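(* Let $b\in\{N,D\}$, $\alpha\ge0$, and let $u=(u(t,x))_{(t,x)\in[0,\infty)\times F}$ be the family of random variables $$u(t,x)=\sum_{k=1}^\infty(1+\lambda^b_k)^{-\alpha/2}X^{b,k}_t\,\phi^b_k(x).$$ Let $$\delta^\alpha=\begin{cases}\frac12\left(1-\frac{d_s}{2}\right),&\alpha\le\frac{d_s}{2},\\[2pt]\frac12(1-d_s+\alpha),&\frac{d_s}{2}<\alpha\le d_s,\\[2pt]\frac12,&\alpha>d_s.\end{cases}$$ Then there exists a version $\tilde u=(\tilde u(t,x))_{(t,x)\in[0,\infty)\times F}$ of $u$ which satisfies: (1) for each $T>0$, $\tilde u$ is almost surely essentially $\delta^\alpha$-Hölder continuous on $[0,T]\times F$ with respect to the metric $R_\infty((s,x),(t,y))=\max\{|s-t|,R(x,y)\}$; (2) for each $t\in[0,\infty)$, $\tilde u(t,\cdot)$ is almost surely essentially $\frac12$-Hölder continuous on $F$ with respect to $R$.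
   Context: Setting. Let $M\ge2$, $I=\{1,\dots,M\}$, let $F$ be a connected compact metric space and $\psi_i:F\to F$ ($i\in I$) injective strict contractions with $F=\bigcup_i\psi_i(F)$. Let $\mathbb W_n=I^n$ ($\mathbb W_0$ contains only the empty word), $\mathbb W_*=\bigcup_{n\ge0}\mathbb W_n$, $\mathbb W=I^{\mathbb N}$. For $w=w_1\dots w_n\in\mathbb W_*$ put $\psi_w=\psi_{w_1}\circ\dots\circ\psi_{w_n}$, $F_w=\psi_w(F)$. Let $\pi:\mathbb W\to F$ be given by $\{\pi(w)\}=\bigcap_nF_{w_1\dots w_n}$. With $\sigma$ the left shift on $\mathbb W$, the post-critical set is $P=\bigcup_{n\ge1}\sigma^n\big(\pi^{-1}(\bigcup_{i\ne j}F_i\cap F_j)\big)$; assume $P$ is finite (so $(F,(\psi_i))$ is a connected post-critically finite self-similar set). Put $F^0=\pi(P)$, $F^n=\bigcup_{w\in\mathbb W_n}\psi_w(F^0)$. Let $(A_0,\mathbf r)$ be a regular irreducible harmonic structure: $\mathbf r=(r_1,\dots,r_M)$ with all $r_i\in(0,1)$; $A_0$ is a real symmetric matrix indexed by $F^0$, non-positive definite, with non-negative off-diagonal entries and kernel exactly the constants; and, with $\mathcal E_0(f,g)=-\sum_{x,y\in F^0}f(x)A_0(x,y)g(y)$, $r_w=\prod_ir_{w_i}$ and $\mathcal E_n(f,g)=\sum_{w\in\mathbb W_n}r_w^{-1}\mathcal E_0(f\circ\psi_w|_{F^0},g\circ\psi_w|_{F^0})$ for $f,g:F^n\to\mathbb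 R$, one has $\mathcal E_0(f,f)=\min\{\mathcal E_1(g,g):g|_{F^0}=f\}$ for all $f$. Let $\mathcal D=\{f\in C(F):\lim_n\mathcal E_n(f|_{F^n},f|_{F^n})<\infty\}$, $\mathcal E(f,g)=\lim_n\mathcal E_n(f|_{F^n},g|_{F^n})$, $\mathcal D_0=\{f\in\mathcal D:f|_{F^0}=0\}$. The resistance metric is $R(x,y)=(\inf\{\mathcal E(f,f):f\in\mathcal D,f(x)=0,f(y)=1\})^{-1}$ for $x\neq y$, $R(x,x)=0$; it induces the topology of $F$. Let $d_H>0$ be the unique number with $\sum_ir_i^{d_H}=1$, $d_s=\frac{2d_H}{d_H+1}$ (the spectral dimension), and $\mu$ the Borel probability measure on $F$ with $\mu(F_w)=r_w^{d_H}$ for all $w\in\mathbb W_*$. Then $(\mathcal E,\mathcal D)$ and $(\mathcal E,\mathcal D_0)$ are regular local Dirichlet forms on $\mathcal H:=L^2(F,\mu)$ and on $L^2(F\setminus F^0,\mu)$ (identified with $\mathcal H$). Let $-L_N$, $-L_D$ be the associated non-negative self-adjoint operators. For $b\in\{N,D\}$, $(\phi^b_k)_{k\ge1}$ is a complete orthonormal basis of $\mathcal H$ of eigenfunctions of $-L_b$ (taken to be their continuous representatives) with eigenvalues $0\le\lambda^b_1\le\lambda^b_2\le\cdots\to\infty$. $W$ is a cylindrical Wiener process on $\mathcal H$ (identity covariance) and $X^{b,k}_t=\int_0^te^{-\lambda^b_k(t-s)}\,d\langle\phi^b_k,W(s)\rangle_\mu$, where $(\langle\phi^b_k,W\rangle_\mu)_{k\ge1}$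 are independent real standard Wiener processes (so the $X^{b,k}$ are independent centred Ornstein–Uhlenbeck processes with unit volatility and rate $\lambda^b_k$, or a Wiener process if $\lambda^b_k=0$). The series defining $u(t,x)$ converges in $L^2(\mathbb P)$ for every $(t,x)$; $u$ is the candidate random-field solution of $du=L_bu\,dt+(1-L_b)^{-\alpha/2}dW$, $u(0)=0$. A version of $u$ is a family $\tilde u$ on the same probability space with $\tilde u(t,x)=u(t,x)$ almost surely for each $(t,x)$. A continuous map $f$ between metric spaces $(M_1,d_1),(M_2,d_2)$ is essentially $\delta$-Hölder continuous, $\delta\in(0,1]$, if for every $\gamma\in(0,\delta)$ there is a constant $\epsilon_\gamma$ with $d_2(f(x),f(y))\le\epsilon_\gamma d_1(x,y)^\gamma$ for all $x,y$. *)

theory Defs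
  imports "HOL-Probability.Probability"
begin

section \<open>Self-similar sets\<close>

text \<open>Finite words are lists over the alphabet \<open>{1..M}\<close>; infinite words are functions on \<^typ>\<open>nat\<close>
  whose value at \<open>0\<close> is the first letter.\<close>

definition words :: "nat \<Rightarrow> nat \<Rightarrow> nat list set" where
  "words M n = {w. length w = n \<and> set w \<subseteq> {1..M}}"

definition inf_words :: "nat \<Rightarrow> (nat \<Rightarrow> nat) set" where
  "inf_words M = {\<omega>. range \<omega> \<subseteq> {1..M}}"

definition shift :: "(nat \<Rightarrow> nat) \<Rightarrow> nat \<Rightarrow> nat" where
  "shift \<omega> = (\<lambda>k. \<omega> (Suc k))"

locale self_similar_set =
  fixes M :: nat and F :: "'a::metric_space set" and \<psi> :: "nat \<Rightarrow> 'a \<Rightarrow> 'a"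
  assumes M_ge_2: "M \<ge> 2"
    and nonempty: "F \<noteq> {}"
    and compact: "compact F"
    and connected: "connected F"
    and injective: "\<And>i. i \<in> {1..M} \<Longrightarrow> inj_on (\<psi> i) F"
    and contraction: "\<And>i. i \<in> {1..M} \<Longrightarrow> \<exists>c<1. c-lipschitz_on F (\<psi> i)"
    and self_similar: "F = (\<Union>i\<in>{1..M}. \<psi> i ` F)"
begin

definition word_map :: "nat list \<Rightarrow> 'a \<Rightarrow> 'a" where
  "word_map w = foldr \<psi> w"

definition cell :: "nat list \<Rightarrow> 'a set" where
  "cell w = word_map w ` F"

definition coding :: "(nat \<Rightarrow> nat) \<Rightarrow> 'a" where
  "coding \<omega> = (THE x. x \<in> (\<Inter>n. cell (map \<omega> [0..<n])))"

definition critical_points :: "'a set" where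
  "critical_points = (\<Union>i\<in>{1..M}. \<Union>j\<in>{1..M} - {i}. (\<psi> i ` F) \<inter> (\<psi> j ` F))"

definition postcritical :: "(nat \<Rightarrow> nat) set" where
  "postcritical =
     (\<Union>n\<in>{1..}. (shift ^^ n) ` {\<omega> \<in> inf_words M. coding \<omega> \<in> critical_points})"

definition boundary :: "'a set" where
  "boundary = coding ` postcritical"

end

locale pcf_self_similar_set = self_similar_set +
  assumes pcf: "finite postcritical"


section \<open>Harmonic structures, energy and the resistance metric\<close>

locale weighted_pcf_set = pcf_self_similar_set M F \<psi>
  for M :: nat and F :: "'a::metric_space set" and \<psi> :: "nat \<Rightarrow> 'a \<Rightarrow> 'a" +
  fixes A :: "'a \<Rightarrow> 'a \<Rightarrow> real" and r :: "nat \<Rightarrow> real"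
begin

definition word_weight :: "nat list \<Rightarrow> real" where
  "word_weight w = prod_list (map r w)"

text \<open>Functions on the boundary \<open>F\<^sup>0\<close>, on \<open>F\<^sup>n = \<Union>w. \<psi>\<^sub>w(F\<^sup>0)\<close> and on \<open>F\<close> are all rendered as functions on
  the whole type. The level-\<open>n\<close> energy only reads its arguments on \<open>F\<^sup>n\<close>.\<close>

definition energy0 :: "('a \<Rightarrow> real) \<Rightarrow> ('a \<Rightarrow> real) \<Rightarrow> real" where
  "energy0 f g = - (\<Sum>x\<in>boundary. \<Sum>y\<in>boundary. f x * A x y * g y)"

definition energy_n :: "nat \<Rightarrow> ('a \<Rightarrow> real) \<Rightarrow> ('a \<Rightarrow> real) \<Rightarrow> real" where
  "energy_n n f g =
     (\<Sum>w\<in>words M n. inverse (word_weight w) * energy0 (f \<circ> word_map w) (g \<circ> word_map w))"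

text \<open>The levels \<open>energy_n n f f\<close> are nondecreasing in \<open>n\<close>, so having a finite limit is convergence
  in the reals.\<close>

definition energy_domain :: "('a \<Rightarrow> real) set" where
  "energy_domain = {f. continuous_on F f \<and> convergent (\<lambda>n. energy_n n f f)}"

definition energy :: "('a \<Rightarrow> real) \<Rightarrow> ('a \<Rightarrow> real) \<Rightarrow> real" where
  "energy f g = lim (\<lambda>n. energy_n n f g)"

definition resistance :: "'a \<Rightarrow> 'a \<Rightarrow> real" where
  "resistance x y =
     (if x = y then 0
      else inverse (Inf {energy f f |f. f \<in> energy_domain \<and> f x = 0 \<and> f y = 1}))"

definition hausdorff_dim :: real where
  "hausdorff_dim = (THE d. d > 0 \<and> (\<Sum>i=1..M. r i powr d) = 1)"

definition spectral_dim :: real where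
  "spectral_dim = 2 * hausdorff_dim / (hausdorff_dim + 1)"

end

locale regular_harmonic_structure = weighted_pcf_set +
  assumes weights: "\<And>i. i \<in> {1..M} \<Longrightarrow> 0 < r i \<and> r i < 1"
    and symmetric: "\<And>x y. x \<in> boundary \<Longrightarrow> y \<in> boundary \<Longrightarrow> A x y = A y x"
    and nonpositive: "\<And>f. (\<Sum>x\<in>boundary. \<Sum>y\<in>boundary. f x * A x y * f y) \<le> 0"
    and off_diagonal: "\<And>x y. x \<in> boundary \<Longrightarrow> y \<in> boundary \<Longrightarrow> x \<noteq> y \<Longrightarrow> 0 \<le> A x y"
    and kernel: "\<And>f. (\<forall>x\<in>boundary. (\<Sum>y\<in>boundary. A x y * f y) = 0)
                       \<longleftrightarrow> (\<exists>c. \<forall>x\<in>boundary. f x = c)"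
    and harmonic: "\<And>f. \<exists>g. is_arg_min (\<lambda>h. energy_n 1 h h) (\<lambda>h. \<forall>x\<in>boundary. h x = f x) g
                           \<and> energy_n 1 g g = energy0 f f"


section \<open>Square-integrable functions\<close>

definition L2_space :: "'a measure \<Rightarrow> ('a \<Rightarrow> real) set" where
  "L2_space N = {f \<in> borel_measurable N. integrable N (\<lambda>x. (f x)\<^sup>2)}"

definition L2_inner :: "'a measure \<Rightarrow> ('a \<Rightarrow> real) \<Rightarrow> ('a \<Rightarrow> real) \<Rightarrow> real" where
  "L2_inner N f g = (\<integral>x. f x * g x \<partial>N)"

definition L2_tendsto :: "'a measure \<Rightarrow> (nat \<Rightarrow> 'a \<Rightarrow> real) \<Rightarrow> ('a \<Rightarrow> real) \<Rightarrow> bool" where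
  "L2_tendsto N f g \<longleftrightarrow>
     (\<forall>n. f n \<in> borel_measurable N) \<and> g \<in> borel_measurable N \<and>
     ((\<lambda>n. \<integral>\<^sup>+x. ennreal ((f n x - g x)\<^sup>2) \<partial>N) \<longlonglongrightarrow> 0)"

definition orthonormal_on :: "'a measure \<Rightarrow> nat set \<Rightarrow> (nat \<Rightarrow> 'a \<Rightarrow> real) \<Rightarrow> bool" where
  "orthonormal_on N K e \<longleftrightarrow>
     (\<forall>k\<in>K. e k \<in> L2_space N) \<and>
     (\<forall>j\<in>K. \<forall>k\<in>K. L2_inner N (e j) (e k) = (if j = k then 1 else 0))"

definition complete_orthonormal_basis :: "'a measure \<Rightarrow> (nat \<Rightarrow> 'a \<Rightarrow> real) \<Rightarrow> bool" where
  "complete_orthonormal_basis N e \<longleftrightarrow>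
     orthonormal_on N UNIV e \<and>
     (\<forall>f\<in>L2_space N. L2_tendsto N (\<lambda>n x. \<Sum>k<n. L2_inner N f (e k) * e k x) f)"


section \<open>The Laplacians\<close>

datatype boundary_condition = Neumann | Dirichlet

locale pcf_dirichlet_space = regular_harmonic_structure M F \<psi> A r
  for M :: nat and F :: "'a::metric_space set" and \<psi> :: "nat \<Rightarrow> 'a \<Rightarrow> 'a"
    and A :: "'a \<Rightarrow> 'a \<Rightarrow> real" and r :: "nat \<Rightarrow> real" +
  fixes \<mu> :: "'a measure"
  assumes borel_on_F: "sets \<mu> = sets (restrict_space borel F)"
    and prob: "prob_space \<mu>"
    and self_similar_measure:
      "\<And>n w. w \<in> words M n \<Longrightarrow> measure \<mu> (cell w) = word_weight w powr hausdorff_dim"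
begin

definition form_domain :: "boundary_condition \<Rightarrow> ('a \<Rightarrow> real) set" where
  "form_domain b = {f \<in> energy_domain. b = Dirichlet \<longrightarrow> (\<forall>x\<in>boundary. f x = 0)}"

text \<open>The graph of the non-negative self-adjoint operator \<open>- L\<^sub>b\<close> on \<open>L\<^sup>2(F, \<mu>)\<close> associated with the
  closed form \<open>(energy, form_domain b)\<close>: \<open>f\<close> is in the domain of \<open>L\<^sub>b\<close> with \<open>- L\<^sub>b f = h\<close> iff \<open>f\<close> is in the
  form domain and \<open>energy f g = \<langle>h, g\<rangle>\<close> for all \<open>g\<close> in the form domain. Elements of \<open>L\<^sup>2\<close> are represented
  by functions, hence the closure under almost-everywhere equality.\<close>

definition neg_laplacian :: "boundary_condition \<Rightarrow> (('a \<Rightarrow> real) \<times> ('a \<Rightarrow> real)) set" where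
  "neg_laplacian b =
     {(f, h). f \<in> L2_space \<mu> \<and> h \<in> L2_space \<mu> \<and>
        (\<exists>f'\<in>form_domain b. (AE x in \<mu>. f x = f' x) \<and>
           (\<forall>g\<in>form_domain b. energy f' g = L2_inner \<mu> h g))}"

text \<open>Indices start at \<open>0\<close>.\<close>

definition eigenbasis :: "boundary_condition \<Rightarrow> (nat \<Rightarrow> real) \<Rightarrow> (nat \<Rightarrow> 'a \<Rightarrow> real) \<Rightarrow> bool" where
  "eigenbasis b lam \<phi> \<longleftrightarrow>
     complete_orthonormal_basis \<mu> \<phi> \<and>
     (\<forall>k. continuous_on F (\<phi> k)) \<and>
     (\<forall>k. (\<phi> k, \<lambda>x. lam k * \<phi> k x) \<in> neg_laplacian b) \<and>
     0 \<le> lam 0 \<and> incseq lam \<and> filterlim lam at_top sequentially"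

end


section \<open>Wiener processes and Wiener integrals\<close>

definition wiener_process :: "'w measure \<Rightarrow> (real \<Rightarrow> 'w \<Rightarrow> real) \<Rightarrow> bool" where
  "wiener_process \<Omega> B \<longleftrightarrow>
     prob_space \<Omega> \<and>
     (\<forall>t\<ge>0. B t \<in> borel_measurable \<Omega>) \<and>
     (AE \<omega> in \<Omega>. B 0 \<omega> = 0) \<and>
     (\<forall>s t. 0 \<le> s \<and> s < t \<longrightarrow>
        distributed \<Omega> lborel (\<lambda>\<omega>. B t \<omega> - B s \<omega>)
          (\<lambda>x. ennreal (normal_density 0 (sqrt (t - s)) x))) \<and>
     (\<forall>p n. 0 \<le> p 0 \<and> incseq p \<longrightarrow>
        prob_space.indep_vars \<Omega> (\<lambda>_. borel) (\<lambda>i \<omega>. B (p (Suc i)) \<omega> - B (p i) \<omega>) {..<n::nat}) \<and>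
     (AE \<omega> in \<Omega>. continuous_on {0..} (\<lambda>t. B t \<omega>))"

definition independent_wiener_processes ::
    "'w measure \<Rightarrow> nat set \<Rightarrow> (nat \<Rightarrow> real \<Rightarrow> 'w \<Rightarrow> real) \<Rightarrow> bool" where
  "independent_wiener_processes \<Omega> K B \<longleftrightarrow>
     (\<forall>k\<in>K. wiener_process \<Omega> (B k)) \<and>
     prob_space.indep_vars \<Omega> (\<lambda>_. Pi\<^sub>M {0..} (\<lambda>_. borel))
       (\<lambda>k \<omega>. restrict (\<lambda>t. B k t \<omega>) {0..}) K"

text \<open>A cylindrical Wiener process on \<open>L\<^sup>2(N)\<close> with identity covariance, given by its pairings
  \<open>W t h = \<langle>h, W(t)\<rangle>\<close> with the elements \<open>h\<close> of \<open>L\<^sup>2(N)\<close>.\<close>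

definition cylindrical_wiener_process ::
    "'w measure \<Rightarrow> 'a measure \<Rightarrow> (real \<Rightarrow> ('a \<Rightarrow> real) \<Rightarrow> 'w \<Rightarrow> real) \<Rightarrow> bool" where
  "cylindrical_wiener_process \<Omega> N W \<longleftrightarrow>
     (\<forall>t\<ge>0. \<forall>h\<in>L2_space N. W t h \<in> borel_measurable \<Omega>) \<and>
     (\<forall>t\<ge>0. \<forall>g\<in>L2_space N. \<forall>h\<in>L2_space N. \<forall>a c.
        AE \<omega> in \<Omega>. W t (\<lambda>x. a * g x + c * h x) \<omega> = a * W t g \<omega> + c * W t h \<omega>) \<and>
     (\<forall>K e. orthonormal_on N K e \<longrightarrow> independent_wiener_processes \<Omega> K (\<lambda>k t. W t (e k)))"

text \<open>The step function with value \<open>c i\<close> on \<open>(p i, p (i + 1)]\<close>, and its integral against \<open>B\<close>.\<close>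

definition step_fun :: "nat \<Rightarrow> (nat \<Rightarrow> real) \<Rightarrow> (nat \<Rightarrow> real) \<Rightarrow> real \<Rightarrow> real" where
  "step_fun m p c s = (\<Sum>i<m. c i * indicator {p i<..p (Suc i)} s)"

definition step_integral ::
    "(real \<Rightarrow> 'w \<Rightarrow> real) \<Rightarrow> nat \<Rightarrow> (nat \<Rightarrow> real) \<Rightarrow> (nat \<Rightarrow> real) \<Rightarrow> 'w \<Rightarrow> real" where
  "step_integral B m p c \<omega> = (\<Sum>i<m. c i * (B (p (Suc i)) \<omega> - B (p i) \<omega>))"

text \<open>\<open>Y\<close> is (a representative of) the Wiener-Ito integral over \<open>[0, t]\<close> of the deterministic integrand
  \<open>f\<close> against the Wiener process \<open>B\<close>: the \<open>L\<^sup>2(\<Omega>)\<close>-limit of the integrals of step functions converging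
  to \<open>f\<close> in \<open>L\<^sup>2([0, t])\<close>. By the Ito isometry the choice of the step functions is irrelevant.\<close>

definition is_wiener_integral ::
    "'w measure \<Rightarrow> (real \<Rightarrow> 'w \<Rightarrow> real) \<Rightarrow> real \<Rightarrow> (real \<Rightarrow> real) \<Rightarrow> ('w \<Rightarrow> real) \<Rightarrow> bool" where
  "is_wiener_integral \<Omega> B t f Y \<longleftrightarrow>
     (\<exists>m p c.
        (\<forall>n. p n 0 = 0 \<and> p n (m n) = t \<and> mono_on {..m n} (p n)) \<and>
        L2_tendsto (restrict_space lborel {0..t}) (\<lambda>n. step_fun (m n) (p n) (c n)) f \<and>
        L2_tendsto \<Omega> (\<lambda>n. step_integral B (m n) (p n) (c n)) Y)"


section \<open>Regularity\<close>

definition essentially_holder ::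
    "real \<Rightarrow> 'a set \<Rightarrow> ('a \<Rightarrow> 'a \<Rightarrow> real) \<Rightarrow> ('a \<Rightarrow> 'b::metric_space) \<Rightarrow> bool" where
  "essentially_holder \<delta> S d f \<longleftrightarrow>
     continuous_map (Metric_space.mtopology S d) euclidean f \<and>
     (\<forall>\<gamma>. 0 < \<gamma> \<and> \<gamma> < \<delta> \<longrightarrow>
        (\<exists>C. \<forall>x\<in>S. \<forall>y\<in>S. dist (f x) (f y) \<le> C * d x y powr \<gamma>))"

definition max_time_metric ::
    "('a \<Rightarrow> 'a \<Rightarrow> real) \<Rightarrow> real \<times> 'a \<Rightarrow> real \<times> 'a \<Rightarrow> real" where
  "max_time_metric R = (\<lambda>(s, x) (t, y). max \<bar>s - t\<bar> (R x y))"

definition holder_exponent :: "real \<Rightarrow> real \<Rightarrow> real" where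
  "holder_exponent ds \<alpha> =
     (if \<alpha> \<le> ds / 2 then 1/2 * (1 - ds / 2)
      else if \<alpha> \<le> ds then 1/2 * (1 - ds + \<alpha>)
      else 1/2)"

definition is_version_on ::
    "'w measure \<Rightarrow> 'i set \<Rightarrow> ('i \<Rightarrow> 'w \<Rightarrow> real) \<Rightarrow> ('i \<Rightarrow> 'w \<Rightarrow> real) \<Rightarrow> bool" where
  "is_version_on \<Omega> I v u \<longleftrightarrow>
     (\<forall>i\<in>I. v i \<in> borel_measurable \<Omega> \<and> (AE \<omega> in \<Omega>. v i \<omega> = u i \<omega>))"

end

theory Submission
  imports Defs
begin

text \<open>
  The field \<open>u\<close> is centred Gaussian, so every even moment of an increment is bounded by a power of
  its variance (\<open>wiener_integral_moment\<close>, \<open>increment_moment\<close>). With moments of every order at hand, chaining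
  loses nothing in the exponent as long as the parameter space has nets of polynomially growing size
  (\<open>kolmogorov_chaining\<close>). The images of one boundary point under the words of length \<open>n\<close> are such nets
  for the resistance metric \<open>R\<close>, because the cell of a word \<open>w\<close> has resistance diameter at most a multiple
  of \<open>r\<^sub>w\<close> (\<open>resistance_cell\<close>). What remains are two variance bounds, and both come from one duality
  argument: a partial sum \<open>S\<close> of the series in question is the value (or the increment) of a finite
  combination \<open>f\<close> of eigenfunctions, and \<open>S\<close> also bounds the energy of \<open>f\<close>, so that a bound for
  evaluations by the energy turns into a quadratic inequality for \<open>S\<close>.

  \<^emph>\<open>Space.\<close> The variance of \<open>u(t, x) - u(t, y)\<close> is at most \<open>2 (1 + t)\<close> times the sum of
  \<open>(\<phi>\<^sub>k(x) - \<phi>\<^sub>k(y))\<^sup>2 / (1 + \<lambda>\<^sub>k)\<close>. Here \<open>(f(x) - f(y))\<^sup>2 \<le> R(x, y) E(f, f)\<close> gives \<open>S\<^sup>2 \<le> R(x, y) S\<close>, so the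
  variance is of order \<open>R(x, y)\<close> and the exponent is \<open>1/2\<close>, whatever \<open>\<alpha>\<close> is (\<open>resolvent_increment_bound\<close>).

  \<^emph>\<open>Time.\<close> With \<open>h = |t - s|\<close>, the variance of \<open>u(t, x) - u(s, x)\<close> is at most four times the sum of
  \<open>(1 + \<lambda>\<^sub>k)\<^sup>-\<^sup>\<alpha> \<phi>\<^sub>k(x)\<^sup>2 h / (1 + \<lambda>\<^sub>k h)\<close>. Averaging over a cell of scale \<open>\<epsilon>\<close> around \<open>x\<close> shows that \<open>f(x)\<^sup>2\<close> is at
  most a multiple of \<open>\<epsilon> E(f, f) + \<epsilon>\<^sup>-\<^sup>d \<parallel>f\<parallel>\<^sup>2\<close>, where \<open>d\<close> is the Hausdorff dimension
  (\<open>point_evaluation_bound\<close>). Balancing the two terms bounds the resolvent density, the sum of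
  \<open>\<phi>\<^sub>k(x)\<^sup>2 / (\<Lambda> + \<lambda>\<^sub>k)\<close>, by a multiple of \<open>\<Lambda>\<^sup>-\<^sup>\<kappa>\<close> with \<open>\<kappa> = 1 - d\<^sub>s / 2\<close> (\<open>resolvent_density_bound\<close>). For
  \<open>\<alpha> \<le> d\<^sub>s / 2\<close> the choice \<open>\<Lambda> = 1 / h\<close> yields the order \<open>h\<^sup>\<kappa>\<close>. For \<open>\<alpha> > d\<^sub>s / 2\<close> a superposition of resolvents at
  dyadic \<open>\<Lambda>\<close> shows that the sum of \<open>(1 + \<lambda>\<^sub>k)\<^sup>-\<^sup>\<alpha> \<phi>\<^sub>k(x)\<^sup>2\<close> is bounded (\<open>spectral_sum_bound\<close>), and the order is \<open>h\<close>.
  In both cases half the power of \<open>h\<close> is at least the asserted Hoelder exponent.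

  That \<open>R\<close> is a metric with these bounds rests on two constructions. Points are separated by functions of
  finite energy obtained by repeated harmonic extension (\<open>energy_domain_separates\<close>). Conversely, a
  function of finite energy is followed along the addresses of a point, where its increments are dominated
  by a geometric series (\<open>energy_coercive\<close>); this bounds oscillations by the energy and hence resistances
  from above.
\<close>

section \<open>Limits in mean square\<close>

lemma sum_square_le: "(a + b)\<^sup>2 \<le> 2 * a\<^sup>2 + 2 * b\<^sup>2" for a b :: real
  using zero_le_power2[of "a - b"] by (simp add: power2_eq_square algebra_simps)

text \<open>The convergence is only of second order, but a subsequence converges almost surely, and by Fatou's lemma
  bounds on integrals of any continuous function of the sequence, such as high moments, pass to the limit.\<close>

lemma Fatou_L2_tendsto:
  assumes Z: "L2_tendsto N Z z" and \<Phi>: "continuous_on UNIV \<Phi>"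
    and bd: "\<forall>\<^sub>F n in sequentially. (\<integral>\<^sup>+\<omega>. ennreal (\<Phi> (Z n \<omega>)) \<partial>N) \<le> ennreal (b n)" and b: "b \<longlonglongrightarrow> B"
  shows "(\<integral>\<^sup>+\<omega>. ennreal (\<Phi> (z \<omega>)) \<partial>N) \<le> ennreal B"
proof -
  have [measurable]: "Z n \<in> borel_measurable N" "z \<in> borel_measurable N" for n
    using Z by (auto simp: L2_tendsto_def)
  have [measurable]: "\<Phi> \<in> borel_measurable borel" using \<Phi> by (rule borel_measurable_continuous_onI)
  have lim0: "(\<lambda>n. \<integral>\<^sup>+\<omega>. ennreal ((Z n \<omega> - z \<omega>)\<^sup>2) \<partial>N) \<longlonglongrightarrow> 0"
    using Z by (simp add: L2_tendsto_def)
  have "eventually (\<lambda>n. (\<integral>\<^sup>+\<omega>. ennreal ((Z n \<omega> - z \<omega>)\<^sup>2) \<partial>N) < 1) sequentially"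
    using order_tendstoD(2)[OF lim0, of 1] by simp
  with bd have "\<forall>\<^sub>F n in sequentially. (\<integral>\<^sup>+\<omega>. ennreal ((Z n \<omega> - z \<omega>)\<^sup>2) \<partial>N) < 1
      \<and> (\<integral>\<^sup>+\<omega>. ennreal (\<Phi> (Z n \<omega>)) \<partial>N) \<le> ennreal (b n)"
    by eventually_elim simp
  then obtain n0 where n0: "\<And>n. n \<ge> n0 \<Longrightarrow> (\<integral>\<^sup>+\<omega>. ennreal ((Z n \<omega> - z \<omega>)\<^sup>2) \<partial>N) < 1"
    and bd0: "\<And>n. n \<ge> n0 \<Longrightarrow> (\<integral>\<^sup>+\<omega>. ennreal (\<Phi> (Z n \<omega>)) \<partial>N) \<le> ennreal (b n)"
    by (auto simp: eventually_sequentially)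
  define D where "D n \<omega> = (Z (n + n0) \<omega> - z \<omega>)\<^sup>2" for n \<omega>
  have intD: "integrable N (D n)" for n
    unfolding D_def using n0[of "n + n0"]
    by (intro integrableI_nonneg) (auto intro: less_trans)
  have limD: "(\<lambda>n. \<integral>\<^sup>+\<omega>. ennreal (D n \<omega>) \<partial>N) \<longlonglongrightarrow> 0"
    using LIMSEQ_ignore_initial_segment[OF lim0, of n0] by (simp add: D_def)
  have nonneg: "0 \<le> D n \<omega>" for n \<omega> by (simp add: D_def)
  have "(\<lambda>n. ennreal (\<integral>\<omega>. D n \<omega> \<partial>N)) \<longlonglongrightarrow> ennreal 0"
    using limD by (subst (asm) nn_integral_eq_integral) (auto simp: intD nonneg)
  then have "(\<lambda>n. (\<integral>\<omega>. D n \<omega> \<partial>N)) \<longlonglongrightarrow> 0"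
    by (subst (asm) tendsto_ennreal_iff) (auto simp: nonneg)
  then have "(\<lambda>n. (\<integral>\<omega>. norm (D n \<omega>) \<partial>N)) \<longlonglongrightarrow> 0" using nonneg by simp
  from tendsto_L1_AE_subseq[OF intD this]
  obtain r :: "nat \<Rightarrow> nat" where r: "strict_mono r" and ae: "AE \<omega> in N. (\<lambda>n. D (r n) \<omega>) \<longlonglongrightarrow> 0" by blast
  have lim_ae: "AE \<omega> in N. ennreal (\<Phi> (z \<omega>)) = liminf (\<lambda>n. ennreal (\<Phi> (Z (r n + n0) \<omega>)))"
    using ae
  proof eventually_elim
    case (elim \<omega>)
    then have "(\<lambda>n. Z (r n + n0) \<omega> - z \<omega>) \<longlonglongrightarrow> 0" by (simp add: power_tendsto_0_iff D_def)
    then have "(\<lambda>n. Z (r n + n0) \<omega>) \<longlonglongrightarrow> z \<omega>" by (simp add: LIM_zero_iff)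
    then have "(\<lambda>n. ennreal (\<Phi> (Z (r n + n0) \<omega>))) \<longlonglongrightarrow> ennreal (\<Phi> (z \<omega>))"
      using \<Phi> by (intro tendsto_ennrealI continuous_on_tendsto_compose[OF \<Phi>]) auto
    then show ?case using lim_imp_Liminf by (metis trivial_limit_sequentially)
  qed
  have "(\<integral>\<^sup>+\<omega>. ennreal (\<Phi> (z \<omega>)) \<partial>N) = (\<integral>\<^sup>+\<omega>. liminf (\<lambda>n. ennreal (\<Phi> (Z (r n + n0) \<omega>))) \<partial>N)"
    by (rule nn_integral_cong_AE[OF lim_ae])
  also have "\<dots> \<le> liminf (\<lambda>n. \<integral>\<^sup>+\<omega>. ennreal (\<Phi> (Z (r n + n0) \<omega>)) \<partial>N)"
    by (rule nn_integral_liminf) auto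
  also have "\<dots> \<le> liminf (\<lambda>n. ennreal (b (r n + n0)))"
    by (intro Liminf_mono always_eventually allI bd0) simp
  also have "\<dots> = ennreal B"
  proof -
    have "(\<lambda>n. b (r n + n0)) \<longlonglongrightarrow> B"
      using LIMSEQ_subseq_LIMSEQ[OF LIMSEQ_ignore_initial_segment[OF b, of n0] r] by (simp add: o_def)
    then show ?thesis by (intro lim_imp_Liminf tendsto_ennrealI) auto
  qed
  finally show ?thesis .
qed

lemma L2_tendsto_add:
  assumes Y: "L2_tendsto N Y y" and Z: "L2_tendsto N Z z"
  shows "L2_tendsto N (\<lambda>n \<omega>. Y n \<omega> + Z n \<omega>) (\<lambda>\<omega>. y \<omega> + z \<omega>)"
proof -
  have [measurable]: "Y n \<in> borel_measurable N" "y \<in> borel_measurable N"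
     "Z n \<in> borel_measurable N" "z \<in> borel_measurable N" for n
    using Y Z by (auto simp: L2_tendsto_def)
  let ?B = "\<lambda>n. 2 * (\<integral>\<^sup>+\<omega>. ennreal ((Y n \<omega> - y \<omega>)\<^sup>2) \<partial>N) + 2 * (\<integral>\<^sup>+\<omega>. ennreal ((Z n \<omega> - z \<omega>)\<^sup>2) \<partial>N)"
  have "(\<lambda>n. \<integral>\<^sup>+\<omega>. ennreal (((Y n \<omega> + Z n \<omega>) - (y \<omega> + z \<omega>))\<^sup>2) \<partial>N) \<longlonglongrightarrow> 0"
  proof (rule tendsto_sandwich[OF _ _ tendsto_const])
    show "\<forall>\<^sub>F n in sequentially. (\<integral>\<^sup>+\<omega>. ennreal (((Y n \<omega> + Z n \<omega>) - (y \<omega> + z \<omega>))\<^sup>2) \<partial>N) \<le> ?B n"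
    proof (intro always_eventually allI)
      fix n
      have "(\<integral>\<^sup>+\<omega>. ennreal (((Y n \<omega> + Z n \<omega>) - (y \<omega> + z \<omega>))\<^sup>2) \<partial>N)
        \<le> (\<integral>\<^sup>+\<omega>. 2 * ennreal ((Y n \<omega> - y \<omega>)\<^sup>2) + 2 * ennreal ((Z n \<omega> - z \<omega>)\<^sup>2) \<partial>N)"
      proof (rule nn_integral_mono)
        fix \<omega>
        have "((Y n \<omega> + Z n \<omega>) - (y \<omega> + z \<omega>))\<^sup>2 \<le> 2 * (Y n \<omega> - y \<omega>)\<^sup>2 + 2 * (Z n \<omega> - z \<omega>)\<^sup>2"
          using sum_square_le[of "Y n \<omega> - y \<omega>" "Z n \<omega> - z \<omega>"] by (simp add: algebra_simps)
        from ennreal_leI[OF this]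
        show "ennreal (((Y n \<omega> + Z n \<omega>) - (y \<omega> + z \<omega>))\<^sup>2)
            \<le> 2 * ennreal ((Y n \<omega> - y \<omega>)\<^sup>2) + 2 * ennreal ((Z n \<omega> - z \<omega>)\<^sup>2)"
          by (subst (asm) ennreal_plus) (auto simp: ennreal_mult)
      qed
      also have "\<dots> = ?B n" by (subst nn_integral_add) (auto simp: nn_integral_cmult)
      finally show "(\<integral>\<^sup>+\<omega>. ennreal (((Y n \<omega> + Z n \<omega>) - (y \<omega> + z \<omega>))\<^sup>2) \<partial>N) \<le> ?B n" .
    qed
    have "?B \<longlonglongrightarrow> 2 * 0 + 2 * 0"
      using Y Z by (intro tendsto_add ennreal_tendsto_cmult) (auto simp: L2_tendsto_def)
    then show "?B \<longlonglongrightarrow> 0" by simp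
  qed auto
  then show ?thesis by (simp add: L2_tendsto_def)
qed

lemma L2_tendsto_finite_sum:
  assumes "finite K" and "\<And>k. k \<in> K \<Longrightarrow> L2_tendsto N (Z k) (z k)"
  shows "L2_tendsto N (\<lambda>n \<omega>. \<Sum>k\<in>K. Z k n \<omega>) (\<lambda>\<omega>. \<Sum>k\<in>K. z k \<omega>)"
  using assms
proof (induction K)
  case (insert j K)
  have "L2_tendsto N (\<lambda>n \<omega>. Z j n \<omega> + (\<Sum>k\<in>K. Z k n \<omega>)) (\<lambda>\<omega>. z j \<omega> + (\<Sum>k\<in>K. z k \<omega>))"
    by (intro L2_tendsto_add insert) (auto intro: insert)
  then show ?case using insert(1,2) by simp
qed (simp add: L2_tendsto_def)

lemma L2_tendsto_cmult:
  assumes "L2_tendsto N Z z"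
  shows "L2_tendsto N (\<lambda>n \<omega>. c * Z n \<omega>) (\<lambda>\<omega>. c * z \<omega>)"
proof -
  have [measurable]: "Z n \<in> borel_measurable N" "z \<in> borel_measurable N" for n
    using assms by (auto simp: L2_tendsto_def)
  have "(\<integral>\<^sup>+\<omega>. ennreal ((c * Z n \<omega> - c * z \<omega>)\<^sup>2) \<partial>N) = ennreal (c\<^sup>2) * (\<integral>\<^sup>+\<omega>. ennreal ((Z n \<omega> - z \<omega>)\<^sup>2) \<partial>N)" for n
    by (simp flip: right_diff_distrib nn_integral_cmult add: power_mult_distrib ennreal_mult)
  moreover have "(\<lambda>n. ennreal (c\<^sup>2) * (\<integral>\<^sup>+\<omega>. ennreal ((Z n \<omega> - z \<omega>)\<^sup>2) \<partial>N)) \<longlonglongrightarrow> ennreal (c\<^sup>2) * 0"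
    using assms by (intro ennreal_tendsto_cmult) (auto simp: L2_tendsto_def)
  ultimately show ?thesis by (simp add: L2_tendsto_def)
qed

section \<open>Gaussian moments of Wiener integrals\<close>

text \<open>The identity holds for all functions \<open>\<beta>\<close> simultaneously. This lets the same coefficients serve twice: for a
  Brownian path they give a sum over disjoint time intervals, that is, of independent increments, and for the
  indicators of half-lines they give the same rearrangement of the integrand.\<close>

lemma common_refinement:
  fixes s t c :: "'j \<Rightarrow> real"
  assumes J: "finite J" and st: "\<And>j. j \<in> J \<Longrightarrow> 0 \<le> s j \<and> s j \<le> t j"
  shows "\<exists>(p :: nat \<Rightarrow> real) n d. incseq p \<and> 0 \<le> p 0 \<and> (\<forall>\<beta> :: real \<Rightarrow> real.
    (\<Sum>j\<in>J. c j * (\<beta> (t j) - \<beta> (s j))) = (\<Sum>i<n. d i * (\<beta> (p (Suc i)) - \<beta> (p i))))"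
proof -
  define T where "T = insert 0 (s ` J \<union> t ` J)"
  define l where "l = sorted_list_of_set T"
  have T: "finite T" "T \<noteq> {}" using J by (auto simp: T_def)
  have l: "sorted l" "set l = T" "l \<noteq> []" using T by (auto simp: l_def)
  define n where "n = length l - 1"
  \<comment> \<open>Constant after the last point, so that \<open>p\<close> is monotone on all of \<^typ>\<open>nat\<close>.\<close>
  define p where "p i = l ! min i n" for i
  have n: "n < length l" using l by (simp add: n_def)
  have "incseq p"
    using l n by (auto intro!: sorted_nth_mono simp: p_def mono_def)
  moreover have "0 \<le> p 0"
  proof -
    have "p 0 \<in> T" using l n by (auto simp: p_def simp flip: l(2))
    then show ?thesis using st by (force simp: T_def)
  qed
  moreover
  have "\<exists>i\<le>n. p i = x" if x: "x \<in> T" for x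
  proof -
    obtain i where "i < length l" "l ! i = x" using x in_set_conv_nth[of x l] unfolding l(2) by blast
    then show ?thesis by (intro exI[of _ i]) (auto simp: p_def n_def)
  qed
  then have "\<forall>j\<in>J. \<exists>i\<le>n. p i = s j" "\<forall>j\<in>J. \<exists>i\<le>n. p i = t j" by (auto simp: T_def)
  then obtain a b where a: "\<And>j. j \<in> J \<Longrightarrow> a j \<le> n \<and> p (a j) = s j"
    and b: "\<And>j. j \<in> J \<Longrightarrow> b j \<le> n \<and> p (b j) = t j" by metis
  have tel: "\<beta> (t j) - \<beta> (s j) = (\<Sum>i<n. (if a j \<le> i \<and> i < b j then 1 else 0) * (\<beta> (p (Suc i)) - \<beta> (p i)))"
    if j: "j \<in> J" for j and \<beta> :: "real \<Rightarrow> real"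
  proof (cases "a j \<le> b j")
    case True
    have "(\<Sum>i<n. (if a j \<le> i \<and> i < b j then 1 else 0) * (\<beta> (p (Suc i)) - \<beta> (p i)))
        = (\<Sum>i\<in>{a j..<b j}. \<beta> (p (Suc i)) - \<beta> (p i))"
      using b[OF j] by (intro sum.mono_neutral_cong_right) auto
    also have "\<dots> = \<beta> (p (b j)) - \<beta> (p (a j))" using True by (rule sum_Suc_diff')
    finally show ?thesis using a b j by simp
  next
    case False
    then have "t j = s j" using a[OF j] b[OF j] st[OF j] \<open>incseq p\<close>
      by (metis incseqD order_antisym linear)
    moreover have "(\<Sum>i<n. (if a j \<le> i \<and> i < b j then 1 else 0) * (\<beta> (p (Suc i)) - \<beta> (p i))) = 0"
      using False by (intro sum.neutral) auto
    ultimately show ?thesis by simp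
  qed
  have "(\<Sum>j\<in>J. c j * (\<beta> (t j) - \<beta> (s j)))
      = (\<Sum>i<n. (\<Sum>j\<in>J. c j * (if a j \<le> i \<and> i < b j then 1 else 0)) * (\<beta> (p (Suc i)) - \<beta> (p i)))" for \<beta> :: "real \<Rightarrow> real"
    by (subst sum.cong[OF refl arg_cong2[where f="(*)", OF refl tel]])
       (auto simp: sum_distrib_left sum_distrib_right mult.assoc intro: sum.swap)
  then have "\<forall>\<beta> :: real \<Rightarrow> real. (\<Sum>j\<in>J. c j * (\<beta> (t j) - \<beta> (s j)))
      = (\<Sum>i<n. (\<lambda>i. \<Sum>j\<in>J. c j * (if a j \<le> i \<and> i < b j then 1 else 0)) i * (\<beta> (p (Suc i)) - \<beta> (p i)))"
    by blast
  ultimately show ?thesis by (intro exI conjI)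
qed

text \<open>The degenerate law has no density and needs its own clause. It is stated pointwise, since it only arises
  from combinations without non-trivial increments.\<close>

definition centred_gaussian :: "'w measure \<Rightarrow> real \<Rightarrow> ('w \<Rightarrow> real) \<Rightarrow> bool" where
  "centred_gaussian \<Omega> V Z \<longleftrightarrow> (V = 0 \<and> (\<forall>\<omega>. Z \<omega> = 0)) \<or>
     (V > 0 \<and> distributed \<Omega> lborel Z (\<lambda>x. ennreal (normal_density 0 (sqrt V) x)))"

lemma centred_gaussian_sum:
  assumes "prob_space \<Omega>" and fin: "finite I" and ind: "prob_space.indep_vars \<Omega> (\<lambda>_. borel) Z I"
    and Z: "\<And>i. i \<in> I \<Longrightarrow> centred_gaussian \<Omega> (V i) (Z i)"
  shows "centred_gaussian \<Omega> (\<Sum>i\<in>I. V i) (\<lambda>\<omega>. \<Sum>i\<in>I. Z i \<omega>)"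
proof -
  interpret prob_space \<Omega> by fact
  define J where "J = {i \<in> I. V i > 0}"
  have J: "finite J" "J \<subseteq> I" using fin by (auto simp: J_def)
  have zero: "V i = 0" "Z i \<omega> = 0" if "i \<in> I - J" for i \<omega>
    using Z[of i] that by (auto simp: J_def centred_gaussian_def)
  have VJ: "(\<Sum>i\<in>I. V i) = (\<Sum>i\<in>J. V i)" and ZJ: "(\<Sum>i\<in>I. Z i \<omega>) = (\<Sum>i\<in>J. Z i \<omega>)" for \<omega>
    using zero by (auto intro!: sum.mono_neutral_right fin J)
  show ?thesis
  proof (cases "J = {}")
    case True
    then show ?thesis by (simp add: VJ ZJ centred_gaussian_def)
  next
    case False
    have pos: "(\<Sum>i\<in>J. V i) > 0" using J False by (intro sum_pos) (auto simp: J_def)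
    have ZD: "0 < sqrt (V i)" "distributed \<Omega> lborel (Z i) (normal_density 0 (sqrt (V i)))" if "i \<in> J" for i
      using Z[of i] that by (auto simp: J_def centred_gaussian_def)
    have "distributed \<Omega> lborel (\<lambda>\<omega>. \<Sum>i\<in>J. Z i \<omega>)
        (normal_density (\<Sum>i\<in>J. 0) (sqrt (\<Sum>i\<in>J. (sqrt (V i))\<^sup>2)))"
      by (rule sum_indep_normal[OF J(1) False indep_vars_subset[OF ind J(2)] ZD])
    moreover have "(\<Sum>i\<in>J. (sqrt (V i))\<^sup>2) = (\<Sum>i\<in>J. V i)"
      by (intro sum.cong) (auto simp: J_def)
    ultimately show ?thesis using pos by (simp add: VJ ZJ centred_gaussian_def)
  qed
qed

lemma centred_gaussian_cmult:
  assumes "prob_space \<Omega>" and Z: "centred_gaussian \<Omega> V Z"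
  shows "centred_gaussian \<Omega> (c\<^sup>2 * V) (\<lambda>\<omega>. c * Z \<omega>)"
proof -
  interpret prob_space \<Omega> by fact
  show ?thesis
  proof (cases "V > 0 \<and> c \<noteq> 0")
    case True
    then have "distributed \<Omega> lborel Z (\<lambda>x. ennreal (normal_density 0 (sqrt V) x))"
      using Z by (auto simp: centred_gaussian_def)
    then have "distributed \<Omega> lborel (\<lambda>\<omega>. 0 + c * Z \<omega>) (normal_density (0 + c * 0) (\<bar>c\<bar> * sqrt V))"
      using True by (intro normal_density_affine) auto
    moreover have "\<bar>c\<bar> * sqrt V = sqrt (c\<^sup>2 * V)" by (simp add: real_sqrt_mult)
    ultimately show ?thesis using True by (simp add: centred_gaussian_def)
  qed (use Z in \<open>auto simp: centred_gaussian_def\<close>)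
qed

lemma centred_gaussian_moment:
  assumes "prob_space \<Omega>" and Z: "centred_gaussian \<Omega> V Z" and m: "m > 0"
  shows "(\<integral>\<^sup>+\<omega>. ennreal (Z \<omega> ^ (2 * m)) \<partial>\<Omega>) = ennreal (fact (2 * m) / (2 ^ m * fact m) * V ^ m)"
proof (cases "V > 0")
  case True
  then have D: "distributed \<Omega> lborel Z (\<lambda>x. ennreal (normal_density 0 (sqrt V) x))"
    using Z by (auto simp: centred_gaussian_def)
  have "(\<integral>\<^sup>+\<omega>. ennreal (Z \<omega> ^ (2 * m)) \<partial>\<Omega>)
      = (\<integral>\<^sup>+x. ennreal (normal_density 0 (sqrt V) x) * ennreal (x ^ (2 * m)) \<partial>lborel)"
    by (rule distributed_nn_integral[OF D, symmetric]) simp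
  also have "\<dots> = (\<integral>\<^sup>+x. ennreal (normal_density 0 (sqrt V) x * (x - 0) ^ (2 * m)) \<partial>lborel)"
    by (intro nn_integral_cong) (simp add: ennreal_mult normal_density_nonneg)
  also have "\<dots> = ennreal (fact (2 * m) / ((2 / (sqrt V)\<^sup>2) ^ m * fact m))"
    using True normal_moment_even[of "sqrt V" 0 m]
    by (subst nn_integral_eq_integral) (auto simp: has_bochner_integral_iff normal_density_nonneg)
  also have "fact (2 * m) / ((2 / (sqrt V)\<^sup>2) ^ m * fact m) = fact (2 * m) / (2 ^ m * fact m) * V ^ m"
    using True by (simp add: power_divide)
  finally show ?thesis .
next
  case False
  then show ?thesis using Z m by (auto simp: centred_gaussian_def power_0_left)
qed

lemma wiener_increment_gaussian:
  assumes "wiener_process \<Omega> B" "0 \<le> s" "s \<le> t"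
  shows "centred_gaussian \<Omega> (t - s) (\<lambda>\<omega>. B t \<omega> - B s \<omega>)"
  using assms unfolding wiener_process_def centred_gaussian_def
  by (cases "s = t") auto

text \<open>After passing to a common refinement the increments are independent, and the squared norm of the step
  function is the sum of their variances; this is the isometry of the Wiener integral.\<close>

lemma wiener_combination_gaussian:
  fixes s t c :: "'i \<Rightarrow> real"
  assumes B: "wiener_process \<Omega> B" and J: "finite J" and st: "\<And>j. j \<in> J \<Longrightarrow> 0 \<le> s j \<and> s j \<le> t j"
  shows "centred_gaussian \<Omega> (\<integral>x. (\<Sum>j\<in>J. c j * indicator {s j<..t j} x)\<^sup>2 \<partial>lborel)
           (\<lambda>\<omega>. \<Sum>j\<in>J. c j * (B (t j) \<omega> - B (s j) \<omega>))"
proof -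
  interpret prob_space \<Omega> using B by (simp add: wiener_process_def)
  have "\<exists>(p :: nat \<Rightarrow> real) n d. incseq p \<and> 0 \<le> p 0 \<and> (\<forall>\<beta> :: real \<Rightarrow> real.
      (\<Sum>j\<in>J. c j * (\<beta> (t j) - \<beta> (s j))) = (\<Sum>i<n. d i * (\<beta> (p (Suc i)) - \<beta> (p i))))"
    by (rule common_refinement) (use J st in auto)
  then obtain p :: "nat \<Rightarrow> real" and n d where pnd: "incseq p \<and> 0 \<le> p 0 \<and> (\<forall>\<beta> :: real \<Rightarrow> real.
      (\<Sum>j\<in>J. c j * (\<beta> (t j) - \<beta> (s j))) = (\<Sum>i<n. d i * (\<beta> (p (Suc i)) - \<beta> (p i))))"
    by (elim exE) (rule that)
  then have p: "incseq p" "0 \<le> p 0" by simp_all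
  have eq: "(\<Sum>j\<in>J. c j * (\<beta> (t j) - \<beta> (s j))) = (\<Sum>i<n. d i * (\<beta> (p (Suc i)) - \<beta> (p i)))" for \<beta> :: "real \<Rightarrow> real"
    using pnd by (elim conjE) (erule spec)
  have p_le: "p i \<le> p (Suc i)" "0 \<le> p i" for i
    using p by (auto simp: incseq_SucD intro: order_trans[OF p(2)] incseqD[OF p(1)])
  have ind: "indicator {u<..v} x = (indicator {..v} x - indicator {..u} x :: real)" if "u \<le> v" for u v x :: real
    using that by (auto simp: indicator_def)
  \<comment> \<open>The refinement identity, read for the indicators of half-lines, identifies the step function.\<close>
  have step: "(\<Sum>j\<in>J. c j * indicator {s j<..t j} x) = (\<Sum>i<n. d i * indicator {p i<..p (Suc i)} x)" for x
    using eq[of "\<lambda>t. indicator {..t} x"] st p_le by (simp add: ind)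
  have sq: "(\<Sum>i<n. d i * indicator {p i<..p (Suc i)} x)\<^sup>2 = (\<Sum>i<n. (d i)\<^sup>2 * indicator {p i<..p (Suc i)} x)" for x
  proof -
    have disj: "indicator {p i<..p (Suc i)} x * indicator {p j<..p (Suc j)} x = (0::real)" if "i \<noteq> j" for i j
    proof -
      have "p (Suc i) \<le> p j \<or> p (Suc j) \<le> p i"
        using that incseqD[OF p(1)] by (metis Suc_leI linorder_neqE_nat)
      then show ?thesis by (auto simp: indicator_def)
    qed
    have "(\<Sum>i<n. d i * indicator {p i<..p (Suc i)} x)\<^sup>2
        = (\<Sum>i<n. \<Sum>j<n. d i * d j * (indicator {p i<..p (Suc i)} x * indicator {p j<..p (Suc j)} x))"
      unfolding power2_eq_square sum_product by (intro sum.cong refl) (simp only: mult_ac)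
    also have "\<dots> = (\<Sum>i<n. \<Sum>j<n. if j = i then (d i)\<^sup>2 * indicator {p i<..p (Suc i)} x else 0)"
      using disj by (intro sum.cong refl) (auto simp: power2_eq_square indicator_def)
    finally show ?thesis by (simp add: sum.delta)
  qed
  have V: "(\<integral>x. (\<Sum>j\<in>J. c j * indicator {s j<..t j} x)\<^sup>2 \<partial>lborel) = (\<Sum>i<n. (d i)\<^sup>2 * (p (Suc i) - p i))"
    unfolding step sq using p_le by (subst Bochner_Integration.integral_sum) (auto intro!: sum.cong)
  have "centred_gaussian \<Omega> (\<Sum>i<n. (d i)\<^sup>2 * (p (Suc i) - p i)) (\<lambda>\<omega>. \<Sum>i<n. d i * (B (p (Suc i)) \<omega> - B (p i) \<omega>))"
  proof (rule centred_gaussian_sum)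
    have "indep_vars (\<lambda>_. borel) (\<lambda>i \<omega>. B (p (Suc i)) \<omega> - B (p i) \<omega>) {..<n}"
      using B p by (simp add: wiener_process_def)
    then show "indep_vars (\<lambda>_. borel) (\<lambda>i \<omega>. d i * (B (p (Suc i)) \<omega> - B (p i) \<omega>)) {..<n}"
      by (rule indep_vars_compose2) simp
  qed (auto intro!: centred_gaussian_cmult wiener_increment_gaussian B p_le prob_space_axioms)
  then show ?thesis unfolding V by (simp only: eq[of "\<lambda>t. B t _"])
qed

lemma independent_wiener_combination_gaussian:
  fixes s t c :: "nat \<Rightarrow> 'j \<Rightarrow> real"
  assumes "prob_space \<Omega>" and B: "independent_wiener_processes \<Omega> UNIV B" and K: "finite K"
    and J: "\<And>k. k \<in> K \<Longrightarrow> finite (J k)" and st: "\<And>k j. k \<in> K \<Longrightarrow> j \<in> J k \<Longrightarrow> 0 \<le> s k j \<and> s k j \<le> t k j"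
  shows "centred_gaussian \<Omega> (\<Sum>k\<in>K. \<integral>x. (\<Sum>j\<in>J k. c k j * indicator {s k j<..t k j} x)\<^sup>2 \<partial>lborel)
           (\<lambda>\<omega>. \<Sum>k\<in>K. \<Sum>j\<in>J k. c k j * (B k (t k j) \<omega> - B k (s k j) \<omega>))"
proof (rule centred_gaussian_sum)
  interpret prob_space \<Omega> by fact
  have "indep_vars (\<lambda>_. Pi\<^sub>M {0..} (\<lambda>_. borel)) (\<lambda>k \<omega>. restrict (\<lambda>t. B k t \<omega>) {0..}) K"
    using B indep_vars_subset[OF _ subset_UNIV] by (auto simp: independent_wiener_processes_def)
  then have "indep_vars (\<lambda>_. borel) (\<lambda>k \<omega>. (\<lambda>f. \<Sum>j\<in>J k. c k j * (f (t k j) - f (s k j))) (restrict (\<lambda>t. B k t \<omega>) {0..})) K"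
  proof (rule indep_vars_compose2)
    fix k assume k: "k \<in> K"
    show "(\<lambda>f. \<Sum>j\<in>J k. c k j * (f (t k j) - f (s k j))) \<in> Pi\<^sub>M {0..} (\<lambda>_. borel) \<rightarrow>\<^sub>M borel"
      using st[OF k] by (intro borel_measurable_sum borel_measurable_times borel_measurable_const borel_measurable_diff
         measurable_component_singleton) (auto intro: order_trans)
  qed
  moreover have "(\<lambda>f. \<Sum>j\<in>J k. c k j * (f (t k j) - f (s k j))) (restrict (\<lambda>t. B k t \<omega>) {0..})
      = (\<Sum>j\<in>J k. c k j * (B k (t k j) \<omega> - B k (s k j) \<omega>))" if "k \<in> K" for k \<omega>
    by (intro sum.cong refl) (use st[OF that] in \<open>auto intro: order_trans\<close>)
  ultimately show "indep_vars (\<lambda>_. borel) (\<lambda>k \<omega>. \<Sum>j\<in>J k. c k j * (B k (t k j) \<omega> - B k (s k j) \<omega>)) K"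
    by (subst indep_vars_cong[OF refl _ refl]) (auto simp: fun_eq_iff)
  show "\<And>k. k \<in> K \<Longrightarrow> centred_gaussian \<Omega> (\<integral>x. (\<Sum>j\<in>J k. c k j * indicator {s k j<..t k j} x)\<^sup>2 \<partial>lborel)
           (\<lambda>\<omega>. \<Sum>j\<in>J k. c k j * (B k (t k j) \<omega> - B k (s k j) \<omega>))"
    using B by (intro wiener_combination_gaussian J st) (auto simp: independent_wiener_processes_def)
qed (use assms in auto)

lemma step_times:
  assumes "mono_on {..m} p" "p 0 = (0::real)" "p m = t" "i < m"
  shows "0 \<le> p i" "p i \<le> p (Suc i)" "p (Suc i) \<le> t"
  using assms(2-4) mono_onD[OF assms(1), of 0 i] mono_onD[OF assms(1), of i "Suc i"]
    mono_onD[OF assms(1), of "Suc i" m] by auto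

lemma step_fun_support:
  assumes "mono_on {..m} p" "p 0 = 0" "p m = t"
  shows "step_fun m p c x = step_fun m p c x * indicator {0..t} x"
  unfolding step_fun_def sum_distrib_right
proof (intro sum.cong refl)
  fix i assume "i \<in> {..<m}"
  then show "c i * indicator {p i<..p (Suc i)} x = c i * indicator {p i<..p (Suc i)} x * indicator {0..t} x"
    using step_times[OF assms, of i] by (auto simp: indicator_def)
qed

lemma step_fun_L2_tendsto:
  assumes p: "\<And>n. p n 0 = 0 \<and> p n (M n) = t \<and> mono_on {..M n} (p n)"
    and lim: "L2_tendsto (restrict_space lborel {0..t}) (\<lambda>n. step_fun (M n) (p n) (c n)) f"
  shows "L2_tendsto lborel (\<lambda>n. step_fun (M n) (p n) (c n)) (\<lambda>x. f x * indicator {0..t} x)"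
proof -
  have "(\<integral>\<^sup>+x. ennreal ((step_fun (M n) (p n) (c n) x - f x * indicator {0..t} x)\<^sup>2) \<partial>lborel)
      = (\<integral>\<^sup>+x. ennreal ((step_fun (M n) (p n) (c n) x - f x)\<^sup>2) \<partial>restrict_space lborel {0..t})" for n
  proof -
    have "step_fun (M n) (p n) (c n) x = 0" if "x \<notin> {0..t}" for x
      using step_fun_support[of "M n" "p n" t "c n" x] p[of n] that by simp
    then show ?thesis
      by (subst nn_integral_restrict_space) (auto intro!: nn_integral_cong simp: indicator_def)
  qed
  moreover have "(\<lambda>x. f x * indicator {0..t} x) \<in> borel_measurable lborel"
    using lim by (simp add: L2_tendsto_def borel_measurable_restrict_space_iff mult.commute)
  moreover have "step_fun (M n) (p n) (c n) \<in> borel_measurable lborel" for n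
    unfolding step_fun_def[abs_def] by measurable
  ultimately show ?thesis using lim by (simp add: L2_tendsto_def)
qed

lemma wiener_integral_approximation:
  assumes "\<forall>k\<in>K. is_wiener_integral \<Omega> (B k) t (f k) (Y k)"
  shows "\<exists>M p c. \<forall>k\<in>K. (\<forall>n. p k n 0 = 0 \<and> p k n (M k n) = t \<and> mono_on {..M k n} (p k n)) \<and>
      L2_tendsto lborel (\<lambda>n. step_fun (M k n) (p k n) (c k n)) (\<lambda>x. f k x * indicator {0..t} x) \<and>
      L2_tendsto \<Omega> (\<lambda>n. step_integral (B k) (M k n) (p k n) (c k n)) (Y k)"
proof -
  have "\<forall>k\<in>K. \<exists>M p c. (\<forall>n. p n 0 = 0 \<and> p n (M n) = t \<and> mono_on {..M n} (p n)) \<and>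
      L2_tendsto lborel (\<lambda>n. step_fun (M n) (p n) (c n)) (\<lambda>x. f k x * indicator {0..t} x) \<and>
      L2_tendsto \<Omega> (\<lambda>n. step_integral (B k) (M n) (p n) (c n)) (Y k)"
  proof
    fix k assume "k \<in> K"
    with assms have "is_wiener_integral \<Omega> (B k) t (f k) (Y k)" by blast
    then show "\<exists>M p c. (\<forall>n. p n 0 = 0 \<and> p n (M n) = t \<and> mono_on {..M n} (p n)) \<and>
      L2_tendsto lborel (\<lambda>n. step_fun (M n) (p n) (c n)) (\<lambda>x. f k x * indicator {0..t} x) \<and>
      L2_tendsto \<Omega> (\<lambda>n. step_integral (B k) (M n) (p n) (c n)) (Y k)"
      unfolding is_wiener_integral_def
    proof (elim exE conjE)
      fix M p c assume p: "\<forall>n. p n 0 = 0 \<and> p n (M n) = t \<and> mono_on {..M n} (p n)"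
        and f: "L2_tendsto (restrict_space lborel {0..t}) (\<lambda>n. step_fun (M n) (p n) (c n)) (f k)"
        and Y: "L2_tendsto \<Omega> (\<lambda>n. step_integral (B k) (M n) (p n) (c n)) (Y k)"
      have "L2_tendsto lborel (\<lambda>n. step_fun (M n) (p n) (c n)) (\<lambda>x. f k x * indicator {0..t} x)"
        by (rule step_fun_L2_tendsto[OF spec[OF p] f])
      with p Y show ?thesis by (intro exI conjI)
    qed
  qed
  then show ?thesis by (simp only: bchoice_iff)
qed

lemma ennreal_integral_le_nn_integral:
  assumes "\<And>x. 0 \<le> f x"
  shows "ennreal (\<integral>x. f x \<partial>N) \<le> (\<integral>\<^sup>+x. ennreal (f x) \<partial>N)"
  using assms by (cases "integrable N f") (auto simp: nn_integral_eq_integral not_integrable_integral_eq)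

text \<open>Two integrals are attached to each process, so that the increments of a series of stochastic convolutions
  both in time and in space are covered. The two approximating step functions live on unrelated partitions;
  the moment bound is proved for the Gaussian approximations and passes to the limit. Comparing the
  norm of the approximations with that of the limit by \<open>sum_square_le\<close> costs the factor 2, which is harmless
  because only the order of magnitude of the moments enters the chaining argument.\<close>

lemma wiener_integral_moment:
  assumes \<Omega>: "prob_space \<Omega>" and B: "independent_wiener_processes \<Omega> UNIV B" and K: "finite K"
    and Y: "\<And>k. k \<in> K \<Longrightarrow> is_wiener_integral \<Omega> (B k) t (f k) (Y k)"
    and Y': "\<And>k. k \<in> K \<Longrightarrow> is_wiener_integral \<Omega> (B k) s (g k) (Y' k)"
    and V0: "\<And>k. k \<in> K \<Longrightarrow> 0 \<le> V k"
    and V: "\<And>k. k \<in> K \<Longrightarrow> (\<integral>\<^sup>+x. ennreal ((a k * (f k x * indicator {0..t} x) + b k * (g k x * indicator {0..s} x))\<^sup>2) \<partial>lborel) \<le> ennreal (V k)"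
    and m: "m > 0"
  shows "(\<integral>\<^sup>+\<omega>. ennreal ((\<Sum>k\<in>K. a k * Y k \<omega> + b k * Y' k \<omega>) ^ (2 * m)) \<partial>\<Omega>)
     \<le> ennreal (fact (2 * m) / (2 ^ m * fact m) * (2 * (\<Sum>k\<in>K. V k)) ^ m)"
proof -
  have "\<forall>k\<in>K. is_wiener_integral \<Omega> (B k) t (f k) (Y k)" by (rule ballI) (rule Y)
  from wiener_integral_approximation[OF this]
  obtain M p c where Mpc: "\<forall>k\<in>K. (\<forall>n. p k n 0 = 0 \<and> p k n (M k n) = t \<and> mono_on {..M k n} (p k n)) \<and>
      L2_tendsto lborel (\<lambda>n. step_fun (M k n) (p k n) (c k n)) (\<lambda>x. f k x * indicator {0..t} x) \<and>
      L2_tendsto \<Omega> (\<lambda>n. step_integral (B k) (M k n) (p k n) (c k n)) (Y k)" by (elim exE) (rule that)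
  have "\<forall>k\<in>K. is_wiener_integral \<Omega> (B k) s (g k) (Y' k)" by (rule ballI) (rule Y')
  from wiener_integral_approximation[OF this]
  obtain M' p' c' where Mpc': "\<forall>k\<in>K. (\<forall>n. p' k n 0 = 0 \<and> p' k n (M' k n) = s \<and> mono_on {..M' k n} (p' k n)) \<and>
      L2_tendsto lborel (\<lambda>n. step_fun (M' k n) (p' k n) (c' k n)) (\<lambda>x. g k x * indicator {0..s} x) \<and>
      L2_tendsto \<Omega> (\<lambda>n. step_integral (B k) (M' k n) (p' k n) (c' k n)) (Y' k)" by (elim exE) (rule that)
  have part: "mono_on {..M k n} (p k n)" "p k n 0 = 0" "p k n (M k n) = t"
    and part': "mono_on {..M' k n} (p' k n)" "p' k n 0 = 0" "p' k n (M' k n) = s" if "k \<in> K" for k n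
    using Mpc Mpc' that by auto
  define Z where "Z n \<omega> = (\<Sum>k\<in>K. a k * step_integral (B k) (M k n) (p k n) (c k n) \<omega>
      + b k * step_integral (B k) (M' k n) (p' k n) (c' k n) \<omega>)" for n \<omega>
  define z where "z \<omega> = (\<Sum>k\<in>K. a k * Y k \<omega> + b k * Y' k \<omega>)" for \<omega>
  define G where "G k n x = a k * step_fun (M k n) (p k n) (c k n) x + b k * step_fun (M' k n) (p' k n) (c' k n) x" for k n x
  have Zlim: "L2_tendsto \<Omega> Z z"
    unfolding Z_def[abs_def] z_def[abs_def]
    using Mpc Mpc' by (intro L2_tendsto_finite_sum K L2_tendsto_add L2_tendsto_cmult) auto
  have gauss: "centred_gaussian \<Omega> (\<Sum>k\<in>K. \<integral>x. (G k n x)\<^sup>2 \<partial>lborel) (Z n)" for n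
  proof -
    let ?J = "\<lambda>k. {..<M k n} <+> {..<M' k n}"
    let ?S = "\<lambda>k. case_sum (p k n) (p' k n)"
    let ?E = "\<lambda>k. case_sum (\<lambda>i. p k n (Suc i)) (\<lambda>i. p' k n (Suc i))"
    let ?C = "\<lambda>k. case_sum (\<lambda>i. a k * c k n i) (\<lambda>i. b k * c' k n i)"
    have "centred_gaussian \<Omega> (\<Sum>k\<in>K. \<integral>x. (\<Sum>j\<in>?J k. ?C k j * indicator {?S k j<..?E k j} x)\<^sup>2 \<partial>lborel)
           (\<lambda>\<omega>. \<Sum>k\<in>K. \<Sum>j\<in>?J k. ?C k j * (B k (?E k j) \<omega> - B k (?S k j) \<omega>))"
    proof (rule independent_wiener_combination_gaussian[OF \<Omega> B K])
      fix k j assume k: "k \<in> K" and j: "j \<in> ?J k"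
      then show "0 \<le> ?S k j \<and> ?S k j \<le> ?E k j"
        using step_times[OF part[OF k, of n]] step_times[OF part'[OF k, of n]] by auto
    qed auto
    moreover have "(\<Sum>j\<in>?J k. ?C k j * indicator {?S k j<..?E k j} x) = G k n x" for k x
      by (simp add: sum.Plus G_def step_fun_def sum_distrib_left mult.assoc del: sum_mult_indicator)
    moreover have "(\<lambda>\<omega>. \<Sum>k\<in>K. \<Sum>j\<in>?J k. ?C k j * (B k (?E k j) \<omega> - B k (?S k j) \<omega>)) = Z n"
      by (simp add: fun_eq_iff sum.Plus Z_def step_integral_def sum_distrib_left mult.assoc)
    ultimately show ?thesis by simp
  qed
  define h where "h k x = a k * (f k x * indicator {0..t} x) + b k * (g k x * indicator {0..s} x)" for k x
  have Glim: "L2_tendsto lborel (G k) (h k)" if "k \<in> K" for k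
    unfolding G_def[abs_def] h_def[abs_def] using Mpc Mpc' that by (intro L2_tendsto_add L2_tendsto_cmult) auto
  define D where "D k n = (\<integral>\<^sup>+x. ennreal ((G k n x - h k x)\<^sup>2) \<partial>lborel)" for k n
  have D: "D k \<longlonglongrightarrow> 0" if "k \<in> K" for k
    using Glim[OF that] by (simp add: L2_tendsto_def D_def[abs_def])
  define W where "W n = (\<Sum>k\<in>K. 2 * V k + 2 * enn2real (D k n))" for n
  have Wlim: "W \<longlonglongrightarrow> (\<Sum>k\<in>K. 2 * V k + 2 * 0)"
    unfolding W_def[abs_def]
  proof (rule tendsto_sum)
    fix k assume k: "k \<in> K"
    have "(\<lambda>n. enn2real (D k n)) \<longlonglongrightarrow> 0"
      by (rule tendsto_enn2real) (use D[OF k] in simp_all)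
    then show "(\<lambda>n. 2 * V k + 2 * enn2real (D k n)) \<longlonglongrightarrow> 2 * V k + 2 * 0"
      by (rule tendsto_add[OF tendsto_const tendsto_mult[OF tendsto_const]])
  qed
  have fin: "\<forall>\<^sub>F n in sequentially. \<forall>k\<in>K. D k n < 1"
    using D by (intro eventually_ball_finite[OF K] ballI order_tendstoD(2)) auto
  have VG: "(\<Sum>k\<in>K. \<integral>x. (G k n x)\<^sup>2 \<partial>lborel) \<le> W n" if n: "\<forall>k\<in>K. D k n < 1" for n
    unfolding W_def
  proof (rule sum_mono)
    fix k assume k: "k \<in> K"
    have [measurable]: "G k n \<in> borel_measurable lborel" "h k \<in> borel_measurable lborel"
      using Glim[OF k] by (auto simp: L2_tendsto_def)
    have "D k n < \<top>" using n k by (auto intro: less_trans)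
    then have Dn: "D k n = ennreal (enn2real (D k n))" by (simp add: less_top[symmetric])
    have "ennreal (\<integral>x. (G k n x)\<^sup>2 \<partial>lborel) \<le> (\<integral>\<^sup>+x. ennreal ((G k n x)\<^sup>2) \<partial>lborel)"
      by (rule ennreal_integral_le_nn_integral) simp
    also have "\<dots> \<le> (\<integral>\<^sup>+x. ennreal 2 * ennreal ((h k x)\<^sup>2) + ennreal 2 * ennreal ((G k n x - h k x)\<^sup>2) \<partial>lborel)"
    proof (rule nn_integral_mono)
      fix x
      have "(G k n x)\<^sup>2 \<le> 2 * (h k x)\<^sup>2 + 2 * (G k n x - h k x)\<^sup>2"
        using sum_square_le[of "h k x" "G k n x - h k x"] by simp
      then show "ennreal ((G k n x)\<^sup>2) \<le> ennreal 2 * ennreal ((h k x)\<^sup>2) + ennreal 2 * ennreal ((G k n x - h k x)\<^sup>2)"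
        by (simp flip: ennreal_mult ennreal_plus del: ennreal_numeral)
    qed
    also have "\<dots> = ennreal 2 * (\<integral>\<^sup>+x. ennreal ((h k x)\<^sup>2) \<partial>lborel) + ennreal 2 * D k n"
      unfolding D_def by (simp add: nn_integral_add nn_integral_cmult del: ennreal_numeral)
    also have "\<dots> \<le> ennreal 2 * ennreal (V k) + ennreal 2 * ennreal (enn2real (D k n))"
      using V[OF k] Dn unfolding h_def by (intro add_mono mult_left_mono) auto
    also have "\<dots> = ennreal (2 * V k + 2 * enn2real (D k n))"
      using V0[OF k] by (simp flip: ennreal_mult ennreal_plus del: ennreal_numeral)
    finally show "(\<integral>x. (G k n x)\<^sup>2 \<partial>lborel) \<le> 2 * V k + 2 * enn2real (D k n)"
      using V0[OF k] by (subst (asm) ennreal_le_iff) auto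
  qed
  let ?c = "fact (2 * m) / (2 ^ m * fact m) :: real"
  have "(\<integral>\<^sup>+\<omega>. ennreal (z \<omega> ^ (2 * m)) \<partial>\<Omega>) \<le> ennreal (?c * (\<Sum>k\<in>K. 2 * V k + 2 * 0) ^ m)"
  proof (rule Fatou_L2_tendsto[OF Zlim, where b="\<lambda>n. ?c * W n ^ m"])
    show "continuous_on UNIV (\<lambda>x::real. x ^ (2 * m))" by (intro continuous_intros)
    show "(\<lambda>n. ?c * W n ^ m) \<longlonglongrightarrow> ?c * (\<Sum>k\<in>K. 2 * V k + 2 * 0) ^ m"
      by (intro tendsto_intros Wlim)
    show "\<forall>\<^sub>F n in sequentially. (\<integral>\<^sup>+\<omega>. ennreal (Z n \<omega> ^ (2 * m)) \<partial>\<Omega>) \<le> ennreal (?c * W n ^ m)"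
      using fin
    proof eventually_elim
      case (elim n)
      have "(\<Sum>k\<in>K. \<integral>x. (G k n x)\<^sup>2 \<partial>lborel) ^ m \<le> W n ^ m"
        by (intro power_mono VG elim sum_nonneg integral_nonneg_AE) auto
      then have "?c * (\<Sum>k\<in>K. \<integral>x. (G k n x)\<^sup>2 \<partial>lborel) ^ m \<le> ?c * W n ^ m"
        by (intro mult_left_mono) auto
      then show ?case
        unfolding centred_gaussian_moment[OF \<Omega> gauss m] by (rule ennreal_leI)
    qed
  qed
  then show ?thesis by (simp add: z_def sum_distrib_left)
qed

section \<open>Variance of the Ornstein-Uhlenbeck kernels\<close>

lemma exp_kernel_norm:
  fixes l a c :: real
  assumes "0 \<le> l" "a \<le> c"
  shows "(\<integral>\<^sup>+x. ennreal ((exp (- l * (c - x)))\<^sup>2) * indicator {a..c} x \<partial>lborel) \<le> ennreal (c - a)"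
    and "0 < l \<Longrightarrow> (\<integral>\<^sup>+x. ennreal ((exp (- l * (c - x)))\<^sup>2) * indicator {a..c} x \<partial>lborel) \<le> ennreal (1 / (2 * l))"
proof -
  have "(\<integral>\<^sup>+x. ennreal ((exp (- l * (c - x)))\<^sup>2) * indicator {a..c} x \<partial>lborel) \<le> (\<integral>\<^sup>+x. indicator {a..c} x \<partial>lborel)"
    using assms(1) by (intro nn_integral_mono) (auto simp: indicator_def power_le_one mult_nonneg_nonneg)
  also have "\<dots> = ennreal (c - a)" using assms(2) by simp
  finally show "(\<integral>\<^sup>+x. ennreal ((exp (- l * (c - x)))\<^sup>2) * indicator {a..c} x \<partial>lborel) \<le> ennreal (c - a)" .
  assume l: "0 < l"
  have "(\<integral>\<^sup>+x. ennreal ((exp (- l * (c - x)))\<^sup>2) * indicator {a..c} x \<partial>lborel)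
      = ennreal ((exp (- l * (c - c)))\<^sup>2 / (2 * l) - (exp (- l * (c - a)))\<^sup>2 / (2 * l))"
    using assms l by (intro nn_integral_FTC_Icc) (auto intro!: derivative_eq_intros simp: power2_eq_square field_simps)
  also have "\<dots> \<le> ennreal (1 / (2 * l))" using l by (intro ennreal_leI) (simp add: field_simps)
  finally show "(\<integral>\<^sup>+x. ennreal ((exp (- l * (c - x)))\<^sup>2) * indicator {a..c} x \<partial>lborel) \<le> ennreal (1 / (2 * l))" .
qed

text \<open>The variance of a kernel with rate \<open>l\<close> over a time span \<open>h\<close> is bounded by the span as well as by the
  inverse rate. The combined bound is twice \<open>1 / (1 / h + l)\<close>, a resolvent weight at the point \<open>1 / h\<close>.\<close>

lemma min_time_rate:
  fixes l h :: real
  assumes l: "0 \<le> l" and h: "0 \<le> h" and X: "X \<le> ennreal h" "0 < l \<Longrightarrow> X \<le> ennreal (1 / l)"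
  shows "X \<le> ennreal (2 * h / (1 + l * h))"
proof (cases "l * h \<le> 1")
  case True
  have "h * (1 + l * h) \<le> h * 2" using True h by (intro mult_left_mono) auto
  then have "h \<le> 2 * h / (1 + l * h)" using l h by (simp add: pos_le_divide_eq add_pos_nonneg)
  then show ?thesis using X(1) by (meson ennreal_leI order_trans)
next
  case False
  then have lp: "0 < l" using l by (cases "l = 0") auto
  have "1 / l \<le> 2 * h / (1 + l * h)" 
  proof -
    have "1 / l * (1 + l * h) \<le> 2 * h" using False lp by (simp add: pos_divide_le_eq mult.commute)
    then show ?thesis using lp h by (simp add: pos_le_divide_eq add_pos_nonneg)
  qed
  then show ?thesis using X(2)[OF lp] by (meson ennreal_leI order_trans)
qed

lemma exp_kernel_variance:
  fixes l t :: real
  assumes l: "0 \<le> l" and t: "0 \<le> t"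
  shows "(\<integral>\<^sup>+x. ennreal ((exp (- l * (t - x)) * indicator {0..t} x)\<^sup>2) \<partial>lborel) \<le> ennreal (2 * t / (1 + l * t))"
proof -
  have eq: "(\<integral>\<^sup>+x. ennreal ((exp (- l * (t - x)) * indicator {0..t} x)\<^sup>2) \<partial>lborel)
      = (\<integral>\<^sup>+x. ennreal ((exp (- l * (t - x)))\<^sup>2) * indicator {0..t} x \<partial>lborel)"
    by (intro nn_integral_cong) (auto simp: indicator_def)
  show ?thesis unfolding eq
  proof (rule min_time_rate[OF l t])
    show "(\<integral>\<^sup>+x. ennreal ((exp (- l * (t - x)))\<^sup>2) * indicator {0..t} x \<partial>lborel) \<le> ennreal t"
      using exp_kernel_norm(1)[OF l t] by simp
    assume "0 < l"
    then show "(\<integral>\<^sup>+x. ennreal ((exp (- l * (t - x)))\<^sup>2) * indicator {0..t} x \<partial>lborel) \<le> ennreal (1 / l)"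
      by (intro order_trans[OF exp_kernel_norm(2)[OF l t]] ennreal_leI) (auto simp: field_simps)
  qed
qed

text \<open>On \<open>[0, s]\<close> the two kernels differ by the factor \<open>d = 1 - exp (- l h)\<close>, which is at most \<open>1\<close> and at most
  \<open>l h\<close>, so that \<open>d\<^sup>2 / (2 l)\<close> has again both bounds of \<open>min_time_rate\<close>; the remaining interval has length \<open>h\<close>.\<close>

lemma exp_kernel_increment_variance:
  fixes l s t :: real
  assumes l: "0 \<le> l" and s: "0 \<le> s" and st: "s \<le> t"
  shows "(\<integral>\<^sup>+x. ennreal ((exp (- l * (t - x)) * indicator {0..t} x - exp (- l * (s - x)) * indicator {0..s} x)\<^sup>2) \<partial>lborel)
     \<le> ennreal (4 * (t - s) / (1 + l * (t - s)))"
proof -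
  define h where "h = t - s"
  have h: "0 \<le> h" using st by (simp add: h_def)
  define d where "d = 1 - exp (- l * h)"
  have d: "0 \<le> d" "d \<le> 1" "d \<le> l * h"
    using l h exp_ge_add_one_self[of "- l * h"] by (auto simp: d_def mult_nonneg_nonneg)
  let ?I = "\<lambda>a c. (\<integral>\<^sup>+x. ennreal ((exp (- l * (c - x)))\<^sup>2) * indicator {a..c} x \<partial>lborel)"
  have pw: "(exp (- l * (t - x)) * indicator {0..t} x - exp (- l * (s - x)) * indicator {0..s} x)\<^sup>2
      \<le> (exp (- l * (t - x)))\<^sup>2 * indicator {s..t} x + d\<^sup>2 * ((exp (- l * (s - x)))\<^sup>2 * indicator {0..s} x)" for x
  proof -
    have "exp (- l * (t - x)) = exp (- l * (s - x)) * exp (- l * h)"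
      by (simp add: h_def algebra_simps flip: exp_add)
    then have "exp (- l * (t - x)) - exp (- l * (s - x)) = - (d * exp (- l * (s - x)))"
      by (simp add: d_def algebra_simps)
    then have "(exp (- l * (t - x)) - exp (- l * (s - x)))\<^sup>2 = d\<^sup>2 * (exp (- l * (s - x)))\<^sup>2"
      by (simp add: power_mult_distrib)
    then show ?thesis using s st by (auto simp: indicator_def)
  qed
  have "(\<integral>\<^sup>+x. ennreal ((exp (- l * (t - x)) * indicator {0..t} x - exp (- l * (s - x)) * indicator {0..s} x)\<^sup>2) \<partial>lborel)
      \<le> (\<integral>\<^sup>+x. ennreal ((exp (- l * (t - x)))\<^sup>2) * indicator {s..t} x
          + ennreal (d\<^sup>2) * (ennreal ((exp (- l * (s - x)))\<^sup>2) * indicator {0..s} x) \<partial>lborel)"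
  proof (rule nn_integral_mono)
    fix x
    have "ennreal ((exp (- l * (t - x)) * indicator {0..t} x - exp (- l * (s - x)) * indicator {0..s} x)\<^sup>2)
       \<le> ennreal ((exp (- l * (t - x)))\<^sup>2 * indicator {s..t} x + d\<^sup>2 * ((exp (- l * (s - x)))\<^sup>2 * indicator {0..s} x))"
      by (rule ennreal_leI[OF pw])
    also have "\<dots> = ennreal ((exp (- l * (t - x)))\<^sup>2) * indicator {s..t} x
          + ennreal (d\<^sup>2) * (ennreal ((exp (- l * (s - x)))\<^sup>2) * indicator {0..s} x)"
      by (auto simp: ennreal_mult indicator_def)
    finally show "ennreal ((exp (- l * (t - x)) * indicator {0..t} x - exp (- l * (s - x)) * indicator {0..s} x)\<^sup>2)
       \<le> ennreal ((exp (- l * (t - x)))\<^sup>2) * indicator {s..t} x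
          + ennreal (d\<^sup>2) * (ennreal ((exp (- l * (s - x)))\<^sup>2) * indicator {0..s} x)" .
  qed
  also have "\<dots> = ?I s t + ennreal (d\<^sup>2) * ?I 0 s"
    by (subst nn_integral_add) (auto simp: nn_integral_cmult)
  also have "\<dots> \<le> ennreal (2 * h / (1 + l * h)) + ennreal (2 * h / (1 + l * h))"
  proof (rule add_mono)
    show "?I s t \<le> ennreal (2 * h / (1 + l * h))"
    proof (rule min_time_rate[OF l h])
      show "?I s t \<le> ennreal h" using exp_kernel_norm(1)[OF l st] by (simp add: h_def)
      assume "0 < l"
      then show "?I s t \<le> ennreal (1 / l)"
        by (intro order_trans[OF exp_kernel_norm(2)[OF l st]] ennreal_leI) (auto simp: field_simps)
    qed
    show "ennreal (d\<^sup>2) * ?I 0 s \<le> ennreal (2 * h / (1 + l * h))"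
    proof (cases "l = 0")
      case True
      then have "d = 0" by (simp add: d_def)
      then show ?thesis by simp
    next
      case False
      then have lp: "0 < l" using l by simp
      have "ennreal (d\<^sup>2) * ?I 0 s \<le> ennreal (d\<^sup>2) * ennreal (1 / (2 * l))"
        by (intro mult_left_mono exp_kernel_norm l s lp) auto
      also have "\<dots> = ennreal (d\<^sup>2 / (2 * l))" using lp by (simp flip: ennreal_mult)
      finally have I: "ennreal (d\<^sup>2) * ?I 0 s \<le> ennreal (d\<^sup>2 / (2 * l))" .
      have "d\<^sup>2 \<le> 1 * (l * h)" unfolding power2_eq_square using d by (intro mult_mono) auto
      also have "\<dots> \<le> h * (2 * l)" using lp h by simp
      finally have 1: "d\<^sup>2 / (2 * l) \<le> h" using lp by (simp add: pos_divide_le_eq)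
      have "d\<^sup>2 \<le> 1" using d by (simp add: power_le_one)
      then have 2: "d\<^sup>2 / (2 * l) \<le> 1 / l" using lp by (simp add: divide_simps)
      show ?thesis
        by (rule min_time_rate[OF l h]; rule order_trans[OF I]; intro ennreal_leI 1 2)
    qed
  qed
  also have "\<dots> = ennreal (4 * (t - s) / (1 + l * (t - s)))"
    using l h by (subst ennreal_plus[symmetric]) (auto simp: h_def intro!: divide_nonneg_nonneg)
  finally show ?thesis .
qed

section \<open>Chaining along nets of polynomial size\<close>

lemma geometric_increments_limit:
  fixes s :: "nat \<Rightarrow> real"
  assumes q: "0 \<le> q" "q < 1" and inc: "\<And>m. m \<ge> n \<Longrightarrow> \<bar>s (Suc m) - s m\<bar> \<le> B * q ^ m"
  shows "\<bar>lim s - s n\<bar> \<le> B * q ^ n / (1 - q)"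
proof -
  have sm: "summable (\<lambda>m. B * q ^ (m + n))"
    using q by (intro summable_mult summable_ignore_initial_segment summable_geometric) auto
  have sm_abs: "summable (\<lambda>m. norm (s (Suc (m + n)) - s (m + n)))"
    by (rule summable_comparison_test'[OF sm, of 0]) (use inc in auto)
  then have sm': "summable (\<lambda>m. s (Suc (m + n)) - s (m + n))"
    by (rule summable_norm_cancel)
  have part: "(\<Sum>m<k. s (Suc (m + n)) - s (m + n)) = s (k + n) - s n" for k
    by (induction k) auto
  have lim': "(\<lambda>k. s (k + n) - s n) \<longlonglongrightarrow> (\<Sum>m. s (Suc (m + n)) - s (m + n))"
    using summable_LIMSEQ[OF sm'] by (simp add: part)
  have "(\<lambda>k. s (k + n) - s n + s n) \<longlonglongrightarrow> (\<Sum>m. s (Suc (m + n)) - s (m + n)) + s n"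
    by (intro tendsto_add lim' tendsto_const)
  then have *: "s \<longlonglongrightarrow> (\<Sum>m. s (Suc (m + n)) - s (m + n)) + s n"
    using LIMSEQ_offset[of s n] by simp
  have "\<bar>lim s - s n\<bar> = norm (\<Sum>m. s (Suc (m + n)) - s (m + n))"
    using limI[OF *] by simp
  also have "\<dots> \<le> (\<Sum>m. norm (s (Suc (m + n)) - s (m + n)))"
    by (rule summable_norm[OF sm_abs])
  also have "\<dots> \<le> (\<Sum>m. B * q ^ (m + n))"
    by (intro suminf_le sm_abs sm) (use inc in auto)
  also have "\<dots> = (B * q ^ n) * (\<Sum>m. q ^ m)"
    using q by (subst suminf_mult[symmetric]) (auto simp: power_add mult_ac intro: summable_geometric)
  also have "\<dots> = B * q ^ n / (1 - q)"
    using q by (subst suminf_geometric) auto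
  finally show "\<bar>lim s - s n\<bar> \<le> B * q ^ n / (1 - q)" .
qed

lemma powr_lt_one:
  fixes x s :: real
  assumes "0 < x" "x < 1" "0 < s"
  shows "x powr s < 1"
  using powr_less_mono2[of s x 1] assms by simp

text \<open>A bounded metric space with maps \<open>a n\<close> that send each point to a nearby point of a finite net. The growth
  rate \<open>L\<close> of the nets is arbitrary, since moments of all orders will be available to compensate for it.\<close>

locale approximating_nets =
  fixes S :: "'s set" and d :: "'s \<Rightarrow> 's \<Rightarrow> real" and a :: "nat \<Rightarrow> 's \<Rightarrow> 's"
    and c \<rho> K L \<Delta> :: real
  assumes d_nonneg: "\<And>x y. 0 \<le> d x y"
    and d_sym: "\<And>x y. d x y = d y x"
    and d_zero: "\<And>x y. x \<in> S \<Longrightarrow> y \<in> S \<Longrightarrow> d x y = 0 \<longleftrightarrow> x = y"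
    and d_triangle: "\<And>x y z. x \<in> S \<Longrightarrow> y \<in> S \<Longrightarrow> z \<in> S \<Longrightarrow> d x z \<le> d x y + d y z"
    and d_bounded: "\<And>x y. x \<in> S \<Longrightarrow> y \<in> S \<Longrightarrow> d x y \<le> \<Delta>"
    and \<rho>: "0 < \<rho>" "\<rho> < 1"
    and net_in: "\<And>n z. z \<in> S \<Longrightarrow> a n z \<in> S"
    and net_dist: "\<And>n z. z \<in> S \<Longrightarrow> d z (a n z) \<le> c * \<rho> ^ n"
    and net_finite: "\<And>n. finite (a n ` S)"
    and net_card: "\<And>n. real (card (a n ` S)) \<le> K * L ^ n"
    and constants: "0 \<le> c" "0 \<le> K" "1 \<le> L" "0 \<le> \<Delta>"
begin

text \<open>Both kinds of comparison made by chaining are included: between points of one net at the level where it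
  resolves their distance, and between successive approximations of one point.\<close>

definition close_pairs :: "nat \<Rightarrow> ('s \<times> 's) set" where
  "close_pairs n = {(p, q). p \<in> a n ` S \<and> q \<in> a n ` S \<union> a (Suc n) ` S \<and> d p q \<le> (2 * c + \<Delta> + 1) * \<rho> ^ n}"

lemma finite_close_pairs: "finite (close_pairs n)"
  by (rule finite_subset[of _ "a n ` S \<times> (a n ` S \<union> a (Suc n) ` S)"])
     (auto simp: close_pairs_def net_finite)

lemma card_close_pairs: "real (card (close_pairs n)) \<le> K\<^sup>2 * (1 + L) * (L\<^sup>2) ^ n"
proof -
  have "card (close_pairs n) \<le> card (a n ` S \<times> (a n ` S \<union> a (Suc n) ` S))"
    by (rule card_mono) (auto simp: close_pairs_def net_finite)
  also have "\<dots> \<le> card (a n ` S) * (card (a n ` S) + card (a (Suc n) ` S))"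
    by (simp add: card_cartesian_product card_Un_le)
  finally have "real (card (close_pairs n)) \<le> real (card (a n ` S)) * (real (card (a n ` S)) + real (card (a (Suc n) ` S)))"
    by (metis of_nat_add of_nat_mult of_nat_mono)
  also have "\<dots> \<le> (K * L ^ n) * (K * L ^ n + K * L ^ Suc n)"
    using constants by (intro mult_mono add_mono net_card) auto
  also have "\<dots> = K\<^sup>2 * (1 + L) * (L\<^sup>2) ^ n"
    by (simp add: power2_eq_square algebra_simps flip: power_mult_distrib)
  finally show ?thesis .
qed

lemma successive_close:
  assumes "z \<in> S"
  shows "(a n z, a (Suc n) z) \<in> close_pairs n"
proof -
  have "d (a n z) (a (Suc n) z) \<le> d z (a n z) + d z (a (Suc n) z)"
    using d_triangle[of "a n z" z "a (Suc n) z"] assms net_in d_sym by metis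
  also have "\<dots> \<le> c * \<rho> ^ n + c * \<rho> ^ n"
  proof (intro add_mono)
    have "c * \<rho> ^ Suc n \<le> c * \<rho> ^ n" using \<rho> constants by (intro mult_left_mono power_decreasing) auto
    then show "d z (a (Suc n) z) \<le> c * \<rho> ^ n" using net_dist[OF assms, of "Suc n"] by linarith
  qed (rule net_dist[OF assms])
  also have "\<dots> \<le> (2 * c + \<Delta> + 1) * \<rho> ^ n"
    using \<rho> constants by (simp add: algebra_simps)
  finally show ?thesis using assms by (auto simp: close_pairs_def)
qed

lemma net_tendsto:
  assumes "z \<in> S"
  shows "(\<lambda>n. d z (a n z)) \<longlonglongrightarrow> 0"
proof (rule tendsto_sandwich[OF _ _ tendsto_const])
  show "(\<lambda>n. c * \<rho> ^ n) \<longlonglongrightarrow> 0"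
    using \<rho> by (intro tendsto_mult_right_zero LIMSEQ_power_zero) auto
qed (auto simp: d_nonneg net_dist assms)

text \<open>Two points are compared at the level \<open>n\<close> at which their distance is about \<open>\<rho> ^ n\<close>. From there on the chains
  of approximations leading to the two points contribute geometric series.\<close>

lemma close_pairs_imp_holder:
  fixes U :: "'s \<Rightarrow> real"
  assumes \<gamma>: "0 < \<gamma>"
    and B: "\<And>n p q. (p, q) \<in> close_pairs n \<Longrightarrow> \<bar>U p - U q\<bar> \<le> B * (\<rho> powr \<gamma>) ^ n"
  shows "\<exists>C. \<forall>x\<in>S. \<forall>y\<in>S. \<bar>lim (\<lambda>n. U (a n x)) - lim (\<lambda>n. U (a n y))\<bar> \<le> C * d x y powr \<gamma>"
proof -
  define q where "q = \<rho> powr \<gamma>"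
  have q: "0 < q" "q < 1" 
    using \<rho> \<gamma> by (auto simp: q_def powr_lt_one)
  have inc: "\<bar>U (a (Suc m) z) - U (a m z)\<bar> \<le> B * q ^ m" if "z \<in> S" for z m
    using B[OF successive_close[OF that, of m]] by (simp add: q_def abs_minus_commute)
  have near: "\<bar>lim (\<lambda>n. U (a n z)) - U (a m z)\<bar> \<le> B * q ^ m / (1 - q)" if "z \<in> S" for z m
    using geometric_increments_limit[of q m "\<lambda>n. U (a n z)" B] q inc[OF that] by auto
  have "\<bar>lim (\<lambda>n. U (a n x)) - lim (\<lambda>n. U (a n y))\<bar> \<le> (\<bar>B\<bar> * (1 + 2 / (1 - q)) / q) * d x y powr \<gamma>"
    if x: "x \<in> S" and y: "y \<in> S" for x y
  proof (cases "x = y")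
    case False
    then have dp: "d x y > 0" using d_nonneg[of x y] d_zero[OF x y] by simp
    \<comment> \<open>The level at which the nets resolve the distance of the two points.\<close>
    obtain n where n: "\<rho> ^ Suc n < d x y" "n = 0 \<or> d x y \<le> \<rho> ^ n"
    proof -
      have ex: "\<exists>n. \<rho> ^ Suc n < d x y"
      proof -
        obtain k where "\<rho> ^ k < d x y" using real_arch_pow_inv[OF dp \<rho>(2)] by blast
        moreover have "\<rho> ^ Suc k \<le> \<rho> ^ k" using \<rho> by (intro power_decreasing) auto
        ultimately have "\<rho> ^ Suc k < d x y" by linarith
        then show ?thesis by blast
      qed
      define n where "n = (LEAST n. \<rho> ^ Suc n < d x y)"
      have "\<rho> ^ Suc n < d x y" unfolding n_def by (rule LeastI_ex[OF ex])
      moreover have "n = 0 \<or> d x y \<le> \<rho> ^ n"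
      proof (cases n)
        case (Suc k)
        then have "\<not> \<rho> ^ Suc k < d x y" unfolding n_def using not_less_Least by (metis lessI)
        then show ?thesis using Suc by simp
      qed simp
      ultimately show ?thesis using that by blast
    qed
    have dn: "d x y \<le> (\<Delta> + 1) * \<rho> ^ n"
    proof -
      have "0 < \<rho> ^ n" using \<rho> by simp
      then have "\<rho> ^ n \<le> (\<Delta> + 1) * \<rho> ^ n" using constants by (simp add: algebra_simps)
      then show ?thesis using n(2) d_bounded[OF x y] by auto
    qed
    have "d (a n x) (a n y) \<le> d x (a n x) + (d x y + d y (a n y))"
      using d_triangle[of "a n x" x "a n y"] d_triangle[of x y "a n y"] x y net_in d_sym
      by (smt (verit))
    also have "\<dots> \<le> c * \<rho> ^ n + ((\<Delta> + 1) * \<rho> ^ n + c * \<rho> ^ n)"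
      using net_dist x y dn by (intro add_mono) auto
    finally have "d (a n x) (a n y) \<le> (2 * c + \<Delta> + 1) * \<rho> ^ n" by (simp add: algebra_simps)
    then have "(a n x, a n y) \<in> close_pairs n" using x y by (auto simp: close_pairs_def)
    then have "\<bar>U (a n x) - U (a n y)\<bar> \<le> B * q ^ n" using B by (auto simp: q_def)
    then have "\<bar>lim (\<lambda>n. U (a n x)) - lim (\<lambda>n. U (a n y))\<bar> \<le> B * q ^ n + 2 * (B * q ^ n / (1 - q))"
      using near[OF x, of n] near[OF y, of n] by linarith
    also have "\<dots> = B * ((1 + 2 / (1 - q)) * q ^ n)" by (simp add: algebra_simps)
    also have "\<dots> \<le> \<bar>B\<bar> * ((1 + 2 / (1 - q)) * q ^ n)"
      using q by (intro mult_right_mono) (auto intro!: mult_nonneg_nonneg add_nonneg_nonneg)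
    also have "\<dots> = \<bar>B\<bar> * (1 + 2 / (1 - q)) / q * q ^ Suc n"
      using q by simp
    also have "\<dots> \<le> \<bar>B\<bar> * (1 + 2 / (1 - q)) / q * d x y powr \<gamma>"
    proof (intro mult_left_mono)
      have "q ^ Suc n = (\<rho> ^ Suc n) powr \<gamma>"
        using \<rho> by (simp add: q_def powr_mult powr_powr flip: powr_realpow) (simp add: powr_mult powr_powr mult.commute)
      also have "\<dots> \<le> d x y powr \<gamma>" using n(1) \<rho> \<gamma> by (intro powr_mono2) auto
      finally show "q ^ Suc n \<le> d x y powr \<gamma>" .
    qed (use q in \<open>auto intro!: divide_nonneg_nonneg mult_nonneg_nonneg add_nonneg_nonneg\<close>)
    finally show ?thesis .
  qed (use d_zero[OF x y] in auto)
  then show "\<exists>C. \<forall>x\<in>S. \<forall>y\<in>S. \<bar>lim (\<lambda>n. U (a n x)) - lim (\<lambda>n. U (a n y))\<bar> \<le> C * d x y powr \<gamma>"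
    by blast
qed

text \<open>At level \<open>n\<close> there are at most about \<open>L ^ (2 * n)\<close> close pairs, while the moment of order \<open>2 * m\<close> of an
  increment divided by its desired size \<open>\<rho> powr (\<gamma> * n)\<close> is of order \<open>\<rho> powr (2 * m * (\<beta> - \<gamma>) * n)\<close>. For large \<open>m\<close>
  the sum over all levels has finite expectation and therefore bounds all increments at once.\<close>

lemma AE_close_pairs:
  assumes meas [measurable]: "\<And>z. z \<in> S \<Longrightarrow> U z \<in> borel_measurable \<Omega>"
    and \<gamma>: "0 < \<gamma>" "\<gamma> < \<beta>"
    and mom: "\<And>m::nat. m > 0 \<Longrightarrow> \<exists>C\<ge>0. \<forall>x\<in>S. \<forall>y\<in>S.
        (\<integral>\<^sup>+\<omega>. ennreal ((U x \<omega> - U y \<omega>) ^ (2 * m)) \<partial>\<Omega>) \<le> ennreal (C * (d x y powr \<beta>) ^ (2 * m))"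
  shows "AE \<omega> in \<Omega>. \<exists>B. \<forall>n p q. (p, q) \<in> close_pairs n \<longrightarrow> \<bar>U p \<omega> - U q \<omega>\<bar> \<le> B * (\<rho> powr \<gamma>) ^ n"
proof -
  define t where "t = \<rho> powr (\<beta> - \<gamma>)"
  have t: "0 < t" "t < 1" using \<rho> \<gamma> by (auto simp: t_def powr_lt_one)
  \<comment> \<open>A moment so high that it beats the polynomial number of pairs.\<close>
  obtain m where m: "m > 0" "L\<^sup>2 * (t ^ (2 * m)) \<le> 1 / 2"
  proof -
    have "0 < 1 / (2 * L\<^sup>2)" using constants by simp
    then obtain k where k: "t ^ k < 1 / (2 * L\<^sup>2)" using real_arch_pow_inv t(2) by blast
    have "t ^ (2 * Suc k) \<le> t ^ k" using t by (intro power_decreasing) auto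
    then have "t ^ (2 * Suc k) \<le> 1 / (2 * L\<^sup>2)" using k by linarith
    then have "L\<^sup>2 * (t ^ (2 * Suc k)) \<le> L\<^sup>2 * (1 / (2 * L\<^sup>2))" by (intro mult_left_mono) auto
    also have "\<dots> = 1 / 2" using constants by simp
    finally show ?thesis by (intro that[of "Suc k"]) auto
  qed
  obtain C where C: "C \<ge> 0" "\<And>x y. x \<in> S \<Longrightarrow> y \<in> S \<Longrightarrow>
      (\<integral>\<^sup>+\<omega>. ennreal ((U x \<omega> - U y \<omega>) ^ (2 * m)) \<partial>\<Omega>) \<le> ennreal (C * (d x y powr \<beta>) ^ (2 * m))"
    using mom[OF m(1)] by blast
  define q where "q = \<rho> powr \<gamma>"
  have q: "0 < q" "q < 1" using \<rho> \<gamma> by (auto simp: q_def powr_lt_one)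
  define D where "D = (2 * c + \<Delta> + 1) powr \<beta>"
  define H where "H = C * D ^ (2 * m)"
  define e where "e n p \<omega> = ennreal (((U (fst p) \<omega> - U (snd p) \<omega>) / q ^ n) ^ (2 * m))" for n p \<omega>
  define G where "G \<omega> = (\<Sum>n. \<Sum>p\<in>close_pairs n. e n p \<omega>)" for \<omega>
  have cpS: "fst p \<in> S" "snd p \<in> S" if "p \<in> close_pairs n" for p n
    using that net_in by (auto simp: close_pairs_def)
  have e_meas: "e n p \<in> borel_measurable \<Omega>" if p: "p \<in> close_pairs n" for p n
  proof -
    note [measurable] = meas[OF cpS(1)[OF p]] meas[OF cpS(2)[OF p]]
    show ?thesis unfolding e_def[abs_def] by measurable
  qed
  have pair: "(\<integral>\<^sup>+\<omega>. e n p \<omega> \<partial>\<Omega>) \<le> ennreal (H * (t ^ (2 * m)) ^ n)" if p: "p \<in> close_pairs n" for p n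
  proof -
    let ?x = "fst p" and ?y = "snd p" and ?s = "inverse ((q ^ n) ^ (2 * m))"
    note [measurable] = meas[OF cpS(1)[OF p]] meas[OF cpS(2)[OF p]]
    have "(\<integral>\<^sup>+\<omega>. e n p \<omega> \<partial>\<Omega>) = (\<integral>\<^sup>+\<omega>. ennreal ?s * ennreal ((U ?x \<omega> - U ?y \<omega>) ^ (2 * m)) \<partial>\<Omega>)"
      unfolding e_def using q by (intro nn_integral_cong, subst ennreal_mult[symmetric])
        (auto simp: power_divide field_simps intro!: zero_le_even_power)
    also have "\<dots> = ennreal ?s * (\<integral>\<^sup>+\<omega>. ennreal ((U ?x \<omega> - U ?y \<omega>) ^ (2 * m)) \<partial>\<Omega>)"
      by (rule nn_integral_cmult) simp
    also have "\<dots> \<le> ennreal ?s * ennreal (C * (d ?x ?y powr \<beta>) ^ (2 * m))"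
      by (intro mult_left_mono C cpS[OF p]) auto
    also have "\<dots> = ennreal (?s * (C * (d ?x ?y powr \<beta>) ^ (2 * m)))"
      using q C(1) by (subst ennreal_mult) auto
    also have "?s * (C * (d ?x ?y powr \<beta>) ^ (2 * m)) \<le> H * (t ^ (2 * m)) ^ n"
    proof -
      have "d ?x ?y powr \<beta> \<le> ((2 * c + \<Delta> + 1) * \<rho> ^ n) powr \<beta>"
        using p \<gamma> d_nonneg by (intro powr_mono2) (auto simp: close_pairs_def)
      also have "\<dots> = D * (\<rho> powr \<beta>) ^ n"
        using \<rho> constants by (simp add: D_def powr_mult powr_powr mult.commute flip: powr_realpow)
      also have "\<rho> powr \<beta> = t * q" by (simp add: t_def q_def flip: powr_add)
      finally have "(d ?x ?y powr \<beta>) ^ (2 * m) \<le> (D * (t * q) ^ n) ^ (2 * m)"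
        by (intro power_mono) auto
      then have "?s * (C * (d ?x ?y powr \<beta>) ^ (2 * m)) \<le> ?s * (C * (D * (t * q) ^ n) ^ (2 * m))"
        using q C(1) by (intro mult_left_mono) auto
      also have "\<dots> = H * (t ^ n) ^ (2 * m)"
        using q by (simp add: H_def power_mult_distrib field_simps)
      also have "(t ^ n) ^ (2 * m) = (t ^ (2 * m)) ^ n"
        by (simp add: mult.commute flip: power_mult)
      finally show ?thesis .
    qed
    finally show ?thesis by (simp add: ennreal_leI)
  qed
  have H0: "0 \<le> H" using C(1) by (simp add: H_def D_def)
  have level: "(\<integral>\<^sup>+\<omega>. (\<Sum>p\<in>close_pairs n. e n p \<omega>) \<partial>\<Omega>) \<le> ennreal (K\<^sup>2 * (1 + L) * H * (1 / 2) ^ n)" for n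
  proof -
    have "(\<integral>\<^sup>+\<omega>. (\<Sum>p\<in>close_pairs n. e n p \<omega>) \<partial>\<Omega>) = (\<Sum>p\<in>close_pairs n. \<integral>\<^sup>+\<omega>. e n p \<omega> \<partial>\<Omega>)"
      by (rule nn_integral_sum) (rule e_meas)
    also have "\<dots> \<le> (\<Sum>p\<in>close_pairs n. ennreal (H * (t ^ (2 * m)) ^ n))"
      by (intro sum_mono pair)
    also have "\<dots> = ennreal (real (card (close_pairs n)) * (H * (t ^ (2 * m)) ^ n))"
      using H0 t by (simp add: ennreal_mult ennreal_of_nat_eq_real_of_nat)
    also have "\<dots> \<le> ennreal (K\<^sup>2 * (1 + L) * H * (1 / 2) ^ n)"
    proof (rule ennreal_leI)
      have "real (card (close_pairs n)) * (H * (t ^ (2 * m)) ^ n)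
          \<le> (K\<^sup>2 * (1 + L) * (L\<^sup>2) ^ n) * (H * (t ^ (2 * m)) ^ n)"
        using H0 t by (intro mult_right_mono card_close_pairs) auto
      also have "\<dots> = K\<^sup>2 * (1 + L) * H * (L\<^sup>2 * t ^ (2 * m)) ^ n"
        by (simp add: power_mult_distrib mult_ac)
      also have "\<dots> \<le> K\<^sup>2 * (1 + L) * H * (1 / 2) ^ n"
        using H0 m t constants by (intro mult_left_mono power_mono) auto
      finally show "real (card (close_pairs n)) * (H * (t ^ (2 * m)) ^ n) \<le> K\<^sup>2 * (1 + L) * H * (1 / 2) ^ n" .
    qed
    finally show ?thesis .
  qed
  have G_meas: "(\<lambda>\<omega>. \<Sum>p\<in>close_pairs n. e n p \<omega>) \<in> borel_measurable \<Omega>" "G \<in> borel_measurable \<Omega>" for n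
    unfolding G_def[abs_def] by (intro borel_measurable_suminf_order borel_measurable_sum e_meas; assumption)+
  have "(\<integral>\<^sup>+\<omega>. G \<omega> \<partial>\<Omega>) = (\<Sum>n. \<integral>\<^sup>+\<omega>. (\<Sum>p\<in>close_pairs n. e n p \<omega>) \<partial>\<Omega>)"
    unfolding G_def by (rule nn_integral_suminf[OF G_meas(1)])
  also have "\<dots> \<le> (\<Sum>n. ennreal (K\<^sup>2 * (1 + L) * H * (1 / 2) ^ n))"
    by (intro suminf_le level summableI)
  also have "\<dots> = ennreal (\<Sum>n. K\<^sup>2 * (1 + L) * H * (1 / 2) ^ n)"
    using H0 constants by (intro suminf_ennreal2 summable_mult summable_geometric) auto
  finally have "(\<integral>\<^sup>+\<omega>. G \<omega> \<partial>\<Omega>) \<noteq> \<infinity>" by (auto simp: top_unique)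
  then have "AE \<omega> in \<Omega>. G \<omega> \<noteq> \<infinity>"
    by (rule nn_integral_noteq_infinite[OF G_meas(2)])
  then show ?thesis
  proof (eventually_elim)
    case (elim \<omega>)
    define B where "B = max 1 (enn2real (G \<omega>))"
    have "\<bar>U x \<omega> - U y \<omega>\<bar> \<le> B * q ^ n" if xy: "(x, y) \<in> close_pairs n" for x y n
    proof -
      have "ennreal (((U x \<omega> - U y \<omega>) / q ^ n) ^ (2 * m)) \<le> (\<Sum>p\<in>close_pairs n. e n p \<omega>)"
        using member_le_sum[OF xy, of "\<lambda>p. e n p \<omega>"] finite_close_pairs by (auto simp: e_def)
      also have "\<dots> \<le> G \<omega>"
        unfolding G_def using sum_le_suminf[OF summableI, of "{n}" "\<lambda>n. \<Sum>p\<in>close_pairs n. e n p \<omega>"] by auto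
      also have "\<dots> \<le> ennreal B" using elim unfolding B_def
        by (metis ennreal_enn2real_if ennreal_leI infinity_ennreal_def max.cobounded2)
      finally have *: "((U x \<omega> - U y \<omega>) / q ^ n) ^ (2 * m) \<le> B"
        by (simp add: B_def)
      define z where "z = \<bar>(U x \<omega> - U y \<omega>) / q ^ n\<bar>"
      have "z \<le> B"
      proof (rule ccontr)
        assume "\<not> ?thesis"
        then have gt: "B < z" by simp
        have "1 \<le> B" by (simp add: B_def)
        then have "z ^ 1 \<le> z ^ (2 * m)" using gt m(1) by (intro power_increasing) auto
        moreover have "z ^ (2 * m) \<le> B" unfolding z_def using * by (subst power_even_abs) simp_all
        ultimately show False using gt by simp
      qed
      then show ?thesis using q by (simp add: z_def abs_divide field_simps)
    qed
    then show ?case by (auto simp: q_def)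
  qed
qed

text \<open>The continuous version is the limit along the nets. It is a version because the increments towards a
  fixed point have summable second moments. A sequence of exponents increasing to \<open>\<beta>\<close> provides one null
  set for all \<open>\<gamma>\<close>.\<close>

theorem kolmogorov_chaining:
  assumes meas: "\<And>z. z \<in> S \<Longrightarrow> U z \<in> borel_measurable \<Omega>"
    and \<beta>: "0 < \<beta>"
    and mom: "\<And>m::nat. m > 0 \<Longrightarrow> \<exists>C\<ge>0. \<forall>x\<in>S. \<forall>y\<in>S.
        (\<integral>\<^sup>+\<omega>. ennreal ((U x \<omega> - U y \<omega>) ^ (2 * m)) \<partial>\<Omega>) \<le> ennreal (C * (d x y powr \<beta>) ^ (2 * m))"
  shows "AE \<omega> in \<Omega>. \<forall>\<gamma>. 0 < \<gamma> \<and> \<gamma> < \<beta> \<longrightarrow>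
      (\<exists>C. \<forall>x\<in>S. \<forall>y\<in>S. \<bar>lim (\<lambda>n. U (a n x) \<omega>) - lim (\<lambda>n. U (a n y) \<omega>)\<bar> \<le> C * d x y powr \<gamma>)"
    and "z \<in> S \<Longrightarrow> AE \<omega> in \<Omega>. lim (\<lambda>n. U (a n z) \<omega>) = U z \<omega>"
proof -
  define g where "g i = \<beta> * (1 - 1 / real (i + 2))" for i
  have g: "0 < g i" "g i < \<beta>" for i
    using \<beta> by (auto simp: g_def)
  have "AE \<omega> in \<Omega>. \<forall>i. \<exists>B. \<forall>n p q. (p, q) \<in> close_pairs n \<longrightarrow> \<bar>U p \<omega> - U q \<omega>\<bar> \<le> B * (\<rho> powr (g i)) ^ n"
    unfolding AE_all_countable using AE_close_pairs[OF meas g mom] by blast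
  then show "AE \<omega> in \<Omega>. \<forall>\<gamma>. 0 < \<gamma> \<and> \<gamma> < \<beta> \<longrightarrow>
      (\<exists>C. \<forall>x\<in>S. \<forall>y\<in>S. \<bar>lim (\<lambda>n. U (a n x) \<omega>) - lim (\<lambda>n. U (a n y) \<omega>)\<bar> \<le> C * d x y powr \<gamma>)"
  proof eventually_elim
    case (elim \<omega>)
    show ?case
    proof (intro allI impI)
      fix \<gamma> assume \<gamma>: "0 < \<gamma> \<and> \<gamma> < \<beta>"
      have "(\<lambda>i. \<beta> * (1 - 1 / real (i + 2))) \<longlonglongrightarrow> \<beta> * (1 - 0)"
        using LIMSEQ_ignore_initial_segment[OF lim_1_over_n, of 2]
        by (intro tendsto_mult tendsto_diff tendsto_const) auto
      then have "eventually (\<lambda>i. \<gamma> < g i) sequentially"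
        using \<gamma> order_tendstoD(1) unfolding g_def by fastforce
      then obtain i where i: "\<gamma> < g i" by (auto simp: eventually_sequentially)
      obtain B where B: "\<And>n p q. (p, q) \<in> close_pairs n \<Longrightarrow> \<bar>U p \<omega> - U q \<omega>\<bar> \<le> B * (\<rho> powr (g i)) ^ n"
        using elim by blast
      obtain C where C: "\<forall>x\<in>S. \<forall>y\<in>S. \<bar>lim (\<lambda>n. U (a n x) \<omega>) - lim (\<lambda>n. U (a n y) \<omega>)\<bar> \<le> C * d x y powr g i"
        using close_pairs_imp_holder[OF g(1)[of i], of "\<lambda>z. U z \<omega>", OF B] by blast
      have "\<bar>lim (\<lambda>n. U (a n x) \<omega>) - lim (\<lambda>n. U (a n y) \<omega>)\<bar> \<le> (\<bar>C\<bar> * \<Delta> powr (g i - \<gamma>)) * d x y powr \<gamma>"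
        if x: "x \<in> S" and y: "y \<in> S" for x y
      proof -
        have "\<bar>lim (\<lambda>n. U (a n x) \<omega>) - lim (\<lambda>n. U (a n y) \<omega>)\<bar> \<le> C * d x y powr g i"
          using C x y by blast
        also have "\<dots> \<le> \<bar>C\<bar> * (d x y powr (g i - \<gamma>) * d x y powr \<gamma>)"
          by (auto simp flip: powr_add intro!: mult_right_mono)
        also have "\<dots> \<le> \<bar>C\<bar> * (\<Delta> powr (g i - \<gamma>) * d x y powr \<gamma>)"
          using i d_nonneg d_bounded[OF x y] by (intro mult_left_mono mult_right_mono powr_mono2) auto
        finally show ?thesis by (simp add: mult.assoc)
      qed
      then show "\<exists>C. \<forall>x\<in>S. \<forall>y\<in>S. \<bar>lim (\<lambda>n. U (a n x) \<omega>) - lim (\<lambda>n. U (a n y) \<omega>)\<bar> \<le> C * d x y powr \<gamma>"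
        by blast
    qed
  qed
  assume z: "z \<in> S"
  note [measurable] = meas[OF z] meas[OF net_in[OF z]]
  obtain C where C: "C \<ge> 0" "\<And>x y. x \<in> S \<Longrightarrow> y \<in> S \<Longrightarrow>
      (\<integral>\<^sup>+\<omega>. ennreal ((U x \<omega> - U y \<omega>)\<^sup>2) \<partial>\<Omega>) \<le> ennreal (C * (d x y powr \<beta>)\<^sup>2)"
    using mom[of 1] by auto
  define s where "s = (\<rho> powr \<beta>)\<^sup>2"
  have s: "0 \<le> s" "s < 1" using \<rho> \<beta> unfolding s_def by (auto simp: powr_lt_one power_less_one_iff)
  have "(\<integral>\<^sup>+\<omega>. (\<Sum>n. ennreal ((U (a n z) \<omega> - U z \<omega>)\<^sup>2)) \<partial>\<Omega>) = (\<Sum>n. \<integral>\<^sup>+\<omega>. ennreal ((U (a n z) \<omega> - U z \<omega>)\<^sup>2) \<partial>\<Omega>)"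
    by (intro nn_integral_suminf) auto
  also have "\<dots> \<le> (\<Sum>n. ennreal (C * (c powr \<beta>)\<^sup>2 * s ^ n))"
  proof (intro suminf_le summableI)
    fix n
    have "(\<integral>\<^sup>+\<omega>. ennreal ((U (a n z) \<omega> - U z \<omega>)\<^sup>2) \<partial>\<Omega>) \<le> ennreal (C * (d (a n z) z powr \<beta>)\<^sup>2)"
      by (intro C net_in z)
    also have "\<dots> \<le> ennreal (C * ((c * \<rho> ^ n) powr \<beta>)\<^sup>2)"
      using net_dist[OF z, of n] \<beta> d_nonneg C(1) unfolding d_sym[of "a n z" z]
      by (intro ennreal_leI mult_left_mono power_mono powr_mono2) auto
    also have "((c * \<rho> ^ n) powr \<beta>)\<^sup>2 = (c powr \<beta>)\<^sup>2 * s ^ n"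
      using \<rho> constants by (simp add: s_def powr_mult powr_powr power_mult_distrib mult_ac flip: powr_realpow power_mult)
    finally show "(\<integral>\<^sup>+\<omega>. ennreal ((U (a n z) \<omega> - U z \<omega>)\<^sup>2) \<partial>\<Omega>) \<le> ennreal (C * (c powr \<beta>)\<^sup>2 * s ^ n)"
      by (simp add: mult.assoc)
  qed
  also have "\<dots> = ennreal (\<Sum>n. C * (c powr \<beta>)\<^sup>2 * s ^ n)"
    using C s by (intro suminf_ennreal2 summable_mult summable_geometric) auto
  finally have "(\<integral>\<^sup>+\<omega>. (\<Sum>n. ennreal ((U (a n z) \<omega> - U z \<omega>)\<^sup>2)) \<partial>\<Omega>) \<noteq> \<infinity>"
    by (auto simp: top_unique)
  then have "AE \<omega> in \<Omega>. (\<Sum>n. ennreal ((U (a n z) \<omega> - U z \<omega>)\<^sup>2)) \<noteq> \<infinity>"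
    by (rule nn_integral_noteq_infinite[rotated]) measurable
  then show "AE \<omega> in \<Omega>. lim (\<lambda>n. U (a n z) \<omega>) = U z \<omega>"
  proof eventually_elim
    case (elim \<omega>)
    have "summable (\<lambda>n. (U (a n z) \<omega> - U z \<omega>)\<^sup>2)"
      by (rule summable_suminf_not_top[OF _ elim[unfolded infinity_ennreal_def]]) simp
    then have "(\<lambda>n. (U (a n z) \<omega> - U z \<omega>)\<^sup>2) \<longlonglongrightarrow> 0" by (rule summable_LIMSEQ_zero)
    then have "(\<lambda>n. U (a n z) \<omega> - U z \<omega>) \<longlonglongrightarrow> 0" by (simp add: power_tendsto_0_iff)
    then have "(\<lambda>n. U (a n z) \<omega>) \<longlonglongrightarrow> U z \<omega>" by (simp add: LIM_zero_iff)
    then show ?case by (rule limI)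
  qed
qed

end

lemma (in Metric_space) essentially_holderI:
  fixes f :: "'a \<Rightarrow> real"
  assumes \<delta>: "0 < \<delta>'" "\<delta> \<le> \<delta>'"
    and f: "\<And>\<gamma>. 0 < \<gamma> \<Longrightarrow> \<gamma> < \<delta>' \<Longrightarrow> \<exists>C. \<forall>x\<in>M. \<forall>y\<in>M. \<bar>f x - f y\<bar> \<le> C * d x y powr \<gamma>"
  shows "essentially_holder \<delta> M d f"
proof -
  obtain C where C: "\<And>x y. x \<in> M \<Longrightarrow> y \<in> M \<Longrightarrow> \<bar>f x - f y\<bar> \<le> C * d x y powr (\<delta>' / 2)"
    using f[of "\<delta>' / 2"] \<delta> by auto
  have "continuous_map mtopology euclidean f"
    unfolding continuous_map_from_metric
  proof (intro conjI ballI allI impI)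
    fix a U assume a: "a \<in> M" and U: "openin euclidean U \<and> f a \<in> U"
    then obtain e where e: "e > 0" "ball (f a) e \<subseteq> U" by (metis open_contains_ball open_openin)
    define \<rho> where "\<rho> = (e / (\<bar>C\<bar> + 1)) powr (2 / \<delta>')"
    have \<rho>: "0 < \<rho>" using e by (simp add: \<rho>_def)
    have "f x \<in> U" if x: "x \<in> M" "d a x < \<rho>" for x
    proof -
      have "d a x powr (\<delta>' / 2) \<le> \<rho> powr (\<delta>' / 2)" using x \<delta> by (intro powr_mono2) auto
      also have "\<dots> = e / (\<bar>C\<bar> + 1)" using e \<delta> by (simp add: \<rho>_def powr_powr)
      finally have p: "d a x powr (\<delta>' / 2) \<le> e / (\<bar>C\<bar> + 1)" .
      have "\<bar>f a - f x\<bar> \<le> \<bar>C\<bar> * d a x powr (\<delta>' / 2)"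
        using C[OF a x(1)] by (rule order_trans) (intro mult_right_mono, auto)
      also have "\<dots> \<le> \<bar>C\<bar> * (e / (\<bar>C\<bar> + 1))" using p by (intro mult_left_mono) auto
      also have "\<dots> < e" using e by (simp add: field_simps)
      finally show ?thesis using e(2) by (auto simp: dist_real_def)
    qed
    then show "\<exists>r>0. \<forall>x. x \<in> M \<and> d a x < r \<longrightarrow> f x \<in> U" using \<rho> by blast
  qed auto
  then show ?thesis using f \<delta> unfolding essentially_holder_def by (auto simp: dist_real_def)
qed

lemma (in approximating_nets) metric_space: "Metric_space S d"
  by unfold_locales (auto simp: d_nonneg d_zero d_triangle intro: d_sym)

section \<open>Addresses, codings and the boundary\<close>

context self_similar_set
begin

lemma word_map_simps [simp]:
  "word_map [] = id" "word_map (i # w) = \<psi> i \<circ> word_map w" "word_map (v @ w) = word_map v \<circ> word_map w"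
  by (auto simp: word_map_def fun_eq_iff)

lemma \<psi>_in: "i \<in> {1..M} \<Longrightarrow> x \<in> F \<Longrightarrow> \<psi> i x \<in> F"
  using self_similar by blast

lemma word_map_in: "set w \<subseteq> {1..M} \<Longrightarrow> x \<in> F \<Longrightarrow> word_map w x \<in> F"
  by (induction w) (auto intro!: \<psi>_in)

definition ratio :: real where
  "ratio = (SOME c. 0 \<le> c \<and> c < 1 \<and> (\<forall>i\<in>{1..M}. \<forall>x\<in>F. \<forall>y\<in>F. dist (\<psi> i x) (\<psi> i y) \<le> c * dist x y))"

lemma ratio: "0 \<le> ratio" "ratio < 1"
  "i \<in> {1..M} \<Longrightarrow> x \<in> F \<Longrightarrow> y \<in> F \<Longrightarrow> dist (\<psi> i x) (\<psi> i y) \<le> ratio * dist x y"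
proof -
  obtain c where c: "\<And>i. i \<in> {1..M} \<Longrightarrow> c i < 1 \<and> (c i)-lipschitz_on F (\<psi> i)"
    using contraction by metis
  define C where "C = Max (c ` {1..M})"
  have ne: "{1..M} \<noteq> {}" using M_ge_2 by auto
  have le: "c i \<le> C" if "i \<in> {1..M}" for i using that by (auto simp: C_def)
  have "C \<in> c ` {1..M}" unfolding C_def using ne by (intro Max_in) auto
  then obtain j where j: "j \<in> {1..M}" "C = c j" by auto
  have "0 \<le> C" "C < 1" using c[OF j(1)] j(2) by (auto dest: lipschitz_on_nonneg)
  moreover have "dist (\<psi> i x) (\<psi> i y) \<le> C * dist x y" if "i \<in> {1..M}" "x \<in> F" "y \<in> F" for i x y
    using lipschitz_onD[OF conjunct2[OF c[OF that(1)]] that(2,3)] mult_right_mono[OF le[OF that(1)], of "dist x y"] by simp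
  ultimately have "\<exists>c. 0 \<le> c \<and> c < 1 \<and> (\<forall>i\<in>{1..M}. \<forall>x\<in>F. \<forall>y\<in>F. dist (\<psi> i x) (\<psi> i y) \<le> c * dist x y)"
    by blast
  from someI_ex[OF this, folded ratio_def]
  show "0 \<le> ratio" "ratio < 1"
  "i \<in> {1..M} \<Longrightarrow> x \<in> F \<Longrightarrow> y \<in> F \<Longrightarrow> dist (\<psi> i x) (\<psi> i y) \<le> ratio * dist x y" by auto
qed

lemma word_map_dist:
  assumes "set w \<subseteq> {1..M}" "x \<in> F" "y \<in> F"
  shows "dist (word_map w x) (word_map w y) \<le> ratio ^ length w * diameter F"
  using assms
proof (induction w)
  case Nil
  then show ?case using diameter_bounded_bound[OF compact_imp_bounded[OF compact]] by simp
next
  case (Cons i w)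
  have "dist (word_map (i # w) x) (word_map (i # w) y) \<le> ratio * dist (word_map w x) (word_map w y)"
    using Cons.prems by (simp add: ratio(3) word_map_in)
  also have "\<dots> \<le> ratio * (ratio ^ length w * diameter F)"
    using Cons ratio by (intro mult_left_mono) auto
  finally show ?case by simp
qed

lemma \<psi>_continuous: "i \<in> {1..M} \<Longrightarrow> continuous_on F (\<psi> i)"
  using contraction lipschitz_on_continuous_on by blast

lemma word_map_continuous: "set w \<subseteq> {1..M} \<Longrightarrow> continuous_on F (word_map w)"
proof (induction w)
  case (Cons i w)
  then show ?case unfolding word_map_simps
    by (intro continuous_on_compose continuous_on_subset[OF \<psi>_continuous]) (auto intro!: word_map_in)
qed (auto simp: id_def)

lemma cell_compact: "set w \<subseteq> {1..M} \<Longrightarrow> compact (cell w)"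
  unfolding cell_def by (intro compact_continuous_image word_map_continuous compact)

lemma cell_subset: "set w \<subseteq> {1..M} \<Longrightarrow> cell w \<subseteq> F"
  by (auto simp: cell_def word_map_in)

lemma mesh_tendsto: "(\<lambda>n. ratio ^ n * diameter F) \<longlonglongrightarrow> 0"
  using ratio by (intro tendsto_mult_left_zero LIMSEQ_power_zero) auto

text \<open>A point that lies in several cells has several addresses. A choice fixes one of them; \<open>overlap_boundary\<close>
  and \<open>tail_boundary\<close> tell what happens when the choice differs from a given address.\<close>

definition letter :: "'a \<Rightarrow> nat" where
  "letter x = (SOME i. i \<in> {1..M} \<and> x \<in> \<psi> i ` F)"

definition tail :: "'a \<Rightarrow> 'a" where
  "tail x = (SOME y. y \<in> F \<and> x = \<psi> (letter x) y)"

lemma letter: "x \<in> F \<Longrightarrow> letter x \<in> {1..M}"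
  and tail: "x \<in> F \<Longrightarrow> tail x \<in> F" "x \<in> F \<Longrightarrow> \<psi> (letter x) (tail x) = x"
proof -
  assume x: "x \<in> F"
  then have "\<exists>i. i \<in> {1..M} \<and> x \<in> \<psi> i ` F" using self_similar by blast
  from someI_ex[OF this, folded letter_def]
  have 1: "letter x \<in> {1..M}" "x \<in> \<psi> (letter x) ` F" by auto
  then have "\<exists>y. y \<in> F \<and> x = \<psi> (letter x) y" by blast
  from someI_ex[OF this, folded tail_def] 1
  show "letter x \<in> {1..M}" "tail x \<in> F" "\<psi> (letter x) (tail x) = x" by auto
qed

fun address :: "'a \<Rightarrow> nat \<Rightarrow> nat list" where
  "address x 0 = []"
| "address x (Suc n) = letter x # address (tail x) n"

lemma funpow_tail_in: "x \<in> F \<Longrightarrow> (tail ^^ n) x \<in> F"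
  by (induction n) (auto simp: tail)

lemma address_snoc: "address x (Suc n) = address x n @ [letter ((tail ^^ n) x)]"
  by (induction n arbitrary: x) (auto simp flip: funpow_swap1)

lemma length_address [simp]: "length (address x n) = n"
  by (induction n arbitrary: x) auto

lemma set_address: "x \<in> F \<Longrightarrow> set (address x n) \<subseteq> {1..M}"
proof (induction n arbitrary: x)
  case (Suc n)
  then show ?case using letter[OF Suc.prems] tail(1)[OF Suc.prems] by simp
qed simp

lemma address_map: "x \<in> F \<Longrightarrow> word_map (address x n) ((tail ^^ n) x) = x"
  by (induction n arbitrary: x) (auto simp: tail funpow_swap1)

lemma mem_cell_address: "x \<in> F \<Longrightarrow> x \<in> cell (address x n)"
  using address_map[of x n] funpow_tail_in[of x n] by (auto simp: cell_def intro: rev_image_eqI)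

lemma address_tendsto:
  assumes x: "x \<in> F" and p: "p \<in> F"
  shows "(\<lambda>n. word_map (address x n) p) \<longlonglongrightarrow> x"
proof (rule metric_tendsto_imp_tendsto[OF mesh_tendsto])
  have "dist (word_map (address x n) p) x \<le> ratio ^ n * diameter F" for n
    using word_map_dist[OF set_address[OF x] p funpow_tail_in[OF x], of n n] by (simp add: address_map x)
  then show "\<forall>\<^sub>F n in sequentially. dist (word_map (address x n) p) x \<le> dist (ratio ^ n * diameter F) 0"
    using ratio diameter_ge_0[OF compact_imp_bounded[OF compact]] by (auto intro!: always_eventually)
qed

lemma cell_snoc: "i \<in> {1..M} \<Longrightarrow> cell (w @ [i]) \<subseteq> cell w"
  by (auto simp: cell_def intro!: \<psi>_in)

lemma prefix_in: "\<omega> \<in> inf_words M \<Longrightarrow> set (map \<omega> [0..<n]) \<subseteq> {1..M}"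
  by (auto simp: inf_words_def)

lemma coding_unique:
  assumes \<omega>: "\<omega> \<in> inf_words M" and x: "\<And>n. x \<in> cell (map \<omega> [0..<n])" and y: "\<And>n. y \<in> cell (map \<omega> [0..<n])"
  shows "x = y"
proof -
  have "dist x y \<le> ratio ^ n * diameter F" for n
  proof -
    obtain x' y' where "x' \<in> F" "y' \<in> F" "x = word_map (map \<omega> [0..<n]) x'" "y = word_map (map \<omega> [0..<n]) y'"
      using x[of n] y[of n] by (auto simp: cell_def)
    then show ?thesis using word_map_dist[OF prefix_in[OF \<omega>, of n]] by simp
  qed
  then have "dist x y \<le> 0" using mesh_tendsto by (intro LIMSEQ_le_const) auto
  then show ?thesis by simp
qed

lemma coding_in_cells:
  assumes \<omega>: "\<omega> \<in> inf_words M"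
  shows "coding \<omega> \<in> cell (map \<omega> [0..<n])"
proof -
  define C where "C n = cell (map \<omega> [0..<n])" for n
  have mono: "C n \<subseteq> C m" if "m \<le> n" for m n
    using that
  proof (induction rule: dec_induct)
    case (step k)
    have "\<omega> k \<in> {1..M}" using \<omega> unfolding inf_words_def by blast
    then show ?case using cell_snoc[of "\<omega> k" "map \<omega> [0..<k]"] step.IH by (auto simp: C_def)
  qed simp
  obtain x0 where x0: "x0 \<in> F" using nonempty by blast
  define s where "s n = word_map (map \<omega> [0..<n]) x0" for n
  have sC: "s n \<in> C n" for n using x0 by (auto simp: s_def C_def cell_def)
  have "\<forall>n. s n \<in> F" using sC cell_subset[OF prefix_in[OF \<omega>]] by (auto simp: C_def)
  then obtain x h where h: "strict_mono h" "(s \<circ> h) \<longlonglongrightarrow> x"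
    using compact by (metis compact_eq_seq_compact_metric seq_compactE)
  have x: "x \<in> cell (map \<omega> [0..<n])" for n
  proof -
    have "closed (C n)" using cell_compact[OF prefix_in[OF \<omega>]] by (simp add: C_def compact_imp_closed)
    moreover have "eventually (\<lambda>k. (s \<circ> h) k \<in> C n) sequentially"
      using sC mono seq_suble[OF h(1)] unfolding eventually_sequentially
      by (metis comp_apply order_trans subsetD)
    ultimately show ?thesis using h(2) Lim_in_closed_set[of "C n" "s \<circ> h" sequentially x] by (simp add: C_def)
  qed
  have "coding \<omega> = x" unfolding coding_def
    using x coding_unique[OF \<omega>] by (intro the_equality) auto
  then show ?thesis using x by simp
qed

lemma coding_eqI:
  assumes "\<omega> \<in> inf_words M" "\<And>n. x \<in> cell (map \<omega> [0..<n])"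
  shows "coding \<omega> = x"
  using coding_unique[OF assms(1) coding_in_cells[OF assms(1)] assms(2)] .

lemma coding_in_F: "\<omega> \<in> inf_words M \<Longrightarrow> coding \<omega> \<in> F"
  using coding_in_cells[of \<omega> 0] by (simp add: cell_def)

lemma shift_in: "\<omega> \<in> inf_words M \<Longrightarrow> shift \<omega> \<in> inf_words M"
  by (auto simp: inf_words_def shift_def)

lemma prefix_Suc: "map \<omega> [0..<Suc n] = \<omega> 0 # map (shift \<omega>) [0..<n]"
  by (induction n) (auto simp: shift_def)

lemma coding_shift:
  assumes \<omega>: "\<omega> \<in> inf_words M"
  shows "\<psi> (\<omega> 0) (coding (shift \<omega>)) = coding \<omega>"
proof (rule coding_eqI[OF \<omega>, symmetric])
  fix n
  have in1: "\<omega> k \<in> {1..M}" for k using \<omega> unfolding inf_words_def by blast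
  have "\<psi> (\<omega> 0) (coding (shift \<omega>)) \<in> cell (map \<omega> [0..<Suc n])"
    using coding_in_cells[OF shift_in[OF \<omega>], of n] unfolding prefix_Suc by (auto simp: cell_def)
  moreover have "cell (map \<omega> [0..<Suc n]) \<subseteq> cell (map \<omega> [0..<n])"
    using cell_snoc[OF in1, of "map \<omega> [0..<n]" n] by simp
  ultimately show "\<psi> (\<omega> 0) (coding (shift \<omega>)) \<in> cell (map \<omega> [0..<n])" by blast
qed

lemma coding_surj:
  assumes x: "x \<in> F"
  obtains \<omega> where "\<omega> \<in> inf_words M" "coding \<omega> = x"
proof
  define \<omega> where "\<omega> n = letter ((tail ^^ n) x)" for n
  show \<omega>: "\<omega> \<in> inf_words M"
    using letter[OF funpow_tail_in[OF x]] by (auto simp: inf_words_def \<omega>_def)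
  have "map \<omega> [0..<n] = address x n" for n
  proof (induction n)
    case (Suc n)
    then show ?case using address_snoc[of x n] by (simp add: \<omega>_def)
  qed simp
  then have "x \<in> cell (map \<omega> [0..<n])" for n
    using address_map[OF x, of n] funpow_tail_in[OF x, of n] by (auto simp: cell_def intro: rev_image_eqI)
  then show "coding \<omega> = x" by (rule coding_eqI[OF \<omega>])
qed

lemma shift_funpow_in: "\<omega> \<in> inf_words M \<Longrightarrow> (shift ^^ n) \<omega> \<in> inf_words M"
  by (induction n) (auto simp: shift_in)

lemma postcritical_in: "\<eta> \<in> postcritical \<Longrightarrow> \<eta> \<in> inf_words M"
  by (auto simp: postcritical_def shift_funpow_in)

lemma postcritical_shift: "\<eta> \<in> postcritical \<Longrightarrow> shift \<eta> \<in> postcritical"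
proof -
  assume "\<eta> \<in> postcritical"
  then obtain n \<omega> where "n \<ge> 1" "\<omega> \<in> inf_words M" "coding \<omega> \<in> critical_points" "\<eta> = (shift ^^ n) \<omega>"
    by (auto simp: postcritical_def)
  then show ?thesis unfolding postcritical_def
    by (intro UN_I[of "Suc n"]) auto
qed

lemma boundary_subset: "boundary \<subseteq> F"
  by (auto simp: boundary_def postcritical_in coding_in_F)

lemma boundary_in_F: "p \<in> boundary \<Longrightarrow> p \<in> F"
  using boundary_subset by blast

text \<open>An address of \<open>x\<close> with \<open>i\<close> put in front of it is an address of the critical point \<open>\<psi> i x\<close>, so it becomes
  postcritical when the first letter is shifted away.\<close>

lemma overlap_boundary:
  assumes ij: "i \<in> {1..M}" "j \<in> {1..M}" "i \<noteq> j" and xy: "x \<in> F" "y \<in> F" and eq: "\<psi> i x = \<psi> j y"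
  shows "x \<in> boundary"
proof -
  obtain \<eta> where \<eta>: "\<eta> \<in> inf_words M" "coding \<eta> = x" using coding_surj[OF xy(1)] .
  define \<omega> where "\<omega> = case_nat i \<eta>"
  have sh: "shift \<omega> = \<eta>" by (auto simp: \<omega>_def shift_def)
  have \<omega>: "\<omega> \<in> inf_words M" using \<eta>(1) ij(1) unfolding \<omega>_def inf_words_def by (force split: nat.splits)
  have "coding \<omega> = \<psi> i x" using coding_shift[OF \<omega>] \<eta>(2) unfolding sh by (simp add: \<omega>_def)
  then have "coding \<omega> \<in> \<psi> i ` F \<inter> \<psi> j ` F" using xy eq by (metis IntI imageI)
  then have "coding \<omega> \<in> critical_points"
    using ij unfolding critical_points_def by blast
  then have "shift \<omega> \<in> postcritical" using \<omega> unfolding postcritical_def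
    by (intro UN_I[of 1]) auto
  then show ?thesis using \<eta> sh by (auto simp: boundary_def)
qed

lemma boundary_preimage:
  assumes "p \<in> boundary"
  obtains i q where "i \<in> {1..M}" "q \<in> boundary" "\<psi> i q = p"
proof -
  obtain \<eta> where \<eta>: "\<eta> \<in> postcritical" "p = coding \<eta>" using assms by (auto simp: boundary_def)
  show ?thesis
  proof
    show "\<eta> 0 \<in> {1..M}" using postcritical_in[OF \<eta>(1)] unfolding inf_words_def by blast
    show "coding (shift \<eta>) \<in> boundary" using postcritical_shift[OF \<eta>(1)] by (auto simp: boundary_def)
    show "\<psi> (\<eta> 0) (coding (shift \<eta>)) = p" using coding_shift[OF postcritical_in[OF \<eta>(1)]] \<eta> by simp
  qed
qed

text \<open>Shifting a postcritical address of \<open>p\<close> leads to a boundary point. If the chosen letter of \<open>p\<close> is not the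
  first letter of that address, then \<open>p\<close> lies in two cells and \<open>overlap_boundary\<close> applies.\<close>

lemma tail_boundary:
  assumes "p \<in> boundary"
  shows "tail p \<in> boundary"
proof -
  have p: "p \<in> F" using assms boundary_subset by auto
  obtain i q where iq: "i \<in> {1..M}" "q \<in> boundary" "\<psi> i q = p" using boundary_preimage[OF assms] .
  have q: "q \<in> F" using iq boundary_subset by auto
  show ?thesis
  proof (cases "letter p = i")
    case True
    then have "tail p = q" using inj_onD[OF injective[OF iq(1)]] tail[OF p] iq(3) q by metis
    then show ?thesis using iq by simp
  next
    case False
    then show ?thesis using overlap_boundary[OF letter[OF p] iq(1) False tail(1)[OF p] q] tail(2)[OF p] iq(3) by simp
  qed
qed

text \<open>Otherwise the cells reachable from \<open>i\<close> and the remaining ones would split \<open>F\<close> into two closed sets.\<close>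

lemma cells_connected:
  assumes "i \<in> {1..M}" "j \<in> {1..M}"
  shows "(i, j) \<in> {(i, j). i \<in> {1..M} \<and> j \<in> {1..M} \<and> \<psi> i ` F \<inter> \<psi> j ` F \<noteq> {}}\<^sup>*" (is "_ \<in> ?r\<^sup>*")
proof (rule ccontr)
  assume nij: "(i, j) \<notin> ?r\<^sup>*"
  define K where "K = {k\<in>{1..M}. (i, k) \<in> ?r\<^sup>*}"
  define X where "X = (\<Union>k\<in>K. \<psi> k ` F)"
  define Y where "Y = (\<Union>k\<in>{1..M} - K. \<psi> k ` F)"
  have cl: "compact (\<psi> k ` F)" if "k \<in> {1..M}" for k
    using that by (intro compact_continuous_image \<psi>_continuous compact)
  have "closed X" "closed Y" unfolding X_def Y_def K_def
    using cl by (auto intro!: closed_UN compact_imp_closed)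
  moreover have "F = X \<union> Y" 
  proof -
    have "K \<union> ({1..M} - K) = {1..M}" by (auto simp: K_def)
    then have "X \<union> Y = (\<Union>k\<in>{1..M}. \<psi> k ` F)" unfolding X_def Y_def by blast
    then show ?thesis using self_similar by simp
  qed
  moreover have "X \<inter> Y = {}"
  proof (rule ccontr)
    assume "X \<inter> Y \<noteq> {}"
    then obtain k l where kl: "k \<in> K" "l \<in> {1..M} - K" "\<psi> k ` F \<inter> \<psi> l ` F \<noteq> {}"
      unfolding X_def Y_def by blast
    then have "(k, l) \<in> ?r" by (auto simp: K_def)
    then have "(i, l) \<in> ?r\<^sup>*" using kl by (auto simp: K_def intro: rtrancl_into_rtrancl)
    then show False using kl by (auto simp: K_def)
  qed
  moreover have "X \<inter> F \<noteq> {}" "Y \<inter> F \<noteq> {}"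
  proof -
    obtain x where x: "x \<in> F" using nonempty by blast
    have K: "i \<in> K" "j \<in> {1..M} - K" using assms nij by (auto simp: K_def)
    have "\<psi> i x \<in> X \<inter> F" unfolding X_def using x \<psi>_in[OF assms(1) x] K(1) by blast
    moreover have "\<psi> j x \<in> Y \<inter> F" unfolding Y_def using x \<psi>_in[OF assms(2) x] K(2) by blast
    ultimately show "X \<inter> F \<noteq> {}" "Y \<inter> F \<noteq> {}" by blast+
  qed
  ultimately show False using connected unfolding connected_closed by (metis Int_empty_left inf_assoc order_refl)
qed

end

context pcf_self_similar_set
begin

lemma boundary_finite: "finite boundary"
  unfolding boundary_def using pcf by simp

text \<open>By connectedness the first cell meets another one.\<close>

lemma boundary_nonempty: "boundary \<noteq> {}"
proof -
  have 12: "1 \<in> {1..M}" "2 \<in> {1..M}" using M_ge_2 by auto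
  let ?r = "{(i, j). i \<in> {1..M} \<and> j \<in> {1..M} \<and> \<psi> i ` F \<inter> \<psi> j ` F \<noteq> {}}"
  have "k = 1 \<or> (\<exists>j. j \<noteq> 1 \<and> (1, j) \<in> ?r)" if "(1, k) \<in> ?r\<^sup>*" for k
    using that
  proof (induction rule: rtrancl_induct)
    case (step k l)
    then show ?case by (cases "l = 1"; cases "k = 1") auto
  qed simp
  from this[OF cells_connected[OF 12]] have "\<exists>j. j \<noteq> 1 \<and> (1, j) \<in> ?r" by simp
  then obtain j where j: "j \<noteq> 1" "j \<in> {1..M}" "\<psi> 1 ` F \<inter> \<psi> j ` F \<noteq> {}" by auto
  then obtain x y where "x \<in> F" "y \<in> F" "\<psi> 1 x = \<psi> j y" by auto
  then show ?thesis using overlap_boundary[OF 12(1) j(2) j(1)[symmetric]] by auto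
qed

end

section \<open>The energy form and its domain\<close>

lemma finite_words [simp]: "finite (words M n)"
proof -
  have "finite {w. set w \<subseteq> {1..M} \<and> length w = n}" by (rule finite_lists_length_eq) simp
  then show ?thesis by (simp add: words_def conj_commute)
qed

lemma words_0 [simp]: "words M 0 = {[]}"
  by (auto simp: words_def)

lemma words_Suc: "words M (Suc n) = (\<lambda>(i, w). i # w) ` ({1..M} \<times> words M n)"
  by (force simp: words_def length_Suc_conv)

lemma sum_words_Suc: "(\<Sum>w\<in>words M (Suc n). g w) = (\<Sum>i\<in>{1..M}. \<Sum>w\<in>words M n. g (i # w))"
  unfolding words_Suc by (subst sum.reindex) (auto simp: inj_on_def sum.cartesian_product intro!: sum.cong)

lemma sum_words_append: "(\<Sum>w\<in>words M (m + n). g w) = (\<Sum>v\<in>words M m. \<Sum>w\<in>words M n. g (v @ w))"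
  by (induction m arbitrary: g) (simp_all add: sum_words_Suc)

lemma sum_words_1: "(\<Sum>w\<in>words M 1. g w) = (\<Sum>i\<in>{1..M}. g [i])"
  using sum_words_Suc[of g M 0] by simp

lemma wordsD: "w \<in> words M n \<Longrightarrow> set w \<subseteq> {1..M}" "w \<in> words M n \<Longrightarrow> length w = n"
  by (auto simp: words_def)

lemma (in self_similar_set) address_words: "x \<in> F \<Longrightarrow> address x n \<in> words M n"
  using set_address by (auto simp: words_def)

context weighted_pcf_set
begin

lemma word_weight_simps [simp]:
  "word_weight [] = 1" "word_weight (i # w) = r i * word_weight w" "word_weight (v @ w) = word_weight v * word_weight w"
  by (auto simp: word_weight_def)

lemma energy0_cong:
  "(\<And>x. x \<in> boundary \<Longrightarrow> f x = f' x) \<Longrightarrow> (\<And>x. x \<in> boundary \<Longrightarrow> g x = g' x) \<Longrightarrow> energy0 f g = energy0 f' g'"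
  unfolding energy0_def by (intro arg_cong[where f=uminus] sum.cong refl) auto

lemma energy_n_0 [simp]: "energy_n 0 f g = energy0 f g"
  by (simp add: energy_n_def)

lemma energy_n_cong:
  assumes "\<And>x. x \<in> F \<Longrightarrow> f x = f' x" "\<And>x. x \<in> F \<Longrightarrow> g x = g' x"
  shows "energy_n n f g = energy_n n f' g'"
  unfolding energy_n_def
  using assms word_map_in[OF wordsD(1) boundary_in_F]
  by (intro sum.cong refl arg_cong2[where f="(*)"] energy0_cong) auto

lemma energy_n_add:
  "energy_n (m + n) f g = (\<Sum>v\<in>words M m. inverse (word_weight v) * energy_n n (f \<circ> word_map v) (g \<circ> word_map v))"
  unfolding energy_n_def sum_words_append
  by (simp add: sum_distrib_left mult.assoc o_assoc)

lemma energy_n_1: "energy_n 1 f g = (\<Sum>i\<in>{1..M}. inverse (r i) * energy0 (f \<circ> \<psi> i) (g \<circ> \<psi> i))"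
  unfolding energy_n_def sum_words_1 by simp

lemma energy0_linear_left: "energy0 (\<lambda>x. a * f x + b * g x) h = a * energy0 f h + b * energy0 g h"
  unfolding energy0_def by (simp add: algebra_simps sum.distrib sum_distrib_left)

lemma energy_n_linear_left: "energy_n n (\<lambda>x. a * f x + b * g x) h = a * energy_n n f h + b * energy_n n g h"
proof -
  have "energy0 ((\<lambda>x. a * f x + b * g x) \<circ> u) (h \<circ> u) = a * energy0 (f \<circ> u) (h \<circ> u) + b * energy0 (g \<circ> u) (h \<circ> u)" for u
    using energy0_linear_left[of a "f \<circ> u" b "g \<circ> u" "h \<circ> u"] by (simp add: o_def)
  then show ?thesis
    unfolding energy_n_def by (simp add: algebra_simps sum.distrib sum_distrib_left)
qed

end

context regular_harmonic_structure
begin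

lemma A_row_sum: "x \<in> boundary \<Longrightarrow> (\<Sum>y\<in>boundary. A x y) = 0"
  using kernel[of "\<lambda>_. 1"] by auto

lemma energy0_sym: "energy0 f g = energy0 g f"
proof -
  have "(\<Sum>x\<in>boundary. \<Sum>y\<in>boundary. f x * A x y * g y) = (\<Sum>y\<in>boundary. \<Sum>x\<in>boundary. f x * A x y * g y)"
    by (rule sum.swap)
  also have "\<dots> = (\<Sum>y\<in>boundary. \<Sum>x\<in>boundary. g y * A y x * f x)"
    by (intro sum.cong refl) (simp add: symmetric)
  finally show ?thesis by (simp add: energy0_def)
qed

text \<open>The rows of \<open>A\<close> sum to zero because constants lie in its kernel. In this form the signs of the off-diagonal
  entries become visible: all terms of \<open>energy0 f f\<close> are non-negative.\<close>

lemma energy0_eq: "energy0 f g = (1 / 2) * (\<Sum>x\<in>boundary. \<Sum>y\<in>boundary. A x y * ((f x - f y) * (g x - g y)))"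
proof -
  let ?s = "\<lambda>h. \<Sum>x\<in>boundary. \<Sum>y\<in>boundary. h x y :: real"
  have 1: "?s (\<lambda>x y. A x y * (f x * g x)) = 0"
    by (simp flip: sum_distrib_right add: A_row_sum)
  have 2: "?s (\<lambda>x y. A x y * (f y * g y)) = 0"
  proof -
    have "?s (\<lambda>x y. A x y * (f y * g y)) = ?s (\<lambda>x y. A y x * (f x * g x))" by (rule sum.swap)
    also have "\<dots> = ?s (\<lambda>x y. A x y * (f x * g x))" by (intro sum.cong refl) (simp add: symmetric)
    finally show ?thesis using 1 by simp
  qed
  have 3: "?s (\<lambda>x y. A x y * (f x * g y)) = - energy0 f g"
    unfolding energy0_def by (simp add: mult_ac)
  have 4: "?s (\<lambda>x y. A x y * (f y * g x)) = - energy0 f g"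
    unfolding energy0_sym[of f g] unfolding energy0_def by (simp add: mult_ac)
  have "?s (\<lambda>x y. A x y * ((f x - f y) * (g x - g y)))
      = ?s (\<lambda>x y. A x y * (f x * g x)) + ?s (\<lambda>x y. A x y * (f y * g y))
        - ?s (\<lambda>x y. A x y * (f x * g y)) - ?s (\<lambda>x y. A x y * (f y * g x))"
    by (simp add: algebra_simps sum.distrib sum_subtractf)
  then show ?thesis using 1 2 3 4 by simp
qed

lemma energy0_nonneg: "0 \<le> energy0 f f"
  using nonpositive[of f] by (simp add: energy0_def)

lemma energy0_mono_term:
  assumes "p \<in> boundary" "q \<in> boundary" "p \<noteq> q"
  shows "A p q * (f p - f q)\<^sup>2 \<le> 2 * energy0 f f"
proof -
  have t: "0 \<le> A x y * ((f x - f y) * (f x - f y))" if "x \<in> boundary" "y \<in> boundary" for x y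
    using off_diagonal[OF that] by (cases "x = y") auto
  have "A p q * ((f p - f q) * (f p - f q)) \<le> (\<Sum>y\<in>boundary. A p y * ((f p - f y) * (f p - f y)))"
    using assms boundary_finite t by (intro member_le_sum) auto
  also have "\<dots> \<le> (\<Sum>x\<in>boundary. \<Sum>y\<in>boundary. A x y * ((f x - f y) * (f x - f y)))"
    using assms boundary_finite t
    by (intro member_le_sum[of p boundary "\<lambda>x. \<Sum>y\<in>boundary. A x y * ((f x - f y) * (f x - f y))"]) (auto intro!: sum_nonneg)
  finally show ?thesis by (simp add: energy0_eq power2_eq_square)
qed

text \<open>The indicator of a connected component of the graph is annihilated by \<open>A\<close> and hence constant.\<close>

lemma boundary_graph_connected:
  assumes "p \<in> boundary" "q \<in> boundary"
  shows "(p, q) \<in> {(x, y). x \<in> boundary \<and> y \<in> boundary \<and> x \<noteq> y \<and> A x y > 0}\<^sup>*" (is "_ \<in> ?e\<^sup>*")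
proof (rule ccontr)
  assume npq: "(p, q) \<notin> ?e\<^sup>*"
  define f where "f z = (if (p, z) \<in> ?e\<^sup>* then 1 else 0 :: real)" for z
  have zero: "A x y = 0" if "x \<in> boundary" "y \<in> boundary" "(p, x) \<in> ?e\<^sup>*" "(p, y) \<notin> ?e\<^sup>*" for x y
  proof (rule ccontr)
    assume "A x y \<noteq> 0"
    moreover have "x \<noteq> y" using that by auto
    ultimately have "(x, y) \<in> ?e" using off_diagonal[OF that(1,2)] that(1,2) by (simp add: less_le)
    then show False using that(3,4) by (meson rtrancl.rtrancl_into_rtrancl)
  qed
  have "(\<Sum>y\<in>boundary. A x y * f y) = 0" if x: "x \<in> boundary" for x
  proof (cases "(p, x) \<in> ?e\<^sup>*")
    case True
    have "(\<Sum>y\<in>boundary. A x y * f y) = (\<Sum>y\<in>boundary. A x y)"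
      using zero[OF x _ True] by (intro sum.cong refl) (auto simp: f_def)
    then show ?thesis using A_row_sum[OF x] by simp
  next
    case False
    have "A x y * f y = 0" if "y \<in> boundary" for y
      using zero[OF that x _ False] symmetric[OF x that] by (auto simp: f_def)
    then show ?thesis by (intro sum.neutral) auto
  qed
  then obtain c where c: "\<forall>x\<in>boundary. f x = c" using kernel[of f] by blast
  have "f p = 1" "f q = 0" using npq by (auto simp: f_def)
  then show False using c assms by force
qed

text \<open>A difference along an edge of the graph is controlled by a single term of the form; a path chains such
  bounds, and there are finitely many pairs.\<close>

lemma energy0_coercive_ex:
  "\<exists>C. C > 0 \<and> (\<forall>f. \<forall>p\<in>boundary. \<forall>q\<in>boundary. (f p - f q)\<^sup>2 \<le> C * energy0 f f)"
proof -
  have ex: "\<exists>C\<ge>0. \<forall>f. (f p - f q)\<^sup>2 \<le> C * energy0 f f" if pq: "p \<in> boundary" "q \<in> boundary" for p q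
    using boundary_graph_connected[OF pq]
  proof (induction rule: rtrancl_induct)
    case (step y z)
    then obtain C where C: "C \<ge> 0" "\<And>f. (f p - f y)\<^sup>2 \<le> C * energy0 f f" by blast
    have yz: "y \<in> boundary" "z \<in> boundary" "y \<noteq> z" "A y z > 0" using step by auto
    have "(f p - f z)\<^sup>2 \<le> (2 * C + 4 / A y z) * energy0 f f" for f
    proof -
      have "(f y - f z)\<^sup>2 \<le> 2 / A y z * energy0 f f"
        using energy0_mono_term[OF yz(1-3), of f] yz(4) by (simp add: field_simps)
      moreover have "(f p - f z)\<^sup>2 \<le> 2 * (f p - f y)\<^sup>2 + 2 * (f y - f z)\<^sup>2"
        using sum_square_le[of "f p - f y" "f y - f z"] by simp
      ultimately have "(f p - f z)\<^sup>2 \<le> 2 * (C * energy0 f f) + 2 * (2 / A y z * energy0 f f)"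
        using C(2)[of f] by linarith
      then show ?thesis by (simp add: algebra_simps)
    qed
    then show ?case using C(1) yz(4) by (intro exI[of _ "2 * C + 4 / A y z"]) auto
  qed (auto intro!: exI[of _ 0])
  then obtain C where C: "\<And>p q. p \<in> boundary \<Longrightarrow> q \<in> boundary \<Longrightarrow> C p q \<ge> 0 \<and> (\<forall>f. (f p - f q)\<^sup>2 \<le> C p q * energy0 f f)"
    by metis
  define D where "D = 1 + (\<Sum>p\<in>boundary. \<Sum>q\<in>boundary. C p q)"
  show ?thesis
  proof (intro exI[of _ D] conjI allI ballI)
    show "D > 0" using C unfolding D_def by (intro add_pos_nonneg sum_nonneg) auto
    fix f :: "'a \<Rightarrow> real" and p q assume pq: "p \<in> boundary" "q \<in> boundary"
    have "C p q \<le> (\<Sum>q\<in>boundary. C p q)"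
      using pq boundary_finite C by (intro member_le_sum) auto
    also have "\<dots> \<le> (\<Sum>p\<in>boundary. \<Sum>q\<in>boundary. C p q)"
      using pq boundary_finite C by (intro member_le_sum[of p boundary "\<lambda>p. \<Sum>q\<in>boundary. C p q"]) (auto intro!: sum_nonneg)
    finally have "C p q \<le> D" by (simp add: D_def)
    then have "C p q * energy0 f f \<le> D * energy0 f f" by (intro mult_right_mono energy0_nonneg)
    moreover have "(f p - f q)\<^sup>2 \<le> C p q * energy0 f f" using C pq by blast
    ultimately show "(f p - f q)\<^sup>2 \<le> D * energy0 f f" by linarith
  qed
qed

definition gap0 :: real where
  "gap0 = (SOME C. C > 0 \<and> (\<forall>f. \<forall>p\<in>boundary. \<forall>q\<in>boundary. (f p - f q)\<^sup>2 \<le> C * energy0 f f))"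

lemma gap0_pos: "gap0 > 0"
  using someI_ex[OF energy0_coercive_ex, folded gap0_def] by (rule conjunct1)

lemma energy0_coercive: "p \<in> boundary \<Longrightarrow> q \<in> boundary \<Longrightarrow> (f p - f q)\<^sup>2 \<le> gap0 * energy0 f f"
  using conjunct2[OF someI_ex[OF energy0_coercive_ex, folded gap0_def]] by simp

definition r_max :: real where "r_max = Max (r ` {1..M})"

lemma r_max: "0 < r_max" "r_max < 1" "i \<in> {1..M} \<Longrightarrow> r i \<le> r_max"
proof -
  have ne: "{1..M} \<noteq> {}" using M_ge_2 by auto
  have "r_max \<in> r ` {1..M}" unfolding r_max_def using ne by (intro Max_in) auto
  then show "0 < r_max" "r_max < 1" using weights by auto
qed (auto simp: r_max_def)

lemma word_weight_pos: "set w \<subseteq> {1..M} \<Longrightarrow> 0 < word_weight w"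
  using weights by (induction w) auto

lemma word_weight_le: "set w \<subseteq> {1..M} \<Longrightarrow> word_weight w \<le> r_max ^ length w"
proof (induction w)
  case (Cons i w)
  then show ?case using r_max(3)[of i] weights[of i] word_weight_pos[of w] by (auto intro!: mult_mono)
qed simp

lemma energy_n_nonneg: "0 \<le> energy_n n f f"
  unfolding energy_n_def
  by (intro sum_nonneg mult_nonneg_nonneg energy0_nonneg) (auto dest!: wordsD(1) word_weight_pos)

lemma energy_n_sym: "energy_n n f g = energy_n n g f"
  unfolding energy_n_def by (subst energy0_sym) simp

lemma energy_n_linear_right: "energy_n n h (\<lambda>x. a * f x + b * g x) = a * energy_n n h f + b * energy_n n h g"
  using energy_n_linear_left energy_n_sym by metis

lemma energy_n_cell:
  assumes "set w \<subseteq> {1..M}"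
  shows "energy_n n (f \<circ> word_map w) (f \<circ> word_map w) \<le> word_weight w * energy_n (length w + n) f f"
proof -
  have w: "w \<in> words M (length w)" using assms by (auto simp: words_def)
  have "inverse (word_weight w) * energy_n n (f \<circ> word_map w) (f \<circ> word_map w) \<le> energy_n (length w + n) f f"
    unfolding energy_n_add
    using word_weight_pos wordsD energy_n_nonneg
    by (intro member_le_sum[OF w, of "\<lambda>w. inverse (word_weight w) * energy_n n (f \<circ> word_map w) (f \<circ> word_map w)"])
       (auto intro!: mult_nonneg_nonneg simp: less_imp_le)
  then show ?thesis using word_weight_pos[OF assms] by (simp add: field_simps)
qed

lemma energy0_le_energy_1: "energy0 f f \<le> energy_n 1 f f"
proof -
  obtain g where "is_arg_min (\<lambda>h. energy_n 1 h h) (\<lambda>h. \<forall>x\<in>boundary. h x = f x) g" "energy_n 1 g g = energy0 f f"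
    using harmonic by blast
  then show ?thesis unfolding is_arg_min_def by (metis linorder_not_le)
qed

lemma energy_n_Suc_le: "energy_n n f f \<le> energy_n (Suc n) f f"
proof -
  have "energy_n (n + 0) f f \<le> energy_n (n + 1) f f"
    unfolding energy_n_add using word_weight_pos wordsD energy0_le_energy_1
    by (intro sum_mono mult_left_mono) (auto simp: less_imp_le)
  then show ?thesis by simp
qed

lemma energy_n_mono: "incseq (\<lambda>n. energy_n n f f)"
  by (rule incseq_SucI) (rule energy_n_Suc_le)

text \<open>Inside one cell of level 1 this is coercivity of \<open>energy0\<close>. Cells that meet share the image of a boundary point,
  so the bound propagates along chains of cells. The point \<open>q\<close> of the zeroth level may take part because it is
  itself the image of a boundary point.\<close>

lemma energy_1_coercive_ex:
  "\<exists>K. K > 0 \<and> (\<forall>f. \<forall>i\<in>{1..M}. \<forall>p\<in>boundary. \<forall>q\<in>boundary. (f (\<psi> i p) - f q)\<^sup>2 \<le> K * energy_n 1 f f)"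
proof -
  note C = gap0_pos energy0_coercive
  let ?C = gap0
  have same: "(f (\<psi> i p) - f (\<psi> i q))\<^sup>2 \<le> ?C * energy_n 1 f f" if "i \<in> {1..M}" "p \<in> boundary" "q \<in> boundary" for f i p q
  proof -
    have "(f (\<psi> i p) - f (\<psi> i q))\<^sup>2 \<le> ?C * energy0 (f \<circ> \<psi> i) (f \<circ> \<psi> i)"
      using C(2)[OF that(2,3), of "f \<circ> \<psi> i"] by simp
    also have "energy0 (f \<circ> \<psi> i) (f \<circ> \<psi> i) \<le> r i * energy_n 1 f f"
      using energy_n_cell[of "[i]" 0 f] that(1) by simp
    also have "\<dots> \<le> 1 * energy_n 1 f f"
      using weights[OF that(1)] by (intro mult_right_mono energy_n_nonneg) auto
    finally show ?thesis using C(1) by simp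
  qed
  have ex: "\<exists>K\<ge>0. \<forall>f. \<forall>p\<in>boundary. \<forall>q\<in>boundary. (f (\<psi> i p) - f (\<psi> j q))\<^sup>2 \<le> K * energy_n 1 f f"
    if ij: "i \<in> {1..M}" "j \<in> {1..M}" for i j
    using cells_connected[OF ij]
  proof (induction rule: rtrancl_induct)
    case base
    show ?case using same[OF ij(1)] C(1) by (intro exI[of _ ?C]) auto
  next
    case (step j k)
    show ?case
    proof (cases "j = k")
      case False
      obtain K where K: "K \<ge> 0" "\<And>f p q. p \<in> boundary \<Longrightarrow> q \<in> boundary \<Longrightarrow> (f (\<psi> i p) - f (\<psi> j q))\<^sup>2 \<le> K * energy_n 1 f f"
        using step.IH by blast
      have jk: "j \<in> {1..M}" "k \<in> {1..M}" using step by auto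
      obtain a b where ab: "a \<in> F" "b \<in> F" "\<psi> j a = \<psi> k b" using step by blast
      have bd: "a \<in> boundary" "b \<in> boundary"
        using overlap_boundary[OF jk False ab] overlap_boundary[OF jk(2,1) _ ab(2,1)] False ab(3) by auto
      have "(f (\<psi> i p) - f (\<psi> k q))\<^sup>2 \<le> (2 * K + 2 * ?C) * energy_n 1 f f"
        if "p \<in> boundary" "q \<in> boundary" for f p q
      proof -
        have "(f (\<psi> i p) - f (\<psi> k q))\<^sup>2 \<le> 2 * (f (\<psi> i p) - f (\<psi> j a))\<^sup>2 + 2 * (f (\<psi> k b) - f (\<psi> k q))\<^sup>2"
          using sum_square_le[of "f (\<psi> i p) - f (\<psi> j a)" "f (\<psi> k b) - f (\<psi> k q)"] ab(3) by simp
        then show ?thesis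
          using K(2)[OF that(1) bd(1), of f] same[OF jk(2) bd(2) that(2), of f] by (simp add: algebra_simps)
      qed
      then show ?thesis using K(1) C(1) by (intro exI[of _ "2 * K + 2 * ?C"]) auto
    qed (use step.IH in simp)
  qed
  then obtain K where K: "\<And>i j. i \<in> {1..M} \<Longrightarrow> j \<in> {1..M} \<Longrightarrow>
      K i j \<ge> 0 \<and> (\<forall>f. \<forall>p\<in>boundary. \<forall>q\<in>boundary. (f (\<psi> i p) - f (\<psi> j q))\<^sup>2 \<le> K i j * energy_n 1 f f)"
    by metis
  define D where "D = 1 + (\<Sum>i\<in>{1..M}. \<Sum>j\<in>{1..M}. K i j)"
  show ?thesis
  proof (intro exI[of _ D] conjI allI ballI)
    show "D > 0" using K unfolding D_def by (intro add_pos_nonneg sum_nonneg) auto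
    fix f :: "'a \<Rightarrow> real" and i p q assume as: "i \<in> {1..M}" "p \<in> boundary" "q \<in> boundary"
    obtain j q' where j: "j \<in> {1..M}" "q' \<in> boundary" "\<psi> j q' = q" using boundary_preimage[OF as(3)] .
    have "K i j \<le> (\<Sum>j\<in>{1..M}. K i j)"
      using as(1) j(1) K by (intro member_le_sum) auto
    also have "\<dots> \<le> (\<Sum>i\<in>{1..M}. \<Sum>j\<in>{1..M}. K i j)"
      using as(1) K by (intro member_le_sum[of i "{1..M}" "\<lambda>i. \<Sum>j\<in>{1..M}. K i j"]) (auto intro!: sum_nonneg)
    finally have "K i j \<le> D" by (simp add: D_def)
    then have "K i j * energy_n 1 f f \<le> D * energy_n 1 f f" by (intro mult_right_mono energy_n_nonneg)
    moreover have "(f (\<psi> i p) - f (\<psi> j q'))\<^sup>2 \<le> K i j * energy_n 1 f f" using K as j by blast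
    ultimately show "(f (\<psi> i p) - f q)\<^sup>2 \<le> D * energy_n 1 f f" using j(3) by simp
  qed
qed

definition gap1 :: real where
  "gap1 = (SOME K. K > 0 \<and> (\<forall>f. \<forall>i\<in>{1..M}. \<forall>p\<in>boundary. \<forall>q\<in>boundary. (f (\<psi> i p) - f q)\<^sup>2 \<le> K * energy_n 1 f f))"

lemma gap1_pos: "gap1 > 0"
  using someI_ex[OF energy_1_coercive_ex, folded gap1_def] by (rule conjunct1)

lemma energy_1_coercive:
  "i \<in> {1..M} \<Longrightarrow> p \<in> boundary \<Longrightarrow> q \<in> boundary \<Longrightarrow> (f (\<psi> i p) - f q)\<^sup>2 \<le> gap1 * energy_n 1 f f"
  using conjunct2[OF someI_ex[OF energy_1_coercive_ex, folded gap1_def]] by simp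

lemma energy_domainI:
  assumes "continuous_on F f" "\<And>n. energy_n n f f \<le> B"
  shows "f \<in> energy_domain"
proof -
  have "convergent (\<lambda>n. energy_n n f f)"
    using incseq_convergent[OF energy_n_mono[of f]] assms(2) by (metis convergentI)
  then show ?thesis using assms(1) by (simp add: energy_domain_def)
qed

lemma energy_n_le:
  assumes "f \<in> energy_domain"
  shows "energy_n n f f \<le> energy f f"
  unfolding energy_def using assms
  by (intro incseq_le[OF energy_n_mono]) (auto simp: energy_domain_def convergent_LIMSEQ_iff)

lemma energy_le:
  assumes "f \<in> energy_domain" "\<And>n. energy_n n f f \<le> B"
  shows "energy f f \<le> B"
  unfolding energy_def using assms
  by (intro LIMSEQ_le_const2[of "\<lambda>n. energy_n n f f"]) (auto simp: energy_domain_def convergent_LIMSEQ_iff)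

lemma energy_nonneg: "f \<in> energy_domain \<Longrightarrow> 0 \<le> energy f f"
  using energy_n_le[of f 0] energy_n_nonneg[of 0 f] by linarith

lemma energy_domain_continuous: "f \<in> energy_domain \<Longrightarrow> continuous_on F f"
  by (simp add: energy_domain_def)

lemma energy_n_combination:
  "energy_n n (\<lambda>x. a * f x + b * g x) (\<lambda>x. a * f x + b * g x)
     = a\<^sup>2 * energy_n n f f + 2 * a * b * energy_n n f g + b\<^sup>2 * energy_n n g g"
  by (simp add: energy_n_linear_left energy_n_linear_right energy_n_sym[of n g f] power2_eq_square algebra_simps)

text \<open>At each level the parallelogram identity bounds the energy of the combination.\<close>

lemma energy_domain_combination:
  assumes f: "f \<in> energy_domain" and g: "g \<in> energy_domain"
  shows "(\<lambda>x. a * f x + b * g x) \<in> energy_domain"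
proof (rule energy_domainI)
  show "continuous_on F (\<lambda>x. a * f x + b * g x)"
    using f g by (intro continuous_intros energy_domain_continuous)
  fix n
  have "energy_n n (\<lambda>x. a * f x + b * g x) (\<lambda>x. a * f x + b * g x)
     + energy_n n (\<lambda>x. a * f x + (-b) * g x) (\<lambda>x. a * f x + (-b) * g x)
     = 2 * (a\<^sup>2 * energy_n n f f + b\<^sup>2 * energy_n n g g)"
    unfolding energy_n_combination by simp
  moreover have "a\<^sup>2 * energy_n n f f \<le> a\<^sup>2 * energy f f" "b\<^sup>2 * energy_n n g g \<le> b\<^sup>2 * energy g g"
    using energy_n_le f g by (auto intro!: mult_left_mono)
  ultimately show "energy_n n (\<lambda>x. a * f x + b * g x) (\<lambda>x. a * f x + b * g x)
      \<le> 2 * (a\<^sup>2 * energy f f + b\<^sup>2 * energy g g)"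
    using energy_n_nonneg[of n "\<lambda>x. a * f x + (-b) * g x"] unfolding distrib_left by linarith
qed

lemma energy_n_tendsto:
  assumes f: "f \<in> energy_domain" and g: "g \<in> energy_domain"
  shows "(\<lambda>n. energy_n n f g) \<longlonglongrightarrow> energy f g"
proof -
  let ?e = "\<lambda>n. (energy_n n (\<lambda>x. 1 * f x + 1 * g x) (\<lambda>x. 1 * f x + 1 * g x) - energy_n n f f - energy_n n g g) * (1 / 2)"
  have eq: "(\<lambda>n. energy_n n f g) = ?e"
    unfolding energy_n_combination by (rule ext) simp
  have "convergent ?e"
    using energy_domain_combination[OF f g, of 1 1] f g
    by (intro convergent_mult convergent_diff convergent_const) (auto simp: energy_domain_def)
  then have "convergent (\<lambda>n. energy_n n f g)" by (subst eq)
  then show ?thesis by (simp add: energy_def convergent_LIMSEQ_iff)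
qed

lemma energy_linear_left:
  assumes "f \<in> energy_domain" "g \<in> energy_domain" "h \<in> energy_domain"
  shows "energy (\<lambda>x. a * f x + b * g x) h = a * energy f h + b * energy g h"
  unfolding energy_def[of "\<lambda>x. a * f x + b * g x"] energy_n_linear_left
  using assms by (intro limI tendsto_intros energy_n_tendsto)

lemma energy_n_const: "energy_n n (\<lambda>_. c) g = 0"
  unfolding energy_n_def by (intro sum.neutral) (simp add: energy0_eq)

lemma energy_domain_const: "(\<lambda>_. c) \<in> energy_domain"
  by (rule energy_domainI[of _ 0]) (auto simp: energy_n_const)

lemma energy_const: "energy (\<lambda>_. c) g = 0"
  by (simp add: energy_def energy_n_const)

lemma energy_sym: "energy f g = energy g f"
  unfolding energy_def by (subst energy_n_sym) simp

lemma energy_affine: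
  assumes "f \<in> energy_domain"
  shows "(\<lambda>x. a * f x + c) \<in> energy_domain" "energy (\<lambda>x. a * f x + c) (\<lambda>x. a * f x + c) = a\<^sup>2 * energy f f"
proof -
  show 1: "(\<lambda>x. a * f x + c) \<in> energy_domain"
    using energy_domain_combination[OF assms energy_domain_const, of a 1 c] by simp
  have "energy (\<lambda>x. a * f x + c) h = a * energy f h" if "h \<in> energy_domain" for h
    using energy_linear_left[OF assms energy_domain_const that, of a 1 c] by (simp add: energy_const)
  then show "energy (\<lambda>x. a * f x + c) (\<lambda>x. a * f x + c) = a\<^sup>2 * energy f f"
    using 1 assms by (simp add: energy_sym[of f "\<lambda>x. a * f x + c"] power2_eq_square)
qed

lemma energy_domain_sum:
  assumes "finite K" "\<And>k. k \<in> K \<Longrightarrow> f k \<in> energy_domain"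
  shows "(\<lambda>x. \<Sum>k\<in>K. c k * f k x) \<in> energy_domain"
    and "h \<in> energy_domain \<Longrightarrow> energy (\<lambda>x. \<Sum>k\<in>K. c k * f k x) h = (\<Sum>k\<in>K. c k * energy (f k) h)"
proof -
  have "(\<lambda>x. \<Sum>k\<in>K. c k * f k x) \<in> energy_domain
     \<and> (h \<in> energy_domain \<longrightarrow> energy (\<lambda>x. \<Sum>k\<in>K. c k * f k x) h = (\<Sum>k\<in>K. c k * energy (f k) h))"
    using assms
  proof (induction K)
    case (insert j K)
    then show ?case
      using energy_domain_combination[of "f j" "\<lambda>x. \<Sum>k\<in>K. c k * f k x" "c j" 1]
        energy_linear_left[of "f j" "\<lambda>x. \<Sum>k\<in>K. c k * f k x" h "c j" 1] by auto
  qed (auto simp: energy_domain_const energy_const)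
  then show "(\<lambda>x. \<Sum>k\<in>K. c k * f k x) \<in> energy_domain"
    "h \<in> energy_domain \<Longrightarrow> energy (\<lambda>x. \<Sum>k\<in>K. c k * f k x) h = (\<Sum>k\<in>K. c k * energy (f k) h)" by auto
qed

lemma energy_domain_word_map:
  assumes f: "f \<in> energy_domain" and w: "set w \<subseteq> {1..M}"
  shows "f \<circ> word_map w \<in> energy_domain" "energy (f \<circ> word_map w) (f \<circ> word_map w) \<le> word_weight w * energy f f"
proof -
  have le: "energy_n n (f \<circ> word_map w) (f \<circ> word_map w) \<le> word_weight w * energy f f" for n
    using energy_n_cell[OF w, of n f] mult_left_mono[OF energy_n_le[OF f] less_imp_le[OF word_weight_pos[OF w]]]
    by (rule order_trans)
  have "continuous_on F (f \<circ> word_map w)"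
    using w by (intro continuous_on_compose word_map_continuous continuous_on_subset[OF energy_domain_continuous[OF f]])
      (auto intro!: word_map_in)
  then show *: "f \<circ> word_map w \<in> energy_domain" using le by (rule energy_domainI)
  show "energy (f \<circ> word_map w) (f \<circ> word_map w) \<le> word_weight w * energy f f"
    using * le by (rule energy_le)
qed

text \<open>Each difference of \<open>f\<close> is the sum of the differences of the two parts, and these have the same sign.\<close>

lemma energy_n_cut:
  "energy_n n (\<lambda>x. min (f x) c) (\<lambda>x. min (f x) c) + energy_n n (\<lambda>x. max (f x) c) (\<lambda>x. max (f x) c) \<le> energy_n n f f"
proof -
  have cut: "energy0 (\<lambda>x. min (f x) c) (\<lambda>x. min (f x) c) + energy0 (\<lambda>x. max (f x) c) (\<lambda>x. max (f x) c) \<le> energy0 f f"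
    for f :: "'a \<Rightarrow> real"
  proof -
    have "A x y * ((min (f x) c - min (f y) c) * (min (f x) c - min (f y) c))
        + A x y * ((max (f x) c - max (f y) c) * (max (f x) c - max (f y) c))
        \<le> A x y * ((f x - f y) * (f x - f y))" if xy: "x \<in> boundary" "y \<in> boundary" for x y
    proof (cases "x = y")
      case False
      define d e where "d = min (f x) c - min (f y) c" and "e = max (f x) c - max (f y) c"
      have "f x - f y = d + e" by (simp add: d_def e_def min_def max_def)
      moreover have "0 \<le> d * e" unfolding d_def e_def
        by (cases "f x \<le> f y") (auto intro!: mult_nonneg_nonneg mult_nonpos_nonpos)
      ultimately have "d * d + e * e \<le> (f x - f y) * (f x - f y)" by (simp add: algebra_simps)
      then have "A x y * (d * d + e * e) \<le> A x y * ((f x - f y) * (f x - f y))"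
        using off_diagonal[OF xy False] by (intro mult_left_mono)
      then show ?thesis by (simp add: d_def e_def distrib_left)
    qed simp
    then show ?thesis unfolding energy0_eq
      by (simp flip: distrib_left sum.distrib) (intro sum_mono, auto)
  qed
  have "inverse (word_weight w) * energy0 ((\<lambda>x. min (f x) c) \<circ> word_map w) ((\<lambda>x. min (f x) c) \<circ> word_map w)
      + inverse (word_weight w) * energy0 ((\<lambda>x. max (f x) c) \<circ> word_map w) ((\<lambda>x. max (f x) c) \<circ> word_map w)
      \<le> inverse (word_weight w) * energy0 (f \<circ> word_map w) (f \<circ> word_map w)" if "w \<in> words M n" for w
    using cut[of "f \<circ> word_map w"] word_weight_pos[OF wordsD(1)[OF that]]
    unfolding distrib_left[symmetric] by (intro mult_left_mono) (auto simp: o_def)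
  then show ?thesis unfolding energy_n_def sum.distrib[symmetric] by (rule sum_mono)
qed

lemma energy_cut:
  assumes f: "f \<in> energy_domain"
  shows "(\<lambda>x. min (f x) c) \<in> energy_domain" "(\<lambda>x. max (f x) c) \<in> energy_domain"
    "energy (\<lambda>x. min (f x) c) (\<lambda>x. min (f x) c) + energy (\<lambda>x. max (f x) c) (\<lambda>x. max (f x) c) \<le> energy f f"
proof -
  have le: "energy_n n (\<lambda>x. min (f x) c) (\<lambda>x. min (f x) c) \<le> energy f f"
    "energy_n n (\<lambda>x. max (f x) c) (\<lambda>x. max (f x) c) \<le> energy f f" for n
    using energy_n_cut[of n f c] energy_n_le[OF f, of n] energy_n_nonneg[of n "\<lambda>x. min (f x) c"]
      energy_n_nonneg[of n "\<lambda>x. max (f x) c"] by linarith+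
  show 1: "(\<lambda>x. min (f x) c) \<in> energy_domain" "(\<lambda>x. max (f x) c) \<in> energy_domain"
    using energy_domain_continuous[OF f] le by (auto intro!: energy_domainI continuous_intros)
  show "energy (\<lambda>x. min (f x) c) (\<lambda>x. min (f x) c) + energy (\<lambda>x. max (f x) c) (\<lambda>x. max (f x) c) \<le> energy f f"
    by (rule LIMSEQ_le[OF tendsto_add[OF energy_n_tendsto[OF 1(1) 1(1)] energy_n_tendsto[OF 1(2) 1(2)]] energy_n_tendsto[OF f f]])
       (use energy_n_cut in auto)
qed

text \<open>A point \<open>x\<close> is approached by the images of one boundary point under the initial segments of its address.
  The step from level \<open>n\<close> to level \<open>n + 1\<close> happens inside a cell whose rescaled function has energy at most
  \<open>r_max ^ n * energy f f\<close>, so the steps form a geometric series.\<close>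

lemma energy_coercive_ex:
  "\<exists>C. C > 0 \<and> (\<forall>f\<in>energy_domain. \<forall>x\<in>F. \<forall>y\<in>F. (f x - f y)\<^sup>2 \<le> C * energy f f)"
proof -
  note K = gap1_pos energy_1_coercive
  let ?K = gap1
  obtain p where p: "p \<in> boundary" using boundary_nonempty by blast
  define q where "q = sqrt r_max"
  have q: "0 < q" "q < 1" using r_max by (auto simp: q_def)
  define D where "D = 2 * sqrt ?K / (1 - q)"
  have D: "D > 0" using K q by (simp add: D_def)
  have near: "\<bar>f x - f p\<bar> \<le> sqrt (?K * energy f f) / (1 - q)" if f: "f \<in> energy_domain" and x: "x \<in> F" for f x
  proof -
    define s where "s n = f (word_map (address x n) p)" for n
    have "\<bar>s (Suc n) - s n\<bar> \<le> sqrt (?K * energy f f) * q ^ n" for n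
    proof -
      define g where "g = f \<circ> word_map (address x n)"
      define i where "i = letter ((tail ^^ n) x)"
      have i: "i \<in> {1..M}" using letter[OF funpow_tail_in[OF x]] by (simp add: i_def)
      have "s (Suc n) - s n = g (\<psi> i p) - g p"
        unfolding s_def address_snoc by (simp add: g_def i_def)
      moreover have "(g (\<psi> i p) - g p)\<^sup>2 \<le> ?K * energy_n 1 g g" by (rule K(2)[OF i p p])
      moreover have "energy_n 1 g g \<le> r_max ^ n * energy f f"
      proof -
        have "energy_n 1 g g \<le> word_weight (address x n) * energy_n (n + 1) f f"
          using energy_n_cell[OF set_address[OF x], of 1 f n] by (simp add: g_def)
        also have "\<dots> \<le> r_max ^ n * energy f f"
          using word_weight_le[OF set_address[OF x, of n]] r_max energy_n_le[OF f] energy_n_nonneg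
          by (intro mult_mono) auto
        finally show ?thesis .
      qed
      ultimately have "(s (Suc n) - s n)\<^sup>2 \<le> ?K * (r_max ^ n * energy f f)"
        using K(1) by (smt (verit) mult_left_mono)
      then have "\<bar>s (Suc n) - s n\<bar> \<le> sqrt (?K * (r_max ^ n * energy f f))"
        by (metis real_sqrt_abs real_sqrt_le_iff)
      also have "\<dots> = sqrt (?K * energy f f) * q ^ n"
        by (simp add: q_def real_sqrt_mult real_sqrt_power)
      finally show ?thesis .
    qed
    then have "\<bar>lim s - s 0\<bar> \<le> sqrt (?K * energy f f) * q ^ 0 / (1 - q)"
      using q by (intro geometric_increments_limit) auto
    moreover have "s \<longlonglongrightarrow> f x" unfolding s_def
      using boundary_in_F[OF p] x word_map_in[OF set_address[OF x]]
      by (intro continuous_on_tendsto_compose[OF energy_domain_continuous[OF f] address_tendsto]) auto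
    ultimately show ?thesis by (simp add: limI s_def)
  qed
  have "(f x - f y)\<^sup>2 \<le> D\<^sup>2 * energy f f" if f: "f \<in> energy_domain" and x: "x \<in> F" and y: "y \<in> F" for f x y
  proof -
    have "\<bar>f x - f y\<bar> \<le> D * sqrt (energy f f)"
      using near[OF f x] near[OF f y] by (simp add: D_def real_sqrt_mult)
    then have "(f x - f y)\<^sup>2 \<le> (D * sqrt (energy f f))\<^sup>2"
      by (metis abs_ge_zero power2_abs power_mono)
    then show ?thesis using energy_nonneg[OF f] by (simp add: power_mult_distrib)
  qed
  then show ?thesis using D by (intro exI[of _ "D\<^sup>2"]) auto
qed

definition osc_const :: real where
  "osc_const = (SOME C. C > 0 \<and> (\<forall>f\<in>energy_domain. \<forall>x\<in>F. \<forall>y\<in>F. (f x - f y)\<^sup>2 \<le> C * energy f f))"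

lemma osc_const_pos: "osc_const > 0"
  using someI_ex[OF energy_coercive_ex, folded osc_const_def] by (rule conjunct1)

lemma energy_coercive: "f \<in> energy_domain \<Longrightarrow> x \<in> F \<Longrightarrow> y \<in> F \<Longrightarrow> (f x - f y)\<^sup>2 \<le> osc_const * energy f f"
  using conjunct2[OF someI_ex[OF energy_coercive_ex, folded osc_const_def]] by simp

lemma energy_coercive_cell:
  assumes f: "f \<in> energy_domain" and w: "set w \<subseteq> {1..M}" and xy: "x \<in> cell w" "y \<in> cell w"
  shows "(f x - f y)\<^sup>2 \<le> osc_const * word_weight w * energy f f"
proof -
  obtain x' y' where x'y': "x' \<in> F" "y' \<in> F" "x = word_map w x'" "y = word_map w y'"
    using xy by (auto simp: cell_def)
  have "(f x - f y)\<^sup>2 \<le> osc_const * energy (f \<circ> word_map w) (f \<circ> word_map w)"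
    using energy_coercive[OF energy_domain_word_map(1)[OF f w] x'y'(1,2)] x'y'(3,4) by simp
  also have "\<dots> \<le> osc_const * (word_weight w * energy f f)"
    using energy_domain_word_map(2)[OF f w] osc_const_pos by (intro mult_left_mono) auto
  finally show ?thesis by (simp add: mult.assoc)
qed

end

section \<open>Harmonic extension\<close>

context regular_harmonic_structure
begin

definition ext :: "('a \<Rightarrow> real) \<Rightarrow> 'a \<Rightarrow> real" where
  "ext v = (SOME g. (\<forall>x\<in>boundary. g x = v x) \<and> energy_n 1 g g = energy0 v v)"

lemma ext: "x \<in> boundary \<Longrightarrow> ext v x = v x" "energy_n 1 (ext v) (ext v) = energy0 v v"
proof -
  have "\<exists>g. (\<forall>x\<in>boundary. g x = v x) \<and> energy_n 1 g g = energy0 v v"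
    using harmonic[of v] unfolding is_arg_min_def by blast
  from someI_ex[OF this, folded ext_def]
  show "x \<in> boundary \<Longrightarrow> ext v x = v x" "energy_n 1 (ext v) (ext v) = energy0 v v" by auto
qed

text \<open>\<open>V w\<close> stands for the restriction to the boundary of \<open>f \<circ> word_map w\<close>, for a function \<open>f\<close> to be constructed from
  these data. Such restrictions agree where sibling cells meet, and on boundary points that survive in a subcell.\<close>

definition compatible :: "(nat list \<Rightarrow> 'a \<Rightarrow> real) \<Rightarrow> bool" where
  "compatible V \<longleftrightarrow>
     (\<forall>w. \<forall>i\<in>{1..M}. \<forall>j\<in>{1..M}. \<forall>p\<in>boundary. \<forall>q\<in>boundary. \<psi> i p = \<psi> j q \<longrightarrow> V (w @ [i]) p = V (w @ [j]) q) \<and>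
     (\<forall>w. \<forall>i\<in>{1..M}. \<forall>p\<in>boundary. \<psi> i p \<in> boundary \<longrightarrow> V (w @ [i]) p = V w (\<psi> i p))"

text \<open>From level \<open>n\<close> on, the values on the subcells of a cell come from one function that extends the values on its
  boundary without increasing the energy.\<close>

definition harmonic_from :: "nat \<Rightarrow> (nat list \<Rightarrow> 'a \<Rightarrow> real) \<Rightarrow> bool" where
  "harmonic_from n V \<longleftrightarrow> (\<forall>w. n \<le> length w \<longrightarrow> (\<exists>g. (\<forall>x\<in>boundary. g x = V w x) \<and>
     (\<forall>i\<in>{1..M}. \<forall>p\<in>boundary. V (w @ [i]) p = g (\<psi> i p)) \<and> energy_n 1 g g = energy0 (V w) (V w)))"

lemma compatibleD1: "compatible V \<Longrightarrow> i \<in> {1..M} \<Longrightarrow> j \<in> {1..M} \<Longrightarrow> p \<in> boundary \<Longrightarrow> q \<in> boundary \<Longrightarrow>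
    \<psi> i p = \<psi> j q \<Longrightarrow> V (w @ [i]) p = V (w @ [j]) q"
  unfolding compatible_def by blast

lemma compatibleD2: "compatible V \<Longrightarrow> i \<in> {1..M} \<Longrightarrow> p \<in> boundary \<Longrightarrow> \<psi> i p \<in> boundary \<Longrightarrow> V (w @ [i]) p = V w (\<psi> i p)"
  unfolding compatible_def by blast

lemma compatible_append: "compatible V \<Longrightarrow> compatible (\<lambda>u. V (v @ u))"
  unfolding compatible_def append_assoc[symmetric] by blast

lemma harmonic_from_append: "harmonic_from n V \<Longrightarrow> n \<le> length v + m \<Longrightarrow> harmonic_from m (\<lambda>u. V (v @ u))"
  unfolding harmonic_from_def append_assoc[symmetric]
proof (intro allI impI)
  fix w :: "nat list" assume V: "\<forall>w. n \<le> length w \<longrightarrow> (\<exists>g. (\<forall>x\<in>boundary. g x = V w x) \<and>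
     (\<forall>i\<in>{1..M}. \<forall>p\<in>boundary. V (w @ [i]) p = g (\<psi> i p)) \<and> energy_n 1 g g = energy0 (V w) (V w))"
    and n: "n \<le> length v + m" "m \<le> length w"
  have "n \<le> length (v @ w)" using n by simp
  then show "\<exists>g. (\<forall>x\<in>boundary. g x = V (v @ w) x) \<and>
     (\<forall>i\<in>{1..M}. \<forall>p\<in>boundary. V ((v @ w) @ [i]) p = g (\<psi> i p)) \<and> energy_n 1 g g = energy0 (V (v @ w)) (V (v @ w))"
    by (rule V[rule_format])
qed

lemma harmonic_from_energy:
  assumes "harmonic_from n V" "n \<le> length w"
  shows "(\<Sum>i\<in>{1..M}. inverse (r i) * energy0 (V (w @ [i])) (V (w @ [i]))) = energy0 (V w) (V w)"
proof -
  obtain g where g: "\<forall>i\<in>{1..M}. \<forall>p\<in>boundary. V (w @ [i]) p = g (\<psi> i p)" "energy_n 1 g g = energy0 (V w) (V w)"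
    using assms unfolding harmonic_from_def by blast
  have "energy0 (V (w @ [i])) (V (w @ [i])) = energy0 (g \<circ> \<psi> i) (g \<circ> \<psi> i)" if "i \<in> {1..M}" for i
    using g(1) that by (intro energy0_cong) auto
  then show ?thesis using g(2) unfolding energy_n_1 by simp
qed

lemma harmonic_from_energy_step:
  assumes "harmonic_from n V" "n \<le> length w" "i \<in> {1..M}"
  shows "energy0 (V (w @ [i])) (V (w @ [i])) \<le> r_max * energy0 (V w) (V w)"
proof -
  have "inverse (r i) * energy0 (V (w @ [i])) (V (w @ [i]))
      \<le> (\<Sum>i\<in>{1..M}. inverse (r i) * energy0 (V (w @ [i])) (V (w @ [i])))"
    using assms(3) weights energy0_nonneg
    by (intro member_le_sum) (auto intro!: mult_nonneg_nonneg simp: less_imp_le)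
  then have "energy0 (V (w @ [i])) (V (w @ [i])) \<le> r i * energy0 (V w) (V w)"
    unfolding harmonic_from_energy[OF assms(1,2)] using weights[OF assms(3)] by (simp add: field_simps)
  also have "\<dots> \<le> r_max * energy0 (V w) (V w)"
    using r_max(3)[OF assms(3)] by (intro mult_right_mono energy0_nonneg)
  finally show ?thesis .
qed

lemma harmonic_from_energy_decay:
  assumes V: "harmonic_from 0 V" and x: "x \<in> F"
  shows "energy0 (V (address x m)) (V (address x m)) \<le> r_max ^ m * energy0 (V []) (V [])"
proof (induction m)
  case (Suc m)
  have "energy0 (V (address x (Suc m))) (V (address x (Suc m))) \<le> r_max * energy0 (V (address x m)) (V (address x m))"
    unfolding address_snoc by (intro harmonic_from_energy_step[OF V] letter funpow_tail_in x) auto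
  also have "\<dots> \<le> r_max * (r_max ^ m * energy0 (V []) (V []))"
    using r_max Suc by (intro mult_left_mono) auto
  finally show ?case by (simp add: mult_ac)
qed simp

text \<open>Which boundary point is used is immaterial: oscillations over the boundary of a small cell vanish in the limit.\<close>

definition base_point :: 'a where "base_point = (SOME p. p \<in> boundary)"

lemma base_point: "base_point \<in> boundary"
  unfolding base_point_def using boundary_nonempty some_in_eq by blast

definition limit_fun :: "(nat list \<Rightarrow> 'a \<Rightarrow> real) \<Rightarrow> 'a \<Rightarrow> real" where
  "limit_fun V x = lim (\<lambda>n. V (address x n) base_point)"

lemma limit_fun_tail: "limit_fun V x = limit_fun (\<lambda>u. V (letter x # u)) (tail x)"
proof -
  have "(\<lambda>n. V (address x n) base_point) \<longlonglongrightarrow> l \<longleftrightarrow> (\<lambda>n. V (letter x # address (tail x) n) base_point) \<longlonglongrightarrow> l" for l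
    by (subst filterlim_sequentially_Suc[symmetric]) simp
  then show ?thesis unfolding limit_fun_def lim_def by simp
qed

lemma limit_fun_address: "limit_fun V x = limit_fun (\<lambda>u. V (address x m @ u)) ((tail ^^ m) x)"
proof (induction m arbitrary: V x)
  case (Suc m)
  have "limit_fun V x = limit_fun (\<lambda>u. V (letter x # u)) (tail x)" by (rule limit_fun_tail)
  also have "\<dots> = limit_fun (\<lambda>u. V (letter x # (address (tail x) m @ u))) ((tail ^^ m) (tail x))"
    by (rule Suc)
  finally show ?case by (simp add: funpow_swap1)
qed simp

definition ext_const :: real where "ext_const = sqrt gap1 / (1 - sqrt r_max) + sqrt gap0"

lemma ext_const_pos: "ext_const > 0"
  using gap0_pos gap1_pos r_max by (auto simp: ext_const_def intro!: add_nonneg_pos)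

lemma abs_le_sqrt_of_square: "x\<^sup>2 \<le> y \<Longrightarrow> \<bar>x\<bar> \<le> sqrt y" for x y :: real
  by (metis real_sqrt_abs real_sqrt_le_iff)

text \<open>The values along an address change by steps whose squares are dominated by the decaying energies of the cells.\<close>

lemma limit_fun_near:
  assumes V: "harmonic_from 0 V" and x: "x \<in> F" and q: "q \<in> boundary"
  shows "\<bar>limit_fun V x - V [] q\<bar> \<le> ext_const * sqrt (energy0 (V []) (V []))"
proof -
  let ?E = "energy0 (V []) (V [])"
  define s where "s n = V (address x n) base_point" for n
  have step: "\<bar>s (Suc n) - s n\<bar> \<le> sqrt (gap1 * ?E) * sqrt r_max ^ n" for n
  proof -
    let ?w = "address x n" and ?i = "letter ((tail ^^ n) x)"
    obtain g where g: "\<forall>x\<in>boundary. g x = V ?w x" "\<forall>i\<in>{1..M}. \<forall>p\<in>boundary. V (?w @ [i]) p = g (\<psi> i p)"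
      "energy_n 1 g g = energy0 (V ?w) (V ?w)"
      using V unfolding harmonic_from_def by blast
    have i: "?i \<in> {1..M}" by (intro letter funpow_tail_in x)
    have "s (Suc n) - s n = g (\<psi> ?i base_point) - g base_point"
      unfolding s_def address_snoc using g(1,2) i base_point by simp
    moreover have "(g (\<psi> ?i base_point) - g base_point)\<^sup>2 \<le> gap1 * energy_n 1 g g"
      by (rule energy_1_coercive[OF i base_point base_point])
    moreover have "gap1 * energy_n 1 g g \<le> gap1 * (r_max ^ n * ?E)"
      unfolding g(3) using gap1_pos by (intro mult_left_mono harmonic_from_energy_decay V x) auto
    ultimately have "(s (Suc n) - s n)\<^sup>2 \<le> gap1 * (r_max ^ n * ?E)" by simp
    then have "\<bar>s (Suc n) - s n\<bar> \<le> sqrt (gap1 * (r_max ^ n * ?E))" by (rule abs_le_sqrt_of_square)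
    also have "\<dots> = sqrt (gap1 * ?E) * sqrt r_max ^ n" by (simp add: real_sqrt_mult real_sqrt_power)
    finally show ?thesis .
  qed
  have "\<bar>lim s - s 0\<bar> \<le> sqrt (gap1 * ?E) * sqrt r_max ^ 0 / (1 - sqrt r_max)"
    using step r_max by (intro geometric_increments_limit) auto
  moreover have "\<bar>V [] base_point - V [] q\<bar> \<le> sqrt (gap0 * ?E)"
    by (intro abs_le_sqrt_of_square energy0_coercive base_point q)
  moreover have "lim s = limit_fun V x" "s 0 = V [] base_point"
    by (simp_all add: s_def[abs_def] limit_fun_def)
  ultimately have "\<bar>limit_fun V x - V [] q\<bar> \<le> sqrt (gap1 * ?E) / (1 - sqrt r_max) + sqrt (gap0 * ?E)" by simp
  then show ?thesis by (simp add: ext_const_def real_sqrt_mult algebra_simps)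
qed

text \<open>The tails of a boundary point \<open>p\<close> are boundary points, and by compatibility the values prescribed at them
  along the address of \<open>p\<close> are all equal to \<open>V [] p\<close>; the limit differs from them by less and less.\<close>

lemma limit_fun_boundary:
  assumes c: "compatible V" and V: "harmonic_from n V" and p: "p \<in> boundary"
  shows "limit_fun V p = V [] p"
proof -
  have pF: "p \<in> F" by (rule boundary_in_F[OF p])
  have tb: "(tail ^^ m) p \<in> boundary" for m
    by (induction m) (auto simp: p tail_boundary)
  have vert: "V (address p m) ((tail ^^ m) p) = V [] p" for m
  proof (induction m)
    case (Suc m)
    let ?y = "(tail ^^ m) p"
    have y: "?y \<in> F" by (intro funpow_tail_in pF)
    have "V (address p m @ [letter ?y]) (tail ?y) = V (address p m) (\<psi> (letter ?y) (tail ?y))"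
      using tb[of m] tail(2)[OF y] by (intro compatibleD2[OF c] letter y tail_boundary) auto
    then show ?case using Suc tail(2)[OF y] by (simp add: address_snoc del: address.simps)
  qed simp
  \<comment> \<open>The estimate \<open>limit_fun_near\<close> in the cell of level \<open>n + m\<close> containing \<open>p\<close>.\<close>
  have bd: "\<bar>limit_fun V p - V [] p\<bar> \<le> ext_const * sqrt (r_max ^ m * energy0 (V (address p n)) (V (address p n)))" for m
  proof -
    let ?w = "address p (n + m)"
    have "\<bar>limit_fun (\<lambda>u. V (?w @ u)) ((tail ^^ (n + m)) p) - V (?w @ []) ((tail ^^ (n + m)) p)\<bar>
        \<le> ext_const * sqrt (energy0 (V (?w @ [])) (V (?w @ [])))"
      by (intro limit_fun_near[where V="\<lambda>u. V (?w @ u)"] harmonic_from_append[OF V] funpow_tail_in pF tb) simp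
    then have "\<bar>limit_fun V p - V [] p\<bar> \<le> ext_const * sqrt (energy0 (V ?w) (V ?w))"
      using limit_fun_address[of V p "n + m"] vert[of "n + m"] by simp
    also have "energy0 (V ?w) (V ?w) \<le> r_max ^ m * energy0 (V (address p n)) (V (address p n))"
    proof -
      have split: "?w = address p n @ address ((tail ^^ n) p) m"
        by (induction n arbitrary: p) (auto simp: funpow_swap1)
      have "harmonic_from 0 (\<lambda>u. V (address p n @ u))" by (rule harmonic_from_append[OF V]) simp
      from harmonic_from_energy_decay[OF this funpow_tail_in[OF pF], of n m]
      show ?thesis by (simp add: split)
    qed
    finally show ?thesis using ext_const_pos by simp
  qed
  have "(\<lambda>m. ext_const * sqrt (r_max ^ m * energy0 (V (address p n)) (V (address p n)))) \<longlonglongrightarrow>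
      ext_const * sqrt (0 * energy0 (V (address p n)) (V (address p n)))"
    using r_max by (intro tendsto_intros LIMSEQ_power_zero) auto
  then have "\<bar>limit_fun V p - V [] p\<bar> \<le> 0"
    using bd by (intro LIMSEQ_le_const) auto
  then show ?thesis by simp
qed

text \<open>This is independence of the address. The chosen first letter of \<open>\<psi> i y\<close> can differ from \<open>i\<close> only if \<open>y\<close> is a
  boundary point, and there the values are known.\<close>

lemma limit_fun_\<psi>:
  assumes c: "compatible V" and V: "harmonic_from n V" and i: "i \<in> {1..M}" and y: "y \<in> F"
  shows "limit_fun V (\<psi> i y) = limit_fun (\<lambda>u. V (i # u)) y"
proof -
  let ?x = "\<psi> i y"
  have x: "?x \<in> F" by (rule \<psi>_in[OF i y])
  have sub: "compatible (\<lambda>u. V (j # u))" "harmonic_from n (\<lambda>u. V (j # u))" for j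
    using compatible_append[OF c, of "[j]"] harmonic_from_append[OF V, of "[j]" n] by auto
  show ?thesis
  proof (cases "letter ?x = i")
    case True
    then have "tail ?x = y" using inj_onD[OF injective[OF i]] tail[OF x] y by metis
    then show ?thesis using limit_fun_tail[of V ?x] True by simp
  next
    case False
    let ?j = "letter ?x" and ?z = "tail ?x"
    note j = letter[OF x] and z = tail[OF x]
    have bd: "?z \<in> boundary" "y \<in> boundary"
      using overlap_boundary[OF j i False z(1) y z(2)] overlap_boundary[OF i j _ y z(1)] False z(2) by auto
    have "limit_fun V ?x = limit_fun (\<lambda>u. V (?j # u)) ?z" by (rule limit_fun_tail)
    also have "\<dots> = V [?j] ?z" using limit_fun_boundary[OF sub bd(1)] by simp
    also have "\<dots> = V [i] y" using compatibleD1[OF c j i bd z(2), of "[]"] by simp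
    also have "\<dots> = limit_fun (\<lambda>u. V (i # u)) y" using limit_fun_boundary[OF sub bd(2)] by simp
    finally show ?thesis .
  qed
qed

lemma limit_fun_word_map:
  assumes "compatible V" "harmonic_from n V" "set w \<subseteq> {1..M}" "y \<in> F"
  shows "limit_fun V (word_map w y) = limit_fun (\<lambda>u. V (w @ u)) y"
  using assms
proof (induction w arbitrary: V)
  case (Cons i w)
  have "limit_fun V (\<psi> i (word_map w y)) = limit_fun (\<lambda>u. V (i # u)) (word_map w y)"
    using Cons.prems by (intro limit_fun_\<psi>[OF Cons.prems(1,2)] word_map_in) auto
  also have "\<dots> = limit_fun (\<lambda>u. V (i # (w @ u))) y"
    using Cons.prems compatible_append[OF Cons.prems(1), of "[i]"] harmonic_from_append[OF Cons.prems(2), of "[i]" n]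
    by (intro Cons.IH) auto
  finally show ?case by simp
qed simp

lemma limit_fun_cell:
  assumes c: "compatible V" and V: "harmonic_from n V" and w: "set w \<subseteq> {1..M}" "n \<le> length w"
    and x: "x \<in> cell w" and q: "q \<in> boundary"
  shows "\<bar>limit_fun V x - V w q\<bar> \<le> ext_const * sqrt (energy0 (V w) (V w))"
proof -
  obtain y where y: "y \<in> F" "x = word_map w y" using x by (auto simp: cell_def)
  have "harmonic_from 0 (\<lambda>u. V (w @ u))" using w by (intro harmonic_from_append[OF V]) auto
  from limit_fun_near[OF this y(1) q] show ?thesis
    by (simp add: y(2) limit_fun_word_map[OF c V w(1) y(1)])
qed

lemma level_energy_const:
  assumes V: "harmonic_from n V" and "n \<le> m"
  shows "(\<Sum>w\<in>words M m. inverse (word_weight w) * energy0 (V w) (V w))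
     = (\<Sum>w\<in>words M n. inverse (word_weight w) * energy0 (V w) (V w))"
  using assms(2)
proof (induction rule: dec_induct)
  case (step m)
  have "(\<Sum>w\<in>words M (m + 1). inverse (word_weight w) * energy0 (V w) (V w))
      = (\<Sum>w\<in>words M m. inverse (word_weight w) * (\<Sum>i\<in>{1..M}. inverse (r i) * energy0 (V (w @ [i])) (V (w @ [i]))))"
    unfolding sum_words_append sum_words_1 by (simp add: sum_distrib_left mult_ac)
  also have "\<dots> = (\<Sum>w\<in>words M m. inverse (word_weight w) * energy0 (V w) (V w))"
    using step wordsD(2) by (intro sum.cong refl arg_cong2[where f="(*)"] harmonic_from_energy[OF V]) auto
  finally show ?case using step by simp
qed simp

text \<open>The oscillation over a cell of level \<open>m\<close> is of order \<open>sqrt (r_max ^ m)\<close>, and every point sufficiently close to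
  \<open>x\<close> lies in a common cell of level \<open>m\<close> with \<open>x\<close>.\<close>

lemma limit_fun_continuous:
  assumes c: "compatible V" and V: "harmonic_from n V"
  shows "continuous_on F (limit_fun V)"
proof -
  define E where "E = (\<Sum>w\<in>words M n. inverse (word_weight w) * energy0 (V w) (V w))"
  have Ew: "energy0 (V w) (V w) \<le> r_max ^ m * E" if w: "w \<in> words M m" and m: "n \<le> m" for w m
  proof -
    note wp = word_weight_pos[OF wordsD(1)[OF w]]
    have "inverse (word_weight w) * energy0 (V w) (V w) \<le> (\<Sum>w\<in>words M m. inverse (word_weight w) * energy0 (V w) (V w))"
      using word_weight_pos wordsD energy0_nonneg
      by (intro member_le_sum[OF w]) (auto intro!: mult_nonneg_nonneg simp: less_imp_le)
    then have "inverse (word_weight w) * energy0 (V w) (V w) \<le> E"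
      unfolding level_energy_const[OF V m] E_def .
    then have 1: "energy0 (V w) (V w) \<le> word_weight w * E" using wp by (simp add: field_simps)
    have "0 \<le> E" unfolding E_def using word_weight_pos wordsD energy0_nonneg
      by (intro sum_nonneg mult_nonneg_nonneg) (auto simp: less_imp_le)
    then have "word_weight w * E \<le> r_max ^ m * E"
      using word_weight_le[OF wordsD(1)[OF w]] wordsD(2)[OF w] by (intro mult_right_mono) auto
    then show ?thesis using 1 by simp
  qed
  have osc: "\<bar>limit_fun V x - limit_fun V y\<bar> \<le> 2 * (ext_const * sqrt (r_max ^ m * E))"
    if w: "w \<in> words M m" and m: "n \<le> m" and xy: "x \<in> cell w" "y \<in> cell w" for w m x y
  proof -
    have "\<bar>limit_fun V z - V w base_point\<bar> \<le> ext_const * sqrt (r_max ^ m * E)" if "z \<in> cell w" for z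
    proof -
      have "\<bar>limit_fun V z - V w base_point\<bar> \<le> ext_const * sqrt (energy0 (V w) (V w))"
        using wordsD[OF w] m by (intro limit_fun_cell[OF c V] that base_point) auto
      also have "\<dots> \<le> ext_const * sqrt (r_max ^ m * E)"
        using Ew[OF w m] ext_const_pos by (intro mult_left_mono) auto
      finally show ?thesis .
    qed
    from this[OF xy(1)] this[OF xy(2)] show ?thesis by linarith
  qed
  show ?thesis unfolding continuous_on_iff
  proof (intro ballI allI impI)
    fix x e :: _ assume x: "x \<in> F" and e: "(0::real) < e"
    have "(\<lambda>m. 2 * (ext_const * sqrt (r_max ^ m * E))) \<longlonglongrightarrow> 2 * (ext_const * sqrt (0 * E))"
      using r_max by (intro tendsto_intros LIMSEQ_power_zero) auto
    then have "eventually (\<lambda>m. 2 * (ext_const * sqrt (r_max ^ m * E)) < e \<and> n \<le> m) sequentially"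
      using e by (intro eventually_conj order_tendstoD eventually_ge_at_top) auto
    then obtain m where m: "2 * (ext_const * sqrt (r_max ^ m * E)) < e" "n \<le> m"
      by (auto simp: eventually_sequentially)
    define Z where "Z = (\<Union>w\<in>{w\<in>words M m. x \<notin> cell w}. cell w)"
    have "closed Z" unfolding Z_def
      using wordsD(1) cell_compact by (intro closed_UN) (auto intro!: compact_imp_closed)
    moreover have "x \<notin> Z" by (auto simp: Z_def)
    ultimately obtain d where d: "0 < d" "ball x d \<subseteq> - Z"
      using open_contains_ball[of "- Z"] by (auto simp: open_Compl)
    have "dist (limit_fun V y) (limit_fun V x) < e" if y: "y \<in> F" and yx: "dist y x < d" for y
    proof -
      let ?w = "address y m"
      have w: "?w \<in> words M m" by (rule address_words[OF y])
      have yw: "y \<in> cell ?w" by (rule mem_cell_address[OF y])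
      have "y \<notin> Z" using d(2) yx by (auto simp: dist_commute)
      then have xw: "x \<in> cell ?w" using w yw by (auto simp: Z_def)
      show ?thesis using osc[OF w m(2) yw xw] m(1) by (simp add: dist_real_def)
    qed
    then show "\<exists>d>0. \<forall>y\<in>F. dist y x < d \<longrightarrow> dist (limit_fun V y) (limit_fun V x) < e" using d(1) by blast
  qed
qed

lemma limit_fun_energy_domain:
  assumes c: "compatible V" and V: "harmonic_from n V"
  shows "limit_fun V \<in> energy_domain"
proof (rule energy_domainI[OF limit_fun_continuous[OF c V]])
  fix m
  have eq: "energy_n k (limit_fun V) (limit_fun V) = (\<Sum>w\<in>words M k. inverse (word_weight w) * energy0 (V w) (V w))" for k
    unfolding energy_n_def
  proof (intro sum.cong refl arg_cong2[where f="(*)"] energy0_cong)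
    fix w p assume w: "w \<in> words M k" and p: "p \<in> boundary"
    have "limit_fun (\<lambda>u. V (w @ u)) p = V (w @ []) p"
      using limit_fun_boundary[OF compatible_append[OF c, of w] harmonic_from_append[OF V, of w n] p] by simp
    then show "(limit_fun V \<circ> word_map w) p = V w p" "(limit_fun V \<circ> word_map w) p = V w p"
      using limit_fun_word_map[OF c V wordsD(1)[OF w] boundary_in_F[OF p]] by auto
  qed
  have "energy_n m (limit_fun V) (limit_fun V) \<le> energy_n (max m n) (limit_fun V) (limit_fun V)"
    by (rule incseqD[OF energy_n_mono]) simp
  also have "\<dots> = (\<Sum>w\<in>words M n. inverse (word_weight w) * energy0 (V w) (V w))"
    unfolding eq by (rule level_energy_const[OF V]) simp
  finally show "energy_n m (limit_fun V) (limit_fun V) \<le> (\<Sum>w\<in>words M n. inverse (word_weight w) * energy0 (V w) (V w))" .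
qed

text \<open>The given values of \<open>f\<close> are used up to level \<open>n\<close> and are then extended harmonically again and again. A new letter
  is added at the end of a word, so the recursion runs over reversed words.\<close>

fun piecewise_rev :: "('a \<Rightarrow> real) \<Rightarrow> nat \<Rightarrow> nat list \<Rightarrow> 'a \<Rightarrow> real" where
  "piecewise_rev f n [] = f"
| "piecewise_rev f n (i # w) =
     (if length w < n then f \<circ> word_map (rev (i # w)) else ext (piecewise_rev f n w) \<circ> \<psi> i)"

definition piecewise :: "('a \<Rightarrow> real) \<Rightarrow> nat \<Rightarrow> nat list \<Rightarrow> 'a \<Rightarrow> real" where
  "piecewise f n w = piecewise_rev f n (rev w)"

lemma piecewise_snoc:
  "piecewise f n (w @ [i]) = (if length w < n then f \<circ> word_map (w @ [i]) else ext (piecewise f n w) \<circ> \<psi> i)"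
  by (simp add: piecewise_def)

lemma piecewise_initial: "length w \<le> n \<Longrightarrow> piecewise f n w = f \<circ> word_map w"
  by (cases w rule: rev_cases) (auto simp: piecewise_snoc, simp add: piecewise_def)

lemma piecewise_compatible: "compatible (piecewise f n)"
  unfolding compatible_def piecewise_snoc using piecewise_initial[of _ n f] ext(1) by auto

lemma piecewise_harmonic_from: "harmonic_from n (piecewise f n)"
  unfolding harmonic_from_def piecewise_snoc using ext by (auto intro!: exI[of _ "ext (piecewise f n _)"])

text \<open>The values at level \<open>n\<close> are \<open>0\<close> near \<open>x\<close> and \<open>1\<close> elsewhere. If cells of that level are small enough, both the cell
  of \<open>x\<close> and the cell of \<open>y\<close> have constant boundary values, hence energy zero there, and the extension
  keeps the constant on the whole cell.\<close>

lemma energy_domain_separates: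
  assumes x: "x \<in> F" and y: "y \<in> F" and ne: "x \<noteq> y"
  obtains f where "f \<in> energy_domain" "f x = 0" "f y = 1"
proof -
  define D where "D = dist x y"
  have D: "D > 0" using ne by (simp add: D_def)
  have "eventually (\<lambda>n. ratio ^ n * diameter F < D / 2) sequentially"
    using D by (intro order_tendstoD(2)[OF mesh_tendsto]) auto
  then obtain n where n: "ratio ^ n * diameter F < D / 2" by (auto simp: eventually_sequentially)
  define f where "f z = (if dist z x < D / 2 then 0 else 1 :: real)" for z
  define V where "V = piecewise f n"
  note cV = piecewise_compatible[of f n, folded V_def] and hV = piecewise_harmonic_from[of n f, folded V_def]
  have cellwise: "limit_fun V z = c" if z: "z \<in> F" and c: "\<And>p. p \<in> F \<Longrightarrow> f (word_map (address z n) p) = c" for z c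
  proof -
    have Vw: "V (address z n) p = c" if "p \<in> boundary" for p
      using c boundary_in_F[OF that] by (simp add: V_def piecewise_initial)
    have "energy0 (V (address z n)) (V (address z n)) = energy0 (\<lambda>_. c) (\<lambda>_. c)"
      using Vw by (intro energy0_cong) auto
    also have "\<dots> = 0" by (simp add: energy0_eq)
    finally have E0: "energy0 (V (address z n)) (V (address z n)) = 0" .
    show ?thesis
      using limit_fun_cell[OF cV hV set_address[OF z, of n] _ mem_cell_address[OF z] base_point] Vw[OF base_point] by (simp add: E0)
  qed
  have near: "dist (word_map (address z n) p) z < D / 2" if "z \<in> F" "p \<in> F" for z p
    using word_map_dist[OF set_address[OF that(1)] that(2) funpow_tail_in[OF that(1)], of n n] n
    by (simp add: address_map that(1))
  have "limit_fun V x = 0" using near[OF x] by (intro cellwise x) (auto simp: f_def)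
  moreover have "limit_fun V y = 1"
  proof (intro cellwise y)
    fix p assume "p \<in> F"
    then have "dist (word_map (address y n) p) y < D / 2" by (rule near[OF y])
    then have "\<not> dist (word_map (address y n) p) x < D / 2"
      using dist_triangle[of x y "word_map (address y n) p"] by (simp add: D_def dist_commute)
    then show "f (word_map (address y n) p) = 1" by (simp add: f_def)
  qed
  ultimately show ?thesis using limit_fun_energy_domain[OF cV hV] that by blast
qed

end

section \<open>The resistance metric\<close>

context regular_harmonic_structure
begin

definition test_energies :: "'a \<Rightarrow> 'a \<Rightarrow> real set" where
  "test_energies x y = {energy f f |f. f \<in> energy_domain \<and> f x = 0 \<and> f y = 1}"

lemma resistance_eq: "x \<noteq> y \<Longrightarrow> resistance x y = inverse (Inf (test_energies x y))"
  by (simp add: resistance_def test_energies_def)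

text \<open>Points outside \<open>F\<close> are included because a metric in the sense of \<open>Metric_space\<close> is non-negative on the whole type.\<close>

lemma test_energies_nonempty: 
  assumes "x \<noteq> y"
  shows "test_energies x y \<noteq> {}"
proof -
  have "\<exists>f. f \<in> energy_domain \<and> f x = 0 \<and> f y = 1"
  proof (cases "x \<in> F \<and> y \<in> F")
    case True
    then show ?thesis using energy_domain_separates assms by metis
  next
    case False
    have dom: "f \<in> energy_domain" if "\<And>z. z \<in> F \<Longrightarrow> f z = c" for f and c :: real
    proof (rule energy_domainI)
      show "continuous_on F f" using that by (simp add: continuous_on_const cong: continuous_on_cong)
      show "energy_n n f f \<le> 0" for n
        using energy_n_cong[of f "\<lambda>_. c" f f n] that by (simp add: energy_n_const)
    qed
    show ?thesis
    proof (cases "x \<in> F")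
      case True
      then have "y \<notin> F" using False by simp
      then have "(\<lambda>z. if z = y then 1 else 0 :: real) \<in> energy_domain" by (intro dom[of _ 0]) auto
      then show ?thesis using assms by (intro exI[of _ "\<lambda>z. if z = y then 1 else 0"]) auto
    next
      case False
      then have "(\<lambda>z. if z = x then 0 else 1 :: real) \<in> energy_domain" by (intro dom[of _ 1]) auto
      then show ?thesis using assms by (intro exI[of _ "\<lambda>z. if z = x then 0 else 1"]) auto
    qed
  qed
  then show ?thesis by (auto simp: test_energies_def)
qed

lemma test_energies_bdd: "bdd_below (test_energies x y)"
  by (intro bdd_belowI[of _ 0]) (auto simp: test_energies_def energy_nonneg)

lemma resistance_nonneg: "0 \<le> resistance x y"
proof (cases "x = y")
  case False
  have "0 \<le> Inf (test_energies x y)"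
    by (intro cInf_greatest test_energies_nonempty False) (auto simp: test_energies_def energy_nonneg)
  then show ?thesis by (simp add: resistance_eq False)
qed (simp add: resistance_def)

lemma resistance_sym: "resistance x y = resistance y x"
proof -
  have "test_energies x y \<subseteq> test_energies y x" for x y
  proof
    fix e assume "e \<in> test_energies x y"
    then obtain f where f: "f \<in> energy_domain" "f x = 0" "f y = 1" "e = energy f f" by (auto simp: test_energies_def)
    then have "(\<lambda>z. (-1) * f z + 1) \<in> energy_domain" "energy (\<lambda>z. (-1) * f z + 1) (\<lambda>z. (-1) * f z + 1) = e"
      using energy_affine[OF f(1), of "-1" 1] by auto
    then show "e \<in> test_energies y x" using f(2,3) unfolding test_energies_def
      by (intro CollectI exI[of _ "\<lambda>z. (-1) * f z + 1"]) auto
  qed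
  then have "test_energies x y = test_energies y x" by blast
  then show ?thesis by (cases "x = y") (auto simp: resistance_eq)
qed

lemma Inf_test_energies_pos:
  assumes "x \<in> F" "y \<in> F" "x \<noteq> y"
  shows "0 < Inf (test_energies x y)"
proof -
  have "1 / osc_const \<le> Inf (test_energies x y)"
  proof (intro cInf_greatest test_energies_nonempty assms)
    fix e assume "e \<in> test_energies x y"
    then obtain f where f: "f \<in> energy_domain" "f x = 0" "f y = 1" "e = energy f f" by (auto simp: test_energies_def)
    then show "1 / osc_const \<le> e"
      using energy_coercive[OF f(1) assms(1,2)] osc_const_pos by (simp add: field_simps)
  qed
  then show ?thesis using osc_const_pos by (smt (verit) divide_pos_pos)
qed

lemma resistance_pos: "x \<in> F \<Longrightarrow> y \<in> F \<Longrightarrow> x \<noteq> y \<Longrightarrow> 0 < resistance x y"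
  using Inf_test_energies_pos by (simp add: resistance_eq)

lemma resistance_bound:
  assumes f: "f \<in> energy_domain" and xy: "x \<in> F" "y \<in> F"
  shows "(f x - f y)\<^sup>2 \<le> resistance x y * energy f f"
proof (cases "f x = f y")
  case True
  then show ?thesis using resistance_nonneg energy_nonneg[OF f] by simp
next
  case False
  define a where "a = 1 / (f y - f x)"
  have a: "a \<noteq> 0" "a * (f y - f x) = 1" using False by (auto simp: a_def)
  have ne: "x \<noteq> y" using False by auto
  have "energy (\<lambda>z. a * f z + - a * f x) (\<lambda>z. a * f z + - a * f x) \<in> test_energies x y"
    unfolding test_energies_def using energy_affine(1)[OF f, of a "- a * f x"] a(2)
    by (intro CollectI exI[of _ "\<lambda>z. a * f z + - a * f x"]) (auto simp: algebra_simps)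
  then have "Inf (test_energies x y) \<le> a\<^sup>2 * energy f f"
    unfolding energy_affine(2)[OF f] by (intro cInf_lower test_energies_bdd)
  then have "1 \<le> resistance x y * (a\<^sup>2 * energy f f)"
    using Inf_test_energies_pos[OF xy ne] by (simp add: resistance_eq[OF ne] field_simps)
  then have "1 * (f y - f x)\<^sup>2 \<le> resistance x y * (a\<^sup>2 * energy f f) * (f y - f x)\<^sup>2"
    by (intro mult_right_mono) auto
  also have "\<dots> = resistance x y * energy f f * (a * (f y - f x))\<^sup>2" by (simp add: power_mult_distrib mult_ac)
  finally show ?thesis unfolding a(2) by (simp add: power2_commute)
qed

lemma resistance_leI:
  assumes "0 \<le> B" and le: "\<And>f. f \<in> energy_domain \<Longrightarrow> f x = 0 \<Longrightarrow> f y = 1 \<Longrightarrow> 1 \<le> B * energy f f"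
  shows "resistance x y \<le> B"
proof (cases "x = y")
  case False
  obtain f where "f \<in> energy_domain" "f x = 0" "f y = 1"
    using test_energies_nonempty[OF False] unfolding test_energies_def by blast
  from le[OF this] have B: "0 < B" using assms(1) by (cases "B = 0") auto
  have "1 / B \<le> Inf (test_energies x y)"
    using le B by (intro cInf_greatest test_energies_nonempty False) (auto simp: test_energies_def field_simps)
  then have "inverse (Inf (test_energies x y)) \<le> inverse (1 / B)"
    using B by (intro le_imp_inverse_le) auto
  then show ?thesis by (simp add: resistance_eq[OF False])
qed (simp add: resistance_def assms(1))

text \<open>Let \<open>f\<close> be a test function for \<open>x\<close> and \<open>z\<close>, with value \<open>c\<close> at \<open>y\<close>. Cutting \<open>f\<close> at the level \<open>c\<close> gives two functions
  with increment \<open>c\<close> from \<open>x\<close> to \<open>y\<close> and increment \<open>1 - c\<close> from \<open>y\<close> to \<open>z\<close>, whose energies add up to at most that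
  of \<open>f\<close>. With \<open>a = R(x, y)\<close> and \<open>b = R(y, z)\<close> the energy of \<open>f\<close> is therefore at least
  \<open>c\<^sup>2 / a + (1 - c)\<^sup>2 / b \<ge> 1 / (a + b)\<close>. If \<open>c\<close> is not between \<open>0\<close> and \<open>1\<close>, one of the two steps alone suffices.\<close>

lemma resistance_triangle:
  assumes x: "x \<in> F" and y: "y \<in> F" and z: "z \<in> F"
  shows "resistance x z \<le> resistance x y + resistance y z"
proof (cases "x = y \<or> y = z")
  case True
  then show ?thesis by (auto simp: resistance_def)
next
  case False
  define a b where "a = resistance x y" and "b = resistance y z"
  have ab: "0 < a" "0 < b" using False resistance_pos x y z by (auto simp: a_def b_def)
  have "resistance x z \<le> a + b"
  proof (rule resistance_leI)
    fix f assume f: "f \<in> energy_domain" "f x = 0" "f z = 1"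
    define c where "c = f y"
    note En = energy_nonneg[OF f(1)]
    have bx: "c\<^sup>2 \<le> a * energy f f" and bz: "(1 - c)\<^sup>2 \<le> b * energy f f"
      using resistance_bound[OF f(1) x y] resistance_bound[OF f(1) y z] f(2,3) power2_commute[of c 1] by (auto simp: c_def a_def b_def)
    show "1 \<le> (a + b) * energy f f"
    proof (cases "0 < c \<and> c < 1")
      case False
      then have "1 \<le> c\<^sup>2 \<or> 1 \<le> (1 - c)\<^sup>2" 
        using one_le_power[of c 2] one_le_power[of "1 - c" 2] by auto
      then show ?thesis using bx bz ab En by (auto simp: distrib_right intro: order_trans add_increasing add_increasing2)
    next
      case True
      let ?f1 = "\<lambda>z. min (f z) c" and ?f2 = "\<lambda>z. max (f z) c"
      have 1: "c\<^sup>2 \<le> a * energy ?f1 ?f1"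
        using resistance_bound[OF energy_cut(1)[OF f(1)] x y, of c] f(2) True by (simp add: a_def c_def)
      have 2: "(1 - c)\<^sup>2 \<le> b * energy ?f2 ?f2"
        using resistance_bound[OF energy_cut(2)[OF f(1)] y z, of c] f(3) True power2_commute[of c 1] by (simp add: b_def c_def max_def)
      have "c\<^sup>2 / a + (1 - c)\<^sup>2 / b \<le> energy f f"
        
      proof -
        have "c\<^sup>2 / a \<le> energy ?f1 ?f1" using 1 ab by (simp add: pos_divide_le_eq mult.commute)
        moreover have "(1 - c)\<^sup>2 / b \<le> energy ?f2 ?f2" using 2 ab by (simp add: pos_divide_le_eq mult.commute)
        ultimately show ?thesis using energy_cut(3)[OF f(1), of c] by linarith
      qed
      then have "(a + b) * (c\<^sup>2 / a + (1 - c)\<^sup>2 / b) \<le> (a + b) * energy f f" using ab by (intro mult_left_mono) auto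
      moreover have "1 \<le> (a + b) * (c\<^sup>2 / a + (1 - c)\<^sup>2 / b)"
      proof -
        have "(a + b) * (c\<^sup>2 / a + (1 - c)\<^sup>2 / b) - 1 = (b * c - a * (1 - c))\<^sup>2 / (a * b)"
          using ab by (simp add: field_simps power2_eq_square)
        moreover have "0 \<le> (b * c - a * (1 - c))\<^sup>2 / (a * b)" using ab by simp
        ultimately show ?thesis by linarith
      qed
      ultimately show ?thesis by linarith
    qed
  qed (use ab in simp)
  then show ?thesis by (simp add: a_def b_def)
qed

lemma resistance_zero_iff: "x \<in> F \<Longrightarrow> y \<in> F \<Longrightarrow> resistance x y = 0 \<longleftrightarrow> x = y"
  using resistance_pos[of x y] by (auto simp: resistance_def)

lemma resistance_cell:
  assumes w: "set w \<subseteq> {1..M}" and xy: "x \<in> cell w" "y \<in> cell w"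
  shows "resistance x y \<le> osc_const * word_weight w"
proof (rule resistance_leI)
  show "0 \<le> osc_const * word_weight w" using osc_const_pos word_weight_pos[OF w] by simp
  fix f assume f: "f \<in> energy_domain" "f x = 0" "f y = 1"
  then show "1 \<le> osc_const * word_weight w * energy f f"
    using energy_coercive_cell[OF f(1) w xy] by simp
qed

lemma resistance_le: "x \<in> F \<Longrightarrow> y \<in> F \<Longrightarrow> resistance x y \<le> osc_const"
  using resistance_cell[of "[]" x y] by (simp add: cell_def)

end

section \<open>Point evaluation at the scale of a cell\<close>

context regular_harmonic_structure
begin

lemma hausdorff_dim_pos: "hausdorff_dim > 0"
proof -
  define f where "f d = (\<Sum>i=1..M. r i powr d)" for d
  have ne: "{1..M} \<noteq> {}" using M_ge_2 by auto
  have anti: "f e < f d" if "d < e" for d e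
    unfolding f_def using weights that ne by (intro sum_strict_mono powr_less_mono') auto
  have f0: "f 0 = real M"
  proof -
    have "r i powr 0 = 1" if "i \<in> {1..M}" for i using weights[OF that] by simp
    then have "f 0 = (\<Sum>i=1..M. 1)" unfolding f_def by (intro sum.cong) auto
    then show ?thesis by simp
  qed
  have Mp: "0 < 1 / real M" using M_ge_2 by simp
  obtain k where k: "r_max ^ k < 1 / real M" using real_arch_pow_inv[OF Mp r_max(2)] by blast
  have "f (real k) \<le> (\<Sum>i=1..M. 1 / real M)"
    unfolding f_def
  proof (rule sum_mono)
    fix i assume i: "i \<in> {1..M}"
    have "r i powr real k = r i ^ k" using weights[OF i] by (simp add: powr_realpow)
    also have "\<dots> \<le> r_max ^ k" using weights[OF i] r_max(3)[OF i] by (intro power_mono) auto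
    finally show "r i powr real k \<le> 1 / real M" using k by simp
  qed
  also have "\<dots> = 1" using M_ge_2 by simp
  finally have fk: "f (real k) \<le> 1" .
  have "\<exists>d. 0 \<le> d \<and> d \<le> real k \<and> f d = 1"
  proof (rule IVT2')
    show "f (real k) \<le> 1" "1 \<le> f 0" using fk f0 M_ge_2 by auto
    have "r i \<noteq> 0" if "i \<in> {1..M}" for i using weights[OF that] by simp
    then show "continuous_on {0..real k} f" unfolding f_def[abs_def] by (intro continuous_intros) auto
  qed simp
  then obtain d where d: "0 \<le> d" "f d = 1" by blast
  then have d0: "d > 0" using f0 M_ge_2 by (cases "d = 0") auto
  have "hausdorff_dim = d" unfolding hausdorff_dim_def
  proof (rule the_equality)
    fix e assume "0 < e \<and> (\<Sum>i=1..M. r i powr e) = 1"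
    then show "e = d" using anti[of e d] anti[of d e] d(2) by (fold f_def) (cases e d rule: linorder_cases, auto)
  qed (use d d0 in \<open>simp add: f_def\<close>)
  then show ?thesis using d0 by simp
qed

text \<open>This is \<open>1 - d\<^sub>s / 2\<close>, the order of decay of the resolvent density on the diagonal.\<close>

definition resolvent_exponent :: real where
  "resolvent_exponent = 1 / (hausdorff_dim + 1)"

lemma resolvent_exponent: "0 < resolvent_exponent" "resolvent_exponent < 1" "spectral_dim / 2 = 1 - resolvent_exponent"
  using hausdorff_dim_pos by (auto simp: resolvent_exponent_def spectral_dim_def field_simps)

definition r_min :: real where "r_min = Min (r ` {1..M})"

lemma r_min: "0 < r_min" "r_min < 1" "i \<in> {1..M} \<Longrightarrow> r_min \<le> r i"
proof -
  have ne: "{1..M} \<noteq> {}" using M_ge_2 by auto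
  have "r_min \<in> r ` {1..M}" unfolding r_min_def using ne by (intro Min_in) auto
  then show "0 < r_min" "r_min < 1" using weights by auto
qed (auto simp: r_min_def)

lemma address_of_scale:
  assumes x: "x \<in> F" and \<epsilon>: "0 < \<epsilon>" "\<epsilon> \<le> 1"
  obtains n where "word_weight (address x n) \<le> \<epsilon>" "r_min * \<epsilon> \<le> word_weight (address x n)"
proof -
  have ex: "\<exists>n. word_weight (address x n) \<le> \<epsilon>"
  proof -
    obtain k where "r_max ^ k < \<epsilon>" using real_arch_pow_inv[OF \<epsilon>(1) r_max(2)] by blast
    moreover have "word_weight (address x k) \<le> r_max ^ k" using word_weight_le[OF set_address[OF x, of k]] by simp
    ultimately show ?thesis by (intro exI[of _ k]) linarith
  qed
  define n where "n = (LEAST n. word_weight (address x n) \<le> \<epsilon>)"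
  have le: "word_weight (address x n) \<le> \<epsilon>" unfolding n_def by (rule LeastI_ex[OF ex])
  have "r_min * \<epsilon> \<le> word_weight (address x n)"
  proof (cases n)
    case 0
    then show ?thesis using \<epsilon> r_min by (simp add: mult_le_one)
  next
    case (Suc m)
    have i: "letter ((tail ^^ m) x) \<in> {1..M}" by (intro letter funpow_tail_in x)
    have "\<epsilon> < word_weight (address x m)"
      using not_less_Least[of m "\<lambda>n. word_weight (address x n) \<le> \<epsilon>"] Suc unfolding n_def by simp
    then have "r_min * \<epsilon> \<le> r (letter ((tail ^^ m) x)) * word_weight (address x m)"
      using r_min(1) r_min(3)[OF i] \<epsilon> by (intro mult_mono) auto
    then show ?thesis unfolding Suc address_snoc by (simp add: mult.commute)
  qed
  then show ?thesis using that le by blast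
qed

end

context pcf_dirichlet_space
begin

lemma space_\<mu> [simp]: "space \<mu> = F"
  using sets_eq_imp_space_eq[OF borel_on_F] by (simp add: space_restrict_space)

lemma continuous_measurable: "continuous_on F f \<Longrightarrow> f \<in> borel_measurable \<mu>" for f :: "'a \<Rightarrow> real"
  using borel_measurable_continuous_on_restrict measurable_cong_sets[OF borel_on_F refl] by blast

lemma continuous_integrable:
  fixes f :: "'a \<Rightarrow> real"
  assumes f: "continuous_on F f"
  shows "integrable \<mu> f"
proof -
  interpret prob_space \<mu> by (rule prob)
  have "bounded (f ` F)" by (intro compact_imp_bounded compact_continuous_image f compact)
  then obtain B where B: "\<And>x. x \<in> F \<Longrightarrow> norm (f x) \<le> B" by (auto simp: bounded_iff)
  show ?thesis
  proof (rule integrable_const_bound[of _ B])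
    show "AE x in \<mu>. norm (f x) \<le> B" using B by (intro AE_I2) simp
  qed (rule continuous_measurable[OF f])
qed

lemma cell_sets: "set w \<subseteq> {1..M} \<Longrightarrow> cell w \<in> sets \<mu>"
proof -
  assume w: "set w \<subseteq> {1..M}"
  have "cell w \<in> sets borel" by (intro borel_closed compact_imp_closed cell_compact w)
  then have "cell w \<in> sets (restrict_space borel F)"
    using cell_subset[OF w] by (auto simp: sets_restrict_space image_iff)
  then show ?thesis using borel_on_F by simp
qed

lemma measure_cell: "set w \<subseteq> {1..M} \<Longrightarrow> measure \<mu> (cell w) = word_weight w powr hausdorff_dim"
  using self_similar_measure[of w "length w"] by (simp add: words_def)

lemma measure_cell_pos: "set w \<subseteq> {1..M} \<Longrightarrow> 0 < measure \<mu> (cell w)"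
  using word_weight_pos[of w] by (simp add: measure_cell)

text \<open>The measure charges every cell, and cells around \<open>x\<close> are arbitrarily small.\<close>

lemma continuous_eq_of_AE_eq:
  fixes f g :: "'a \<Rightarrow> real"
  assumes f: "continuous_on F f" and g: "continuous_on F g" and ae: "AE x in \<mu>. f x = g x" and x: "x \<in> F"
  shows "f x = g x"
proof (rule ccontr)
  assume ne: "f x \<noteq> g x"
  interpret prob_space \<mu> by (rule prob)
  define h where "h z = \<bar>f z - g z\<bar>" for z
  have "continuous_on F h" unfolding h_def[abs_def] using f g by (intro continuous_intros)
  moreover have "0 < h x" using ne by (simp add: h_def)
  ultimately obtain d where d: "d > 0" "\<And>y. y \<in> F \<Longrightarrow> dist y x < d \<Longrightarrow> dist (h y) (h x) < h x"
    using x unfolding continuous_on_iff by blast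
  have "eventually (\<lambda>n. ratio ^ n * diameter F < d) sequentially"
    by (rule order_tendstoD(2)[OF mesh_tendsto d(1)])
  then obtain n where n: "ratio ^ n * diameter F < d" by (auto simp: eventually_sequentially)
  let ?w = "address x n"
  have neq: "f y \<noteq> g y" if y: "y \<in> cell ?w" for y
  proof -
    obtain y' where y': "y' \<in> F" "y = word_map ?w y'" using y by (auto simp: cell_def)
    have "dist y x < d"
      using word_map_dist[OF set_address[OF x] y'(1) funpow_tail_in[OF x], of n n] n by (simp add: address_map x y'(2))
    then have "dist (h y) (h x) < h x" using d(2) y cell_subset[OF set_address[OF x]] by blast
    then show ?thesis by (auto simp: h_def dist_real_def)
  qed
  from ae obtain N where N: "{x \<in> space \<mu>. \<not> f x = g x} \<subseteq> N" "emeasure \<mu> N = 0" "N \<in> sets \<mu>"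
    unfolding eventually_ae_filter by (auto simp: null_sets_def)
  have "cell ?w \<subseteq> N" using neq N(1) cell_subset[OF set_address[OF x]] by auto
  then have "measure \<mu> (cell ?w) \<le> measure \<mu> N"
    using N(3) by (intro finite_measure_mono)
  then show False using N(2) measure_cell_pos[OF set_address[OF x], of n] by (simp add: measure_def)
qed

definition point_const :: real where
  "point_const = 2 * osc_const + 2 * r_min powr (- hausdorff_dim)"

lemma point_const_pos: "point_const > 0"
  using osc_const_pos r_min(1) by (auto simp: point_const_def intro!: add_pos_pos)

text \<open>The value at \<open>x\<close> is compared with the average over a cell of weight about \<open>\<epsilon>\<close> around \<open>x\<close>: the oscillation costs
  energy times resistance diameter, and the mass of the cell is about \<open>\<epsilon> powr hausdorff_dim\<close>.\<close>

lemma point_evaluation_bound: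
  assumes f: "f \<in> energy_domain" and x: "x \<in> F" and \<epsilon>: "0 < \<epsilon>" "\<epsilon> \<le> 1"
  shows "(f x)\<^sup>2 \<le> point_const * (\<epsilon> * energy f f + \<epsilon> powr (- hausdorff_dim) * (\<integral>y. (f y)\<^sup>2 \<partial>\<mu>))"
proof -
  interpret prob_space \<mu> by (rule prob)
  obtain n where n: "word_weight (address x n) \<le> \<epsilon>" "r_min * \<epsilon> \<le> word_weight (address x n)"
    using address_of_scale[OF x \<epsilon>] .
  define w where "w = address x n"
  have w: "set w \<subseteq> {1..M}" unfolding w_def by (rule set_address[OF x])
  let ?m = "measure \<mu> (cell w)" and ?E = "energy f f" and ?I = "\<integral>y. (f y)\<^sup>2 \<partial>\<mu>"
  have m: "0 < ?m" by (rule measure_cell_pos[OF w])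
  have [simp]: "cell w \<inter> F = cell w" using cell_subset[OF w] by blast
  have int: "integrable \<mu> (\<lambda>y. (f y)\<^sup>2)"
    by (intro continuous_integrable continuous_intros energy_domain_continuous f)
  have "(f x)\<^sup>2 * ?m = (\<integral>y. (f x)\<^sup>2 * indicator (cell w) y \<partial>\<mu>)"
    using cell_sets[OF w] by simp
  also have "\<dots> \<le> (\<integral>y. 2 * osc_const * \<epsilon> * ?E * indicator (cell w) y + 2 * (f y)\<^sup>2 \<partial>\<mu>)"
  proof (rule integral_mono)
    show "integrable \<mu> (\<lambda>y. (f x)\<^sup>2 * indicator (cell w) y)"
      "integrable \<mu> (\<lambda>y. 2 * osc_const * \<epsilon> * ?E * indicator (cell w) y + 2 * (f y)\<^sup>2)"
      using cell_sets[OF w] int by (auto simp: less_top[symmetric])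
    fix y
    show "(f x)\<^sup>2 * indicator (cell w) y \<le> 2 * osc_const * \<epsilon> * ?E * indicator (cell w) y + 2 * (f y)\<^sup>2"
    proof (cases "y \<in> cell w")
      case True
      have "(f x)\<^sup>2 \<le> 2 * (f x - f y)\<^sup>2 + 2 * (f y)\<^sup>2"
        using sum_square_le[of "f x - f y" "f y"] by simp
      also have "(f x - f y)\<^sup>2 \<le> osc_const * word_weight w * ?E"
        using True mem_cell_address[OF x] by (intro energy_coercive_cell[OF f w]) (auto simp: w_def)
      also have "\<dots> \<le> osc_const * \<epsilon> * ?E"
        using n(1) osc_const_pos energy_nonneg[OF f] by (intro mult_right_mono mult_left_mono) (auto simp: w_def)
      finally show ?thesis using True by simp
    qed simp
  qed
  also have "\<dots> = 2 * osc_const * \<epsilon> * ?E * ?m + 2 * ?I"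
    using cell_sets[OF w] int by (subst Bochner_Integration.integral_add) (auto simp: less_top[symmetric])
  finally have "(f x)\<^sup>2 \<le> 2 * osc_const * \<epsilon> * ?E + 2 * (?I / ?m)"
    using m by (simp add: field_simps)
  also have "?I / ?m \<le> (r_min powr (- hausdorff_dim) * \<epsilon> powr (- hausdorff_dim)) * ?I"
  proof -
    have "(r_min * \<epsilon>) powr hausdorff_dim \<le> ?m"
      unfolding measure_cell[OF w] using n(2) r_min \<epsilon> hausdorff_dim_pos by (intro powr_mono2) (auto simp: w_def)
    moreover have "0 < (r_min * \<epsilon>) powr hausdorff_dim" using r_min \<epsilon> by simp
    ultimately have "?I / ?m \<le> ?I / (r_min * \<epsilon>) powr hausdorff_dim"
      using m by (intro divide_left_mono) auto
    also have "\<dots> = (r_min powr (- hausdorff_dim) * \<epsilon> powr (- hausdorff_dim)) * ?I"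
      using r_min \<epsilon> by (simp add: powr_mult powr_minus field_simps)
    finally show ?thesis .
  qed
  finally have "(f x)\<^sup>2 \<le> 2 * osc_const * (\<epsilon> * ?E) + 2 * r_min powr (- hausdorff_dim) * (\<epsilon> powr (- hausdorff_dim) * ?I)"
    by (simp add: mult_ac)
  also have "\<dots> \<le> point_const * (\<epsilon> * ?E) + point_const * (\<epsilon> powr (- hausdorff_dim) * ?I)"
    using osc_const_pos energy_nonneg[OF f] \<epsilon> unfolding point_const_def
    by (intro add_mono mult_right_mono) (auto intro!: mult_nonneg_nonneg)
  finally show ?thesis by (simp add: distrib_left)
qed

lemma energy_domain_cong:
  assumes g: "g \<in> energy_domain" and eq: "\<And>x. x \<in> F \<Longrightarrow> f x = g x"
  shows "f \<in> energy_domain" "energy f h = energy g h"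
proof -
  have e: "energy_n n f h = energy_n n g h" for n h by (rule energy_n_cong) (auto simp: eq)
  have "energy_n n f f = energy_n n g g" for n by (rule energy_n_cong) (auto simp: eq)
  then show "f \<in> energy_domain" using g eq unfolding energy_domain_def by (auto cong: continuous_on_cong)
  show "energy f h = energy g h" by (simp add: energy_def e)
qed

end

section \<open>Spectral sums\<close>

locale laplace_eigenbasis = pcf_dirichlet_space M F \<psi> A r \<mu>
  for M :: nat and F :: "'a::metric_space set" and \<psi> :: "nat \<Rightarrow> 'a \<Rightarrow> 'a"
    and A :: "'a \<Rightarrow> 'a \<Rightarrow> real" and r :: "nat \<Rightarrow> real" and \<mu> :: "'a measure" +
  fixes b :: boundary_condition and lam :: "nat \<Rightarrow> real" and \<phi> :: "nat \<Rightarrow> 'a \<Rightarrow> real"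
  assumes eig: "eigenbasis b lam \<phi>"
begin

lemma lam_nonneg: "0 \<le> lam k"
  using eig incseqD[of lam 0 k] unfolding eigenbasis_def by force

lemma \<phi>_continuous: "continuous_on F (\<phi> k)"
  using eig by (simp add: eigenbasis_def)

lemma \<phi>_orthonormal: "orthonormal_on \<mu> UNIV \<phi>"
  using eig by (simp add: eigenbasis_def complete_orthonormal_basis_def)

text \<open>The operator is defined up to almost everywhere equality; since \<open>\<phi> k\<close> is continuous, it coincides on \<open>F\<close> with the
  representative in the form domain.\<close>

lemma \<phi>_weak:
  shows "\<phi> k \<in> form_domain b" and "g \<in> form_domain b \<Longrightarrow> energy (\<phi> k) g = lam k * L2_inner \<mu> (\<phi> k) g"
proof -
  have "(\<phi> k, \<lambda>x. lam k * \<phi> k x) \<in> neg_laplacian b" using eig by (simp add: eigenbasis_def)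
  then obtain f where f: "f \<in> form_domain b" "AE x in \<mu>. \<phi> k x = f x"
    "\<And>g. g \<in> form_domain b \<Longrightarrow> energy f g = L2_inner \<mu> (\<lambda>x. lam k * \<phi> k x) g"
    unfolding neg_laplacian_def by auto
  have fd: "f \<in> energy_domain" using f(1) by (simp add: form_domain_def)
  have eq: "\<phi> k x = f x" if "x \<in> F" for x
    by (rule continuous_eq_of_AE_eq[OF \<phi>_continuous energy_domain_continuous[OF fd] f(2) that])
  show "\<phi> k \<in> form_domain b"
    using f(1) energy_domain_cong(1)[OF fd eq] eq boundary_subset unfolding form_domain_def by auto
  show "energy (\<phi> k) g = lam k * L2_inner \<mu> (\<phi> k) g" if "g \<in> form_domain b"
    using f(3)[OF that] energy_domain_cong(2)[OF fd eq, of g] by (simp add: L2_inner_def mult.assoc)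
qed

lemma \<phi>_energy_domain: "\<phi> k \<in> energy_domain"
  using \<phi>_weak(1) by (simp add: form_domain_def)

definition combination :: "nat \<Rightarrow> (nat \<Rightarrow> real) \<Rightarrow> 'a \<Rightarrow> real" where
  "combination N c x = (\<Sum>k<N. c k * \<phi> k x)"

lemma combination_domain: "combination N c \<in> form_domain b" "combination N c \<in> energy_domain"
proof -
  show 1: "combination N c \<in> energy_domain"
    unfolding combination_def[abs_def] by (intro energy_domain_sum \<phi>_energy_domain) auto
  show "combination N c \<in> form_domain b"
    using 1 \<phi>_weak(1) unfolding form_domain_def by (auto simp: combination_def)
qed

lemma combination_inner:
  "L2_inner \<mu> (\<phi> j) (combination N c) = (if j < N then c j else 0)"
proof -
  have "L2_inner \<mu> (\<phi> j) (combination N c) = (\<integral>x. (\<Sum>k<N. c k * (\<phi> j x * \<phi> k x)) \<partial>\<mu>)"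
    unfolding L2_inner_def combination_def by (simp add: sum_distrib_left mult_ac)
  also have "\<dots> = (\<Sum>k<N. c k * L2_inner \<mu> (\<phi> j) (\<phi> k))"
    unfolding L2_inner_def
    by (subst Bochner_Integration.integral_sum) (auto intro!: continuous_integrable continuous_intros \<phi>_continuous)
  also have "\<dots> = (\<Sum>k<N. if k = j then c j else 0)"
    using \<phi>_orthonormal unfolding orthonormal_on_def by (intro sum.cong) auto
  finally show ?thesis by (simp add: sum.delta)
qed

lemma combination_norm: "(\<integral>x. (combination N c x)\<^sup>2 \<partial>\<mu>) = (\<Sum>k<N. (c k)\<^sup>2)"
proof -
  have cont: "continuous_on F (combination N c)" using combination_domain(2) by (rule energy_domain_continuous)
  have "(\<integral>x. (combination N c x)\<^sup>2 \<partial>\<mu>) = (\<integral>x. (\<Sum>k<N. c k * (\<phi> k x * combination N c x)) \<partial>\<mu>)"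
  proof (intro Bochner_Integration.integral_cong refl)
    fix x
    have "(combination N c x)\<^sup>2 = (\<Sum>k<N. c k * \<phi> k x) * combination N c x"
      by (simp add: power2_eq_square combination_def)
    then show "(combination N c x)\<^sup>2 = (\<Sum>k<N. c k * (\<phi> k x * combination N c x))"
      by (simp add: sum_distrib_right mult.assoc)
  qed
  also have "\<dots> = (\<Sum>k<N. c k * L2_inner \<mu> (\<phi> k) (combination N c))"
    unfolding L2_inner_def
    by (subst Bochner_Integration.integral_sum) (auto intro!: continuous_integrable continuous_intros \<phi>_continuous cont)
  finally show ?thesis by (simp add: combination_inner power2_eq_square)
qed

lemma combination_energy: "energy (combination N c) (combination N c) = (\<Sum>k<N. lam k * (c k)\<^sup>2)"
proof -
  have "energy (combination N c) (combination N c) = (\<Sum>k<N. c k * energy (\<phi> k) (combination N c))"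
    using energy_domain_sum(2)[of "{..<N}" \<phi> "combination N c" c] \<phi>_energy_domain combination_domain(2)
    by (simp add: combination_def[abs_def])
  then show ?thesis
    by (simp add: \<phi>_weak(2)[OF combination_domain(1)] combination_inner power2_eq_square mult_ac)
qed

text \<open>The sum \<open>S\<close> equals \<open>f x\<close> for the combination \<open>f\<close> with coefficients \<open>\<phi> k x / (\<Lambda> + lam k)\<close>, and it also equals
  \<open>energy f f + \<Lambda> * \<parallel>f\<parallel>\<^sup>2\<close>. The bound on point evaluations thus reads \<open>S\<^sup>2 \<le> point_const * \<epsilon> * S\<close>.\<close>

lemma resolvent_density_bound:
  assumes x: "x \<in> F" and \<Lambda>: "1 \<le> \<Lambda>"
  shows "(\<Sum>k<N. (\<phi> k x)\<^sup>2 / (\<Lambda> + lam k)) \<le> point_const * \<Lambda> powr (- resolvent_exponent)"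
proof -
  define c where "c k = \<phi> k x / (\<Lambda> + lam k)" for k
  define S where "S = (\<Sum>k<N. (\<phi> k x)\<^sup>2 / (\<Lambda> + lam k))"
  have pos: "0 < \<Lambda> + lam k" for k using \<Lambda> lam_nonneg[of k] by linarith
  let ?f = "combination N c"
  have fx: "?f x = S" by (simp add: combination_def c_def S_def power2_eq_square)
  have EI: "energy ?f ?f + \<Lambda> * (\<integral>y. (?f y)\<^sup>2 \<partial>\<mu>) = S"
    unfolding combination_energy combination_norm sum_distrib_left sum.distrib[symmetric] S_def
  proof (intro sum.cong refl)
    fix k
    have "lam k * (c k)\<^sup>2 + \<Lambda> * (c k)\<^sup>2 = (\<Lambda> + lam k) * (c k)\<^sup>2" by (simp add: algebra_simps)
    also have "\<dots> = (\<phi> k x)\<^sup>2 / (\<Lambda> + lam k)" using pos[of k] by (simp add: c_def power2_eq_square)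
    finally show "lam k * (c k)\<^sup>2 + \<Lambda> * (c k)\<^sup>2 = (\<phi> k x)\<^sup>2 / (\<Lambda> + lam k)" .
  qed
  \<comment> \<open>The scale at which the two terms of the evaluation bound balance.\<close>
  define \<epsilon> where "\<epsilon> = \<Lambda> powr (- resolvent_exponent)"
  have \<epsilon>: "0 < \<epsilon>" "\<epsilon> \<le> 1"
    using \<Lambda> resolvent_exponent powr_mono[of "- resolvent_exponent" 0 \<Lambda>] by (auto simp: \<epsilon>_def)
  have bal: "\<epsilon> powr (- hausdorff_dim) = \<epsilon> * \<Lambda>"
  proof -
    have "\<epsilon> * \<Lambda> = \<Lambda> powr (- resolvent_exponent + 1)" using \<Lambda> powr_add[of \<Lambda> "- resolvent_exponent" 1] by (simp add: \<epsilon>_def)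
    also have "- resolvent_exponent + 1 = (- resolvent_exponent) * (- hausdorff_dim)"
      using hausdorff_dim_pos by (simp add: resolvent_exponent_def field_simps)
    finally show ?thesis by (simp add: \<epsilon>_def powr_powr)
  qed
  have "S\<^sup>2 \<le> point_const * (\<epsilon> * energy ?f ?f + \<epsilon> powr (- hausdorff_dim) * (\<integral>y. (?f y)\<^sup>2 \<partial>\<mu>))"
    using point_evaluation_bound[OF combination_domain(2)[of N c] x \<epsilon>] by (simp add: fx)
  also have "\<dots> = point_const * \<epsilon> * (energy ?f ?f + \<Lambda> * (\<integral>y. (?f y)\<^sup>2 \<partial>\<mu>))"
    unfolding bal by (simp add: algebra_simps)
  finally have SS: "S * S \<le> (point_const * \<epsilon>) * S" unfolding EI by (simp add: power2_eq_square)
  have "0 \<le> S" unfolding S_def using pos by (intro sum_nonneg divide_nonneg_nonneg) (auto simp: less_imp_le)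
  then have "S \<le> point_const * \<epsilon>"
    using SS point_const_pos \<epsilon> by (cases "S = 0") (auto simp: less_le)
  then show ?thesis by (simp add: S_def \<epsilon>_def)
qed

text \<open>The same duality for the increment of \<open>f\<close> between two points, with \<open>(f x - f y)\<^sup>2 \<le> resistance x y * energy f f\<close> in
  place of the bound on evaluations.\<close>

lemma resolvent_increment_bound:
  assumes x: "x \<in> F" and y: "y \<in> F"
  shows "(\<Sum>k<N. (\<phi> k x - \<phi> k y)\<^sup>2 / (1 + lam k)) \<le> resistance x y"
proof -
  define c where "c k = (\<phi> k x - \<phi> k y) / (1 + lam k)" for k
  define S where "S = (\<Sum>k<N. (\<phi> k x - \<phi> k y)\<^sup>2 / (1 + lam k))"
  have pos: "0 < 1 + lam k" for k using lam_nonneg[of k] by linarith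
  let ?f = "combination N c"
  have "?f x - ?f y = (\<Sum>k<N. c k * (\<phi> k x - \<phi> k y))"
    by (simp add: combination_def sum_subtractf right_diff_distrib)
  then have fx: "?f x - ?f y = S" by (simp add: c_def S_def power2_eq_square)
  have "energy ?f ?f \<le> S" unfolding combination_energy S_def
  proof (intro sum_mono)
    fix k
    have "lam k * (c k)\<^sup>2 \<le> (1 + lam k) * (c k)\<^sup>2" by (intro mult_right_mono) auto
    also have "\<dots> = (\<phi> k x - \<phi> k y)\<^sup>2 / (1 + lam k)" using pos[of k] by (simp add: c_def power2_eq_square)
    finally show "lam k * (c k)\<^sup>2 \<le> (\<phi> k x - \<phi> k y)\<^sup>2 / (1 + lam k)" .
  qed
  then have "S\<^sup>2 \<le> resistance x y * S"
    using resistance_bound[OF combination_domain(2)[of N c] x y] resistance_nonneg[of x y]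
    unfolding fx by (meson mult_left_mono order_trans)
  moreover have "0 \<le> S" unfolding S_def using pos by (intro sum_nonneg divide_nonneg_nonneg) (auto simp: less_imp_le)
  ultimately have "S \<le> resistance x y"
    using resistance_nonneg[of x y] by (cases "S = 0") (auto simp: less_le power2_eq_square)
  then show ?thesis by (simp add: S_def)
qed

text \<open>Summing the bound on the resolvent density over \<open>\<Lambda> = 2 ^ j\<close> with weights \<open>2 powr (j * (1 - \<theta>))\<close> gives a
  convergent series precisely because \<open>1 - \<theta> < resolvent_exponent\<close>. Larger \<open>\<theta>\<close> than \<open>1\<close> are reduced to \<open>1\<close>.\<close>

lemma spectral_sum_bound:
  assumes \<theta>: "1 - resolvent_exponent < \<theta>"
  shows "\<exists>C\<ge>0. \<forall>N. \<forall>x\<in>F. (\<Sum>k<N. (1 + lam k) powr (- \<theta>) * (\<phi> k x)\<^sup>2) \<le> C"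
proof -
  define t where "t = min \<theta> 1"
  have t: "1 - resolvent_exponent < t" "t \<le> 1" "t \<le> \<theta>" using \<theta> resolvent_exponent by (auto simp: t_def)
  define q where "q = 2 powr (1 - t - resolvent_exponent)"
  have q: "0 < q" "q < 1" using t powr_less_mono[of "1 - t - resolvent_exponent" 0 2] by (auto simp: q_def)
  have pos: "1 \<le> 1 + lam k" for k using lam_nonneg[of k] by linarith
  have "\<exists>j. 1 + lam k \<le> 2 ^ j \<and> 2 ^ j \<le> 2 * (1 + lam k)" for k
  proof -
    have ex: "\<exists>j. 1 + lam k \<le> 2 ^ j" using real_arch_pow[of 2 "1 + lam k"] by (auto intro: less_imp_le)
    define j where "j = (LEAST j. 1 + lam k \<le> 2 ^ j)"
    have "1 + lam k \<le> 2 ^ j" unfolding j_def by (rule LeastI_ex[OF ex])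
    moreover have "2 ^ j \<le> 2 * (1 + lam k)"
    proof (cases j)
      case (Suc i)
      then have "\<not> 1 + lam k \<le> 2 ^ i" unfolding j_def using not_less_Least by (metis lessI)
      then show ?thesis using Suc by simp
    qed (use pos[of k] in simp)
    ultimately show ?thesis by blast
  qed
  then obtain J where J: "\<And>k. 1 + lam k \<le> 2 ^ J k" "\<And>k. 2 ^ J k \<le> 2 * (1 + lam k)" by metis
  \<comment> \<open>The power of \<open>1 + \<lambda>\<close> is dominated by a superposition of resolvents at dyadic points.\<close>
  have dyadic: "(1 + lam k) powr (- \<theta>) \<le> 3 * ((2 ^ J k) powr (1 - t) / (2 ^ J k + lam k))" for k
  proof -
    have "(1 + lam k) powr (- \<theta>) \<le> (1 + lam k) powr (- t)" using t pos by (intro powr_mono) auto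
    also have "\<dots> = (1 + lam k) powr (1 - t) / (1 + lam k)" 
    proof -
      have "(1 + lam k) powr (1 - t) = (1 + lam k) * (1 + lam k) powr (- t)"
        using pos[of k] powr_add[of "1 + lam k" 1 "- t"] by simp
      then show ?thesis using pos[of k] by simp
    qed
    also have "\<dots> \<le> (2 ^ J k) powr (1 - t) / (1 + lam k)"
      using t J(1)[of k] pos[of k] by (intro divide_right_mono powr_mono2) auto
    also have "\<dots> \<le> (2 ^ J k) powr (1 - t) / ((2 ^ J k + lam k) / 3)"
      using J(2)[of k] pos[of k] lam_nonneg[of k] by (intro divide_left_mono) (auto intro!: add_pos_nonneg mult_pos_pos)
    finally show ?thesis by (simp add: mult.commute)
  qed
  have "(\<Sum>k<N. (1 + lam k) powr (- \<theta>) * (\<phi> k x)\<^sup>2) \<le> 3 * point_const / (1 - q)" if x: "x \<in> F" for N x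
  proof -
    define m where "m = (\<Sum>k<N. Suc (J k))"
    have m: "J k < m" if "k < N" for k
      using member_le_sum[of k "{..<N}" "\<lambda>k. Suc (J k)"] that by (simp add: m_def)
    have "(\<Sum>k<N. (1 + lam k) powr (- \<theta>) * (\<phi> k x)\<^sup>2)
        \<le> (\<Sum>k<N. \<Sum>j<m. 3 * ((2 ^ j) powr (1 - t) * ((\<phi> k x)\<^sup>2 / (2 ^ j + lam k))))"
    proof (rule sum_mono)
      fix k assume k: "k \<in> {..<N}"
      have "(1 + lam k) powr (- \<theta>) * (\<phi> k x)\<^sup>2 \<le> 3 * ((2 ^ J k) powr (1 - t) / (2 ^ J k + lam k)) * (\<phi> k x)\<^sup>2"
        by (intro mult_right_mono dyadic) auto
      also have "\<dots> = 3 * ((2 ^ J k) powr (1 - t) * ((\<phi> k x)\<^sup>2 / (2 ^ J k + lam k)))" by simp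
      also have "\<dots> \<le> (\<Sum>j<m. 3 * ((2 ^ j) powr (1 - t) * ((\<phi> k x)\<^sup>2 / (2 ^ j + lam k))))"
        using m[of k] k lam_nonneg[of k]
        by (intro member_le_sum[of "J k" "{..<m}" "\<lambda>j. 3 * ((2 ^ j) powr (1 - t) * ((\<phi> k x)\<^sup>2 / (2 ^ j + lam k)))"]) auto
      finally show "(1 + lam k) powr (- \<theta>) * (\<phi> k x)\<^sup>2
          \<le> (\<Sum>j<m. 3 * ((2 ^ j) powr (1 - t) * ((\<phi> k x)\<^sup>2 / (2 ^ j + lam k))))" .
    qed
    also have "\<dots> = (\<Sum>j<m. 3 * ((2 ^ j) powr (1 - t) * (\<Sum>k<N. (\<phi> k x)\<^sup>2 / (2 ^ j + lam k))))"
      by (subst sum.swap) (simp add: sum_distrib_left)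
    also have "\<dots> \<le> (\<Sum>j<m. 3 * ((2 ^ j) powr (1 - t) * (point_const * (2 ^ j) powr (- resolvent_exponent))))"
      by (intro sum_mono mult_left_mono resolvent_density_bound x) auto
    also have "\<dots> = (\<Sum>j<m. 3 * point_const * q ^ j)"
    proof (intro sum.cong refl)
      fix j :: nat
      have "(2 ^ j) powr (1 - t) * (2 ^ j) powr (- resolvent_exponent) = (2 ^ j :: real) powr (1 - t - resolvent_exponent)"
        by (simp flip: powr_add)
      also have "\<dots> = q ^ j" by (simp add: q_def powr_powr mult.commute flip: powr_realpow)
      finally show "3 * ((2 ^ j) powr (1 - t) * (point_const * (2 ^ j) powr (- resolvent_exponent))) = 3 * point_const * q ^ j"
        by (simp add: mult_ac)
    qed
    also have "\<dots> = 3 * point_const * (\<Sum>j<m. q ^ j)" by (simp add: sum_distrib_left)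
    also have "\<dots> \<le> 3 * point_const * (1 / (1 - q))"
    proof (intro mult_left_mono)
      have "(\<Sum>j<m. q ^ j) = (1 - q ^ m) / (1 - q)" using q by (subst sum_gp_strict) auto
      also have "\<dots> \<le> 1 / (1 - q)" using q by (intro divide_right_mono) auto
      finally show "(\<Sum>j<m. q ^ j) \<le> 1 / (1 - q)" .
    qed (use point_const_pos in simp)
    finally show ?thesis by simp
  qed
  moreover have "0 \<le> 3 * point_const / (1 - q)" using point_const_pos q by simp
  ultimately show ?thesis by (intro exI[of _ "3 * point_const / (1 - q)"]) blast
qed

end

section \<open>Nets in space and time\<close>

context regular_harmonic_structure
begin

definition space_net :: "nat \<Rightarrow> 'a \<Rightarrow> 'a" where
  "space_net n x = word_map (address x n) base_point"

lemma card_words: "card (words M n) = M ^ n"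
proof -
  have "words M n = {w. set w \<subseteq> {1..M} \<and> length w = n}" by (auto simp: words_def)
  then show ?thesis by (simp add: card_lists_length_eq)
qed

lemma space_net_in: "x \<in> F \<Longrightarrow> space_net n x \<in> F"
  unfolding space_net_def by (rule word_map_in[OF set_address boundary_in_F[OF base_point]])

lemma space_net_dist: "x \<in> F \<Longrightarrow> resistance x (space_net n x) \<le> osc_const * r_max ^ n"
proof -
  assume x: "x \<in> F"
  have "space_net n x \<in> cell (address x n)"
    using boundary_in_F[OF base_point] by (simp add: cell_def space_net_def)
  with mem_cell_address[OF x] have "resistance x (space_net n x) \<le> osc_const * word_weight (address x n)"
    by (rule resistance_cell[OF set_address[OF x]])
  also have "\<dots> \<le> osc_const * r_max ^ n"
    using word_weight_le[OF set_address[OF x, of n]] osc_const_pos by (intro mult_left_mono) auto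
  finally show ?thesis .
qed

lemma space_net_image: "space_net n ` F \<subseteq> (\<lambda>w. word_map w base_point) ` words M n"
  by (auto simp: space_net_def address_words)

lemma card_space_net: "finite (space_net n ` F)" "card (space_net n ` F) \<le> M ^ n"
proof -
  show "finite (space_net n ` F)" by (rule finite_subset[OF space_net_image]) simp
  have "card (space_net n ` F) \<le> card ((\<lambda>w. word_map w base_point) ` words M n)"
    by (rule card_mono[OF _ space_net_image]) simp
  also have "\<dots> \<le> card (words M n)" by (rule card_image_le) simp
  finally show "card (space_net n ` F) \<le> M ^ n" by (simp add: card_words)
qed

lemma space_nets: "approximating_nets F resistance space_net osc_const r_max 1 (real M) osc_const"
proof
  show "real (card (space_net n ` F)) \<le> 1 * real M ^ n" for n
    using card_space_net(2)[of n] by (metis mult_1 of_nat_le_iff of_nat_power)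
qed (use r_max osc_const_pos M_ge_2 in \<open>auto simp: resistance_nonneg resistance_zero_iff resistance_le
    space_net_in space_net_dist card_space_net(1) intro: resistance_sym resistance_triangle\<close>)

definition time_net :: "nat \<Rightarrow> real \<Rightarrow> real" where
  "time_net n t = r_max ^ n * of_int \<lfloor>t / r_max ^ n\<rfloor>"

lemma time_net: "time_net n t \<le> t" "t < time_net n t + r_max ^ n" "0 \<le> t \<Longrightarrow> 0 \<le> time_net n t"
proof -
  have p: "0 < r_max ^ n" using r_max by simp
  have "of_int \<lfloor>t / r_max ^ n\<rfloor> \<le> t / r_max ^ n" "t / r_max ^ n < of_int \<lfloor>t / r_max ^ n\<rfloor> + 1"
    by linarith+
  then have "of_int \<lfloor>t / r_max ^ n\<rfloor> * r_max ^ n \<le> t" "t < (of_int \<lfloor>t / r_max ^ n\<rfloor> + 1) * r_max ^ n"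
    using p by (simp_all only: pos_le_divide_eq pos_divide_less_eq)
  then show "time_net n t \<le> t" "t < time_net n t + r_max ^ n"
    unfolding time_net_def by (simp_all add: algebra_simps)
  show "0 \<le> t \<Longrightarrow> 0 \<le> time_net n t" using p by (simp add: time_net_def)
qed

lemma card_time_net:
  assumes "0 < T"
  shows "finite (time_net n ` {0..T})" "real (card (time_net n ` {0..T})) \<le> (T + 1) * (1 / r_max) ^ n"
proof -
  have p: "0 < r_max ^ n" "r_max ^ n \<le> 1" using r_max by (auto simp: power_le_one)
  define k where "k = \<lfloor>T / r_max ^ n\<rfloor>"
  have k0: "0 \<le> k" using assms p by (simp add: k_def)
  have sub: "time_net n ` {0..T} \<subseteq> (\<lambda>j. r_max ^ n * of_int j) ` {0..k}"
    using p by (auto simp: time_net_def k_def intro!: imageI floor_mono divide_right_mono)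
  then show "finite (time_net n ` {0..T})" by (rule finite_subset) simp
  have "card (time_net n ` {0..T}) \<le> card ((\<lambda>j. r_max ^ n * of_int j) ` {0..k})"
    by (rule card_mono[OF _ sub]) simp
  also have "\<dots> \<le> card {0..k}" by (rule card_image_le) simp
  also have "\<dots> = nat (k + 1)" by simp
  finally have "real (card (time_net n ` {0..T})) \<le> of_int k + 1" using k0 by linarith
  also have "\<dots> \<le> T / r_max ^ n + 1 / r_max ^ n"
    using p unfolding k_def by (intro add_mono) (auto simp: pos_le_divide_eq)
  also have "\<dots> = (T + 1) * (1 / r_max) ^ n" by (simp add: power_divide add_divide_distrib)
  finally show "real (card (time_net n ` {0..T})) \<le> (T + 1) * (1 / r_max) ^ n" .
qed

definition spacetime_net :: "nat \<Rightarrow> real \<times> 'a \<Rightarrow> real \<times> 'a" where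
  "spacetime_net n = map_prod (time_net n) (space_net n)"

lemma spacetime_nets:
  assumes T: "0 < T"
  shows "approximating_nets ({0..T} \<times> F) (max_time_metric resistance) spacetime_net (1 + osc_const) r_max
           (T + 1) (real M / r_max) (T + osc_const)"
proof
  note defs = max_time_metric_def spacetime_net_def
  show "0 \<le> max_time_metric resistance x y" for x y
    by (cases x; cases y) (auto simp: defs intro: max.coboundedI1)
  show "max_time_metric resistance x y = max_time_metric resistance y x" for x y
    by (cases x; cases y) (simp add: defs resistance_sym abs_minus_commute)
  show "max_time_metric resistance x y = 0 \<longleftrightarrow> x = y" if "x \<in> {0..T} \<times> F" "y \<in> {0..T} \<times> F" for x y
  proof -
    obtain t1 x1 t2 x2 where e: "x = (t1, x1)" "y = (t2, x2)" by (meson surj_pair)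
    have "max \<bar>t1 - t2\<bar> (resistance x1 x2) = 0 \<longleftrightarrow> \<bar>t1 - t2\<bar> = 0 \<and> resistance x1 x2 = 0"
      using resistance_nonneg[of x1 x2] by linarith
    then show ?thesis using that resistance_zero_iff[of x1 x2] unfolding e defs by auto
  qed
  show "max_time_metric resistance x z \<le> max_time_metric resistance x y + max_time_metric resistance y z"
    if "x \<in> {0..T} \<times> F" "y \<in> {0..T} \<times> F" "z \<in> {0..T} \<times> F" for x y z
  proof -
    obtain t1 x1 t2 x2 t3 x3 where e: "x = (t1, x1)" "y = (t2, x2)" "z = (t3, x3)" by (meson surj_pair)
    have "resistance x1 x3 \<le> resistance x1 x2 + resistance x2 x3"
      using that unfolding e by (intro resistance_triangle) auto
    then show ?thesis unfolding e defs prod.case using abs_triangle_ineq[of "t1 - t2" "t2 - t3"] by linarith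
  qed
  show "max_time_metric resistance x y \<le> T + osc_const" if "x \<in> {0..T} \<times> F" "y \<in> {0..T} \<times> F" for x y
    using that T osc_const_pos resistance_le[of "snd x" "snd y"] by (cases x; cases y) (auto simp: defs)
  show "spacetime_net n z \<in> {0..T} \<times> F" if "z \<in> {0..T} \<times> F" for n z
    using that time_net[where n=n and t="fst z"] by (cases z) (auto simp: defs space_net_in)
  show "max_time_metric resistance z (spacetime_net n z) \<le> (1 + osc_const) * r_max ^ n" if zS: "z \<in> {0..T} \<times> F" for n z
  proof -
    obtain t x where z: "z = (t, x)" "x \<in> F" using zS by auto
    have "\<bar>t - time_net n t\<bar> \<le> r_max ^ n" using time_net[where n=n and t=t] by simp
    moreover have "resistance x (space_net n x) \<le> osc_const * r_max ^ n" by (rule space_net_dist[OF z(2)])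
    moreover have "0 \<le> r_max ^ n" "0 \<le> osc_const * r_max ^ n" using r_max osc_const_pos by auto
    ultimately show ?thesis by (simp add: z defs algebra_simps)
  qed
  have im: "spacetime_net n ` ({0..T} \<times> F) = time_net n ` {0..T} \<times> space_net n ` F" for n
    by (force simp: spacetime_net_def)
  show "finite (spacetime_net n ` ({0..T} \<times> F))" for n
    unfolding im using card_time_net(1)[OF T] card_space_net(1) by simp
  show "real (card (spacetime_net n ` ({0..T} \<times> F))) \<le> (T + 1) * (real M / r_max) ^ n" for n
  proof -
    have "real (card (spacetime_net n ` ({0..T} \<times> F))) = real (card (time_net n ` {0..T})) * real (card (space_net n ` F))"
      by (simp add: im card_cartesian_product)
    also have "\<dots> \<le> ((T + 1) * (1 / r_max) ^ n) * real M ^ n"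
    proof (intro mult_mono card_time_net(2) T)
      show "real (card (space_net n ` F)) \<le> real M ^ n"
        using card_space_net(2)[of n] by (metis of_nat_le_iff of_nat_power)
    qed (use T r_max in auto)
    finally show ?thesis by (simp add: power_divide)
  qed
  show "1 \<le> real M / r_max" using M_ge_2 r_max by (simp add: pos_le_divide_eq)
qed (use T r_max osc_const_pos in auto)

end

section \<open>The random field and its continuous version\<close>

lemma power_sum_le:
  fixes x y :: real
  shows "(x + y) ^ (2 * m) \<le> 2 ^ (2 * m) * (x ^ (2 * m) + y ^ (2 * m))"
proof -
  define z where "z = max \<bar>x\<bar> \<bar>y\<bar>"
  have "(x + y) ^ (2 * m) = \<bar>x + y\<bar> ^ (2 * m)" by (rule power_even_abs[symmetric]) simp
  also have "\<dots> \<le> (2 * z) ^ (2 * m)" by (intro power_mono) (auto simp: z_def)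
  also have "\<dots> = 2 ^ (2 * m) * z ^ (2 * m)" by (rule power_mult_distrib)
  also have "z ^ (2 * m) \<le> x ^ (2 * m) + y ^ (2 * m)"
  proof -
    have "z ^ (2 * m) = x ^ (2 * m) \<or> z ^ (2 * m) = y ^ (2 * m)"
      by (auto simp: z_def max_def power_even_abs)
    moreover have "0 \<le> x ^ (2 * m)" "0 \<le> y ^ (2 * m)" by (auto intro: zero_le_even_power)
    ultimately show ?thesis by linarith
  qed
  finally show ?thesis by simp
qed

locale stochastic_heat_field = laplace_eigenbasis M F \<psi> A r \<mu> b lam \<phi>
  for M :: nat and F :: "'a::metric_space set" and \<psi> :: "nat \<Rightarrow> 'a \<Rightarrow> 'a"
    and A :: "'a \<Rightarrow> 'a \<Rightarrow> real" and r :: "nat \<Rightarrow> real" and \<mu> :: "'a measure"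
    and b :: boundary_condition and lam :: "nat \<Rightarrow> real" and \<phi> :: "nat \<Rightarrow> 'a \<Rightarrow> real" +
  fixes \<Omega> :: "'w measure" and W :: "real \<Rightarrow> ('a \<Rightarrow> real) \<Rightarrow> 'w \<Rightarrow> real"
    and X :: "nat \<Rightarrow> real \<Rightarrow> 'w \<Rightarrow> real" and \<alpha> :: real and u :: "real \<times> 'a \<Rightarrow> 'w \<Rightarrow> real"
  assumes prob_\<Omega>: "prob_space \<Omega>"
    and cylindrical: "cylindrical_wiener_process \<Omega> \<mu> W"
    and convolution: "\<And>k t. t \<ge> 0 \<Longrightarrow>
           is_wiener_integral \<Omega> (\<lambda>s. W s (\<phi> k)) t (\<lambda>s. exp (- lam k * (t - s))) (X k t)"
    and \<alpha>: "\<alpha> \<ge> 0"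
    and series: "\<And>t x. t \<ge> 0 \<Longrightarrow> x \<in> F \<Longrightarrow>
           L2_tendsto \<Omega> (\<lambda>n \<omega>. \<Sum>k<n. (1 + lam k) powr (- \<alpha> / 2) * X k t \<omega> * \<phi> k x) (u (t, x))"
begin

lemma noise_independent: "independent_wiener_processes \<Omega> UNIV (\<lambda>k t. W t (\<phi> k))"
proof -
  have "\<forall>K e. orthonormal_on \<mu> K e \<longrightarrow> independent_wiener_processes \<Omega> K (\<lambda>k t. W t (e k))"
    using cylindrical unfolding cylindrical_wiener_process_def by (elim conjE)
  then show ?thesis using \<phi>_orthonormal by simp
qed

lemma u_measurable:
  assumes "t \<ge> 0" "x \<in> F"
  shows "u (t, x) \<in> borel_measurable \<Omega>"
  using series[OF assms] unfolding L2_tendsto_def by (elim conjE)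

text \<open>The moment of order \<open>2 * m\<close> of the standard normal distribution.\<close>

definition moment_const :: "nat \<Rightarrow> real" where
  "moment_const m = fact (2 * m) / (2 ^ m * fact m)"

lemma moment_const_nonneg: "0 \<le> moment_const m"
  by (simp add: moment_const_def)

abbreviation moment :: "nat \<Rightarrow> real \<times> 'a \<Rightarrow> real \<times> 'a \<Rightarrow> ennreal" where
  "moment m z z' \<equiv> (\<integral>\<^sup>+\<omega>. ennreal ((u z \<omega> - u z' \<omega>) ^ (2 * m)) \<partial>\<Omega>)"

lemma increment_moment:
  assumes t: "0 \<le> t" and s: "0 \<le> s" and x: "x \<in> F" and y: "y \<in> F" and m: "m > 0"
    and a: "\<And>k. a k = (1 + lam k) powr (- \<alpha> / 2) * \<phi> k x" and c: "\<And>k. c k = - ((1 + lam k) powr (- \<alpha> / 2) * \<phi> k y)"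
    and V0: "\<And>k. 0 \<le> V k"
    and V: "\<And>k. (\<integral>\<^sup>+z. ennreal ((a k * (exp (- lam k * (t - z)) * indicator {0..t} z)
          + c k * (exp (- lam k * (s - z)) * indicator {0..s} z))\<^sup>2) \<partial>lborel) \<le> ennreal (V k)"
    and v: "\<And>N. (\<Sum>k<N. V k) \<le> v"
  shows "moment m (t, x) (s, y) \<le> ennreal (moment_const m * (2 * v) ^ m)"
proof -
  let ?Z = "\<lambda>n \<omega>. (\<Sum>k<n. (1 + lam k) powr (- \<alpha> / 2) * X k t \<omega> * \<phi> k x)
      + (-1) * (\<Sum>k<n. (1 + lam k) powr (- \<alpha> / 2) * X k s \<omega> * \<phi> k y)"
  have lim: "L2_tendsto \<Omega> ?Z (\<lambda>\<omega>. u (t, x) \<omega> + (-1) * u (s, y) \<omega>)"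
    by (intro L2_tendsto_add L2_tendsto_cmult series t s x y)
  have "(\<integral>\<^sup>+\<omega>. ennreal ((u (t, x) \<omega> + (-1) * u (s, y) \<omega>) ^ (2 * m)) \<partial>\<Omega>) \<le> ennreal (moment_const m * (2 * v) ^ m)"
  proof (rule Fatou_L2_tendsto[OF lim, where b="\<lambda>_. moment_const m * (2 * v) ^ m"])
    show "\<forall>\<^sub>F n in sequentially. (\<integral>\<^sup>+\<omega>. ennreal (?Z n \<omega> ^ (2 * m)) \<partial>\<Omega>) \<le> ennreal (moment_const m * (2 * v) ^ m)"
    proof (intro always_eventually allI)
      fix n
      have "?Z n \<omega> = (\<Sum>k<n. a k * X k t \<omega> + c k * X k s \<omega>)" for \<omega>
        unfolding a c sum_distrib_left sum.distrib[symmetric] by (intro sum.cong refl) (simp add: mult_ac)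
      then have "(\<integral>\<^sup>+\<omega>. ennreal (?Z n \<omega> ^ (2 * m)) \<partial>\<Omega>) = (\<integral>\<^sup>+\<omega>. ennreal ((\<Sum>k<n. a k * X k t \<omega> + c k * X k s \<omega>) ^ (2 * m)) \<partial>\<Omega>)"
        by simp
      also have "\<dots> \<le> ennreal (fact (2 * m) / (2 ^ m * fact m) * (2 * (\<Sum>k<n. V k)) ^ m)"
        by (rule wiener_integral_moment[OF prob_\<Omega> noise_independent _ convolution[OF t] convolution[OF s] V0 V m]) simp
      also have "\<dots> \<le> ennreal (moment_const m * (2 * v) ^ m)"
        unfolding moment_const_def[symmetric]
        by (intro ennreal_leI mult_left_mono power_mono v moment_const_nonneg mult_nonneg_nonneg sum_nonneg V0) auto
      finally show "(\<integral>\<^sup>+\<omega>. ennreal (?Z n \<omega> ^ (2 * m)) \<partial>\<Omega>) \<le> ennreal (moment_const m * (2 * v) ^ m)" .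
    qed
  qed (auto intro!: continuous_intros)
  then show ?thesis by simp
qed

lemma coefficient_square: "((1 + lam k) powr (- \<alpha> / 2))\<^sup>2 = (1 + lam k) powr (- \<alpha>)"
  by (simp add: power2_eq_square flip: powr_add)

lemma coefficient_le_1: "(1 + lam k) powr (- \<alpha>) \<le> 1"
  using \<alpha> lam_nonneg[of k] powr_mono[of "- \<alpha>" 0 "1 + lam k"] by simp

lemma space_increment_moment:
  assumes t: "0 \<le> t" and x: "x \<in> F" and y: "y \<in> F" and m: "m > 0"
  shows "moment m (t, x) (t, y)
     \<le> ennreal (moment_const m * (2 * (2 * (1 + t) * resistance x y)) ^ m)"
proof (rule increment_moment[OF t t x y m refl refl])
  fix k
  let ?a = "(1 + lam k) powr (- \<alpha> / 2)" and ?d = "\<phi> k x - \<phi> k y" and ?l = "lam k"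
  let ?e = "\<lambda>z. exp (- lam k * (t - z)) * indicator {0..t} z"
  note l = lam_nonneg[of k]
  show "0 \<le> 2 * (1 + t) * (?d\<^sup>2 / (1 + lam k))" using t l by simp
  have "(\<integral>\<^sup>+z. ennreal ((?a * \<phi> k x * ?e z + - (?a * \<phi> k y) * ?e z)\<^sup>2) \<partial>lborel)
      = (\<integral>\<^sup>+z. ennreal ((?a * ?d)\<^sup>2) * ennreal ((?e z)\<^sup>2) \<partial>lborel)"
    by (intro nn_integral_cong) (simp add: algebra_simps flip: ennreal_mult power_mult_distrib)
  also have "\<dots> = ennreal ((?a * ?d)\<^sup>2) * (\<integral>\<^sup>+z. ennreal ((?e z)\<^sup>2) \<partial>lborel)"
    by (intro nn_integral_cmult) measurable
  also have "\<dots> \<le> ennreal ((?a * ?d)\<^sup>2) * ennreal (2 * t / (1 + lam k * t))"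
    by (intro mult_left_mono exp_kernel_variance l t) auto
  also have "\<dots> = ennreal ((?a * ?d)\<^sup>2 * (2 * t / (1 + lam k * t)))"
    using l t by (subst ennreal_mult) auto
  also have "\<dots> \<le> ennreal (2 * (1 + t) * (?d\<^sup>2 / (1 + lam k)))"
  proof (rule ennreal_leI)
    have "(?a * ?d)\<^sup>2 \<le> ?d\<^sup>2"
      using mult_right_mono[OF coefficient_le_1[of k], of "?d\<^sup>2"] unfolding power_mult_distrib coefficient_square by simp
    moreover have "2 * t / (1 + lam k * t) \<le> 2 * (1 + t) / (1 + lam k)"
    proof -
      have "2 * t * (1 + lam k) \<le> 2 * (1 + t) * (1 + lam k * t)"
        using l t by (simp add: algebra_simps)
      moreover have p: "0 < 1 + lam k" "0 < 1 + lam k * t" using l t by (auto intro: add_pos_nonneg)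
      ultimately show ?thesis
        by (simp only: pos_divide_le_eq[OF p(2)] times_divide_eq_left pos_le_divide_eq[OF p(1)])
    qed
    ultimately have "(?a * ?d)\<^sup>2 * (2 * t / (1 + lam k * t)) \<le> ?d\<^sup>2 * (2 * (1 + t) / (1 + lam k))"
      using l t by (intro mult_mono) auto
    then show "(?a * ?d)\<^sup>2 * (2 * t / (1 + lam k * t)) \<le> 2 * (1 + t) * (?d\<^sup>2 / (1 + lam k))"
      by (simp add: mult_ac)
  qed
  finally show "(\<integral>\<^sup>+z. ennreal ((?a * \<phi> k x * ?e z + - (?a * \<phi> k y) * ?e z)\<^sup>2) \<partial>lborel)
      \<le> ennreal (2 * (1 + t) * (?d\<^sup>2 / (1 + lam k)))" .
next
  fix N
  have "(\<Sum>k<N. 2 * (1 + t) * ((\<phi> k x - \<phi> k y)\<^sup>2 / (1 + lam k))) = 2 * (1 + t) * (\<Sum>k<N. (\<phi> k x - \<phi> k y)\<^sup>2 / (1 + lam k))"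
    by (simp add: sum_distrib_left)
  also have "\<dots> \<le> 2 * (1 + t) * resistance x y"
    using t by (intro mult_left_mono resolvent_increment_bound x y) auto
  finally show "(\<Sum>k<N. 2 * (1 + t) * ((\<phi> k x - \<phi> k y)\<^sup>2 / (1 + lam k))) \<le> 2 * (1 + t) * resistance x y" .
qed

text \<open>The power of the time difference that bounds the variance of an increment in time.\<close>

definition time_exponent :: real where
  "time_exponent = (if \<alpha> \<le> spectral_dim / 2 then resolvent_exponent else 1)"

lemma time_exponent: "0 < time_exponent" "time_exponent \<le> 1" "holder_exponent spectral_dim \<alpha> \<le> time_exponent / 2"
proof -
  show "0 < time_exponent" "time_exponent \<le> 1"
    using resolvent_exponent(1,2) by (auto simp: time_exponent_def)
  show "holder_exponent spectral_dim \<alpha> \<le> time_exponent / 2"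
  proof (cases "\<alpha> \<le> spectral_dim / 2")
    case True
    then have "holder_exponent spectral_dim \<alpha> = 1 / 2 * (1 - spectral_dim / 2)" "time_exponent = resolvent_exponent"
      by (simp_all only: time_exponent_def holder_exponent_def if_True)
    then show ?thesis unfolding resolvent_exponent(3) by simp
  next
    case False
    then show ?thesis by (simp add: time_exponent_def holder_exponent_def)
  qed
qed

text \<open>For \<open>\<alpha> \<le> spectral_dim / 2\<close> the weight \<open>(1 + lam k) powr - \<alpha>\<close> is dropped and \<open>h / (1 + lam k * h)\<close> is the resolvent weight at
  \<open>1 / h\<close>; spans longer than \<open>1\<close>, where the density bound is not available at \<open>1 / h\<close>, are reduced to the
  weight at \<open>1\<close>. For larger \<open>\<alpha>\<close> the weights \<open>(1 + lam k) powr - \<alpha>\<close> alone are summable.\<close>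

lemma time_variance_bound:
  assumes T: "0 < T"
  shows "\<exists>C\<ge>0. \<forall>h N. \<forall>x\<in>F. 0 \<le> h \<longrightarrow> h \<le> T \<longrightarrow>
     (\<Sum>k<N. (1 + lam k) powr (- \<alpha>) * (\<phi> k x)\<^sup>2 * (h / (1 + lam k * h))) \<le> C * h powr time_exponent"
proof (cases "\<alpha> \<le> spectral_dim / 2")
  case True
  let ?\<kappa> = resolvent_exponent and ?p = point_const
  have "(\<Sum>k<N. (1 + lam k) powr (- \<alpha>) * (\<phi> k x)\<^sup>2 * (h / (1 + lam k * h))) \<le> ((1 + T) * ?p) * h powr ?\<kappa>"
    if h: "0 \<le> h" "h \<le> T" and x: "x \<in> F" for h N x
  proof (cases "h = 0")
    case False
    then have hp: "0 < h" using h by simp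
    have "(\<Sum>k<N. (1 + lam k) powr (- \<alpha>) * (\<phi> k x)\<^sup>2 * (h / (1 + lam k * h))) \<le> (\<Sum>k<N. (\<phi> k x)\<^sup>2 * (h / (1 + lam k * h)))"
    proof (intro sum_mono mult_right_mono)
      fix k
      show "(1 + lam k) powr (- \<alpha>) * (\<phi> k x)\<^sup>2 \<le> (\<phi> k x)\<^sup>2"
        using mult_right_mono[OF coefficient_le_1[of k], of "(\<phi> k x)\<^sup>2"] by simp
    qed (use h lam_nonneg in \<open>auto intro!: divide_nonneg_nonneg\<close>)
    also have "\<dots> \<le> ((1 + T) * ?p) * h powr ?\<kappa>"
    proof (cases "h \<le> 1")
      case True
      have "(\<Sum>k<N. (\<phi> k x)\<^sup>2 * (h / (1 + lam k * h))) = (\<Sum>k<N. (\<phi> k x)\<^sup>2 / (1 / h + lam k))"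
        using hp by (intro sum.cong refl) (simp add: field_simps)
      also have "\<dots> \<le> ?p * (1 / h) powr (- ?\<kappa>)"
        using True hp by (intro resolvent_density_bound x) simp
      also have "(1 / h) powr (- ?\<kappa>) = h powr ?\<kappa>" using hp by (simp add: powr_divide powr_minus field_simps)
      also have "?p * h powr ?\<kappa> \<le> ((1 + T) * ?p) * h powr ?\<kappa>"
        using T point_const_pos by (intro mult_right_mono) auto
      finally show ?thesis .
    next
      case False
      have "(\<Sum>k<N. (\<phi> k x)\<^sup>2 * (h / (1 + lam k * h))) \<le> (\<Sum>k<N. h * ((\<phi> k x)\<^sup>2 / (1 + lam k)))"
      proof (rule sum_mono)
        fix k
        have "lam k * 1 \<le> lam k * h" using False lam_nonneg[of k] by (intro mult_left_mono) auto
        then have "h / (1 + lam k * h) \<le> h / (1 + lam k)"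
          using hp lam_nonneg[of k] by (intro divide_left_mono) (auto intro!: mult_pos_pos add_pos_nonneg)
        then have "(\<phi> k x)\<^sup>2 * (h / (1 + lam k * h)) \<le> (\<phi> k x)\<^sup>2 * (h / (1 + lam k))" by (intro mult_left_mono) auto
        then show "(\<phi> k x)\<^sup>2 * (h / (1 + lam k * h)) \<le> h * ((\<phi> k x)\<^sup>2 / (1 + lam k))" by (simp add: mult.commute)
      qed
      also have "\<dots> = h * (\<Sum>k<N. (\<phi> k x)\<^sup>2 / (1 + lam k))" by (simp add: sum_distrib_left)
      also have "\<dots> \<le> h * (?p * 1 powr (- ?\<kappa>))"
        using hp by (intro mult_left_mono resolvent_density_bound x) auto
      also have "\<dots> \<le> ((1 + T) * ?p) * 1" using h T point_const_pos by simp
      also have "\<dots> \<le> ((1 + T) * ?p) * h powr ?\<kappa>"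
        using T point_const_pos False resolvent_exponent by (intro mult_left_mono ge_one_powr_ge_zero) auto
      finally show ?thesis .
    qed
    finally show ?thesis .
  qed simp
  moreover have "0 \<le> (1 + T) * ?p" using T point_const_pos by simp
  ultimately show ?thesis using True by (intro exI[of _ "(1 + T) * ?p"]) (auto simp: time_exponent_def)
next
  case False
  then have "1 - resolvent_exponent < \<alpha>" using resolvent_exponent by simp
  from spectral_sum_bound[OF this] obtain C where C: "C \<ge> 0"
    "\<And>N x. x \<in> F \<Longrightarrow> (\<Sum>k<N. (1 + lam k) powr (- \<alpha>) * (\<phi> k x)\<^sup>2) \<le> C" by blast
  have "(\<Sum>k<N. (1 + lam k) powr (- \<alpha>) * (\<phi> k x)\<^sup>2 * (h / (1 + lam k * h))) \<le> C * h powr 1"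
    if h: "0 \<le> h" and x: "x \<in> F" for h N x
  proof -
    have "(\<Sum>k<N. (1 + lam k) powr (- \<alpha>) * (\<phi> k x)\<^sup>2 * (h / (1 + lam k * h))) \<le> (\<Sum>k<N. (1 + lam k) powr (- \<alpha>) * (\<phi> k x)\<^sup>2 * h)"
    proof (intro sum_mono mult_left_mono)
      fix k
      have "1 \<le> 1 + lam k * h" using h lam_nonneg[of k] by simp
      then have "h / (1 + lam k * h) \<le> h / 1" using h by (intro divide_left_mono) auto
      then show "h / (1 + lam k * h) \<le> h" by simp
    qed auto
    also have "\<dots> = (\<Sum>k<N. (1 + lam k) powr (- \<alpha>) * (\<phi> k x)\<^sup>2) * h" by (simp add: sum_distrib_right)
    also have "\<dots> \<le> C * h" using h by (intro mult_right_mono C x)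
    finally show ?thesis using h by simp
  qed
  then show ?thesis using C(1) False by (intro exI[of _ C]) (auto simp: time_exponent_def)
qed

lemma time_increment_moment:
  assumes s: "0 \<le> s" and st: "s \<le> t" and x: "x \<in> F" and m: "m > 0"
    and v: "\<And>N. (\<Sum>k<N. (1 + lam k) powr (- \<alpha>) * (\<phi> k x)\<^sup>2 * ((t - s) / (1 + lam k * (t - s)))) \<le> v"
  shows "moment m (t, x) (s, x) \<le> ennreal (moment_const m * (2 * (4 * v)) ^ m)"
proof (rule increment_moment[OF _ s x x m refl refl])
  show "0 \<le> t" using s st by simp
  fix k
  let ?a = "(1 + lam k) powr (- \<alpha> / 2) * \<phi> k x"
  let ?e = "\<lambda>t z. exp (- lam k * (t - z)) * indicator {0..t} z"
  note l = lam_nonneg[of k]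
  let ?V = "4 * ((1 + lam k) powr (- \<alpha>) * (\<phi> k x)\<^sup>2 * ((t - s) / (1 + lam k * (t - s))))"
  show "0 \<le> ?V" using st l by (intro mult_nonneg_nonneg divide_nonneg_nonneg) auto
  have "(\<integral>\<^sup>+z. ennreal ((?a * ?e t z + - ?a * ?e s z)\<^sup>2) \<partial>lborel)
      = (\<integral>\<^sup>+z. ennreal (?a\<^sup>2) * ennreal ((?e t z - ?e s z)\<^sup>2) \<partial>lborel)"
    by (intro nn_integral_cong) (simp add: algebra_simps flip: ennreal_mult power_mult_distrib)
  also have "\<dots> = ennreal (?a\<^sup>2) * (\<integral>\<^sup>+z. ennreal ((?e t z - ?e s z)\<^sup>2) \<partial>lborel)"
    by (intro nn_integral_cmult) measurable
  also have "\<dots> \<le> ennreal (?a\<^sup>2) * ennreal (4 * (t - s) / (1 + lam k * (t - s)))"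
    by (intro mult_left_mono exp_kernel_increment_variance l s st) auto
  also have "\<dots> = ennreal (?a\<^sup>2 * (4 * (t - s) / (1 + lam k * (t - s))))"
    using l st by (subst ennreal_mult) (auto intro!: divide_nonneg_nonneg)
  also have "?a\<^sup>2 * (4 * (t - s) / (1 + lam k * (t - s))) = ?V"
    unfolding power_mult_distrib coefficient_square by simp
  finally show "(\<integral>\<^sup>+z. ennreal ((?a * ?e t z + - ?a * ?e s z)\<^sup>2) \<partial>lborel) \<le> ennreal ?V" .
next
  fix N
  show "(\<Sum>k<N. 4 * ((1 + lam k) powr (- \<alpha>) * (\<phi> k x)\<^sup>2 * ((t - s) / (1 + lam k * (t - s))))) \<le> 4 * v"
    unfolding sum_distrib_left[symmetric] using v[of N] by simp
qed

text \<open>An increment is split into a time increment at \<open>x\<close> and a space increment at the earlier time. The space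
  increment has the better exponent \<open>1 / 2\<close>, which is lowered to the one in time since the space is bounded.\<close>

lemma spacetime_increment_moment:
  assumes T: "0 < T" and m: "m > 0"
  shows "\<exists>C\<ge>0. \<forall>z\<in>{0..T} \<times> F. \<forall>z'\<in>{0..T} \<times> F.
     moment m z z'
       \<le> ennreal (C * (max_time_metric resistance z z' powr (time_exponent / 2)) ^ (2 * m))"
proof -
  let ?\<kappa> = time_exponent and ?d = "max_time_metric resistance"
  obtain C where C: "C \<ge> 0" "\<And>h N x. x \<in> F \<Longrightarrow> 0 \<le> h \<Longrightarrow> h \<le> T \<Longrightarrow>
     (\<Sum>k<N. (1 + lam k) powr (- \<alpha>) * (\<phi> k x)\<^sup>2 * (h / (1 + lam k * h))) \<le> C * h powr ?\<kappa>"
    using time_variance_bound[OF T] by blast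
  define \<Delta> where "\<Delta> = T + osc_const"
  define E where "E = 2 * (2 * (1 + T) * \<Delta> powr (1 - ?\<kappa>))"
  have \<Delta>: "0 < \<Delta>" using T osc_const_pos by (simp add: \<Delta>_def)
  have E0: "0 \<le> E" using T by (simp add: E_def)
  \<comment> \<open>The two summands belong to the time and to the space increment.\<close>
  define D where "D = 2 ^ (2 * m) * (moment_const m * (8 * C) ^ m + moment_const m * E ^ m)"
  have pw: "p powr ?\<kappa> = (p powr (?\<kappa> / 2))\<^sup>2" for p :: real
    by (simp add: power2_eq_square flip: powr_add)
  \<comment> \<open>The time and the space increment at ordered times.\<close>
  have ord: "moment m (t, x) (s, y) \<le> ennreal (D * (?d (t, x) (s, y) powr (?\<kappa> / 2)) ^ (2 * m))"
    if s: "0 \<le> s" and st: "s \<le> t" and tT: "t \<le> T" and x: "x \<in> F" and y: "y \<in> F" for s t x y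
  proof -
    have t: "0 \<le> t" using s st by simp
    define \<rho> where "\<rho> = ?d (t, x) (s, y)"
    have \<rho>: "t - s \<le> \<rho>" "resistance x y \<le> \<rho>" "0 \<le> \<rho>" "\<rho> \<le> \<Delta>"
      using st s tT resistance_le[OF x y] osc_const_pos T by (auto simp: \<rho>_def max_time_metric_def \<Delta>_def)
    note [measurable] = u_measurable[OF t x] u_measurable[OF s x] u_measurable[OF s y]
    have 1: "moment m (t, x) (s, x) \<le> ennreal (moment_const m * (8 * C) ^ m * (\<rho> powr ?\<kappa>) ^ m)"
    proof -
      have "moment m (t, x) (s, x)
          \<le> ennreal (moment_const m * (2 * (4 * (C * (t - s) powr ?\<kappa>))) ^ m)"
        using st s tT by (intro time_increment_moment[OF s st x m] C x) auto
      also have "\<dots> \<le> ennreal (moment_const m * ((8 * C) * \<rho> powr ?\<kappa>) ^ m)"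
      proof (intro ennreal_leI mult_left_mono power_mono moment_const_nonneg)
        have "(t - s) powr ?\<kappa> \<le> \<rho> powr ?\<kappa>" using \<rho> st time_exponent by (intro powr_mono2) auto
        then have "(8 * C) * (t - s) powr ?\<kappa> \<le> (8 * C) * \<rho> powr ?\<kappa>" using C(1) by (intro mult_left_mono) auto
        then show "2 * (4 * (C * (t - s) powr ?\<kappa>)) \<le> 8 * C * \<rho> powr ?\<kappa>" by simp
      qed (use C(1) in auto)
      finally show ?thesis by (simp add: power_mult_distrib mult.assoc)
    qed
    have 2: "moment m (s, x) (s, y) \<le> ennreal (moment_const m * E ^ m * (\<rho> powr ?\<kappa>) ^ m)"
    proof -
      have "moment m (s, x) (s, y)
          \<le> ennreal (moment_const m * (2 * (2 * (1 + s) * resistance x y)) ^ m)"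
        by (rule space_increment_moment[OF s x y m])
      also have "\<dots> \<le> ennreal (moment_const m * (E * \<rho> powr ?\<kappa>) ^ m)"
      proof (intro ennreal_leI mult_left_mono power_mono moment_const_nonneg)
        have "\<rho> = \<rho> powr (1 - ?\<kappa>) * \<rho> powr ?\<kappa>" using \<rho>(3) by (simp flip: powr_add)
        also have "\<dots> \<le> \<Delta> powr (1 - ?\<kappa>) * \<rho> powr ?\<kappa>"
          using \<rho> time_exponent by (intro mult_right_mono powr_mono2) auto
        finally have "resistance x y \<le> \<Delta> powr (1 - ?\<kappa>) * \<rho> powr ?\<kappa>" using \<rho>(2) by simp
        then have "(1 + s) * resistance x y \<le> (1 + T) * (\<Delta> powr (1 - ?\<kappa>) * \<rho> powr ?\<kappa>)"
          using s st tT resistance_nonneg by (intro mult_mono) auto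
        moreover have "E * \<rho> powr ?\<kappa> = 4 * ((1 + T) * (\<Delta> powr (1 - ?\<kappa>) * \<rho> powr ?\<kappa>))"
          by (simp add: E_def)
        moreover have "2 * (2 * (1 + s) * resistance x y) = 4 * ((1 + s) * resistance x y)" by simp
        ultimately show "2 * (2 * (1 + s) * resistance x y) \<le> E * \<rho> powr ?\<kappa>" by linarith
      qed (use s resistance_nonneg in auto)
      finally show ?thesis by (simp add: power_mult_distrib mult.assoc)
    qed
    have "moment m (t, x) (s, y)
       \<le> (\<integral>\<^sup>+\<omega>. ennreal (2 ^ (2 * m)) * (ennreal ((u (t, x) \<omega> - u (s, x) \<omega>) ^ (2 * m)) + ennreal ((u (s, x) \<omega> - u (s, y) \<omega>) ^ (2 * m))) \<partial>\<Omega>)"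
    proof (rule nn_integral_mono)
      fix \<omega>
      let ?p = "u (t, x) \<omega> - u (s, x) \<omega>" and ?q = "u (s, x) \<omega> - u (s, y) \<omega>"
      have "(u (t, x) \<omega> - u (s, y) \<omega>) ^ (2 * m) = (?p + ?q) ^ (2 * m)" by simp
      also have "\<dots> \<le> 2 ^ (2 * m) * (?p ^ (2 * m) + ?q ^ (2 * m))" by (rule power_sum_le)
      finally have "ennreal ((u (t, x) \<omega> - u (s, y) \<omega>) ^ (2 * m)) \<le> ennreal (2 ^ (2 * m) * (?p ^ (2 * m) + ?q ^ (2 * m)))"
        by (rule ennreal_leI)
      also have "\<dots> = ennreal (2 ^ (2 * m)) * (ennreal (?p ^ (2 * m)) + ennreal (?q ^ (2 * m)))"
      proof -
        have "0 \<le> ?p ^ (2 * m)" "0 \<le> ?q ^ (2 * m)" by (auto intro: zero_le_even_power)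
        then show ?thesis by (subst ennreal_mult) (auto simp: ennreal_plus)
      qed
      finally show "ennreal ((u (t, x) \<omega> - u (s, y) \<omega>) ^ (2 * m)) \<le> ennreal (2 ^ (2 * m)) * (ennreal (?p ^ (2 * m)) + ennreal (?q ^ (2 * m)))" .
    qed
    also have "\<dots> = ennreal (2 ^ (2 * m)) * (moment m (t, x) (s, x)
        + moment m (s, x) (s, y))"
      by (subst nn_integral_cmult) (auto simp: nn_integral_add)
    also have "\<dots> \<le> ennreal (2 ^ (2 * m)) * (ennreal (moment_const m * (8 * C) ^ m * (\<rho> powr ?\<kappa>) ^ m) + ennreal (moment_const m * E ^ m * (\<rho> powr ?\<kappa>) ^ m))"
      by (intro mult_left_mono add_mono 1 2) auto
    also have "\<dots> = ennreal (2 ^ (2 * m) * (moment_const m * (8 * C) ^ m * (\<rho> powr ?\<kappa>) ^ m + moment_const m * E ^ m * (\<rho> powr ?\<kappa>) ^ m))"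
      using C(1) E0 moment_const_nonneg[of m] by (subst ennreal_mult) (auto simp: ennreal_plus)
    also have "2 ^ (2 * m) * (moment_const m * (8 * C) ^ m * (\<rho> powr ?\<kappa>) ^ m + moment_const m * E ^ m * (\<rho> powr ?\<kappa>) ^ m) = D * (\<rho> powr ?\<kappa>) ^ m"
      by (simp add: D_def algebra_simps)
    also have "(\<rho> powr ?\<kappa>) ^ m = (\<rho> powr (?\<kappa> / 2)) ^ (2 * m)" unfolding pw by (simp add: power_mult)
    finally show ?thesis by (simp add: \<rho>_def)
  qed
  show ?thesis
  proof (intro exI[of _ D] conjI ballI)
    show "0 \<le> D" using C(1) E0 moment_const_nonneg[of m] by (simp add: D_def)
    fix z z' assume zz: "z \<in> {0..T} \<times> F" "z' \<in> {0..T} \<times> F"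
    obtain t x s y where e: "z = (t, x)" "z' = (s, y)" by (meson surj_pair)
    show "moment m z z' \<le> ennreal (D * (?d z z' powr (?\<kappa> / 2)) ^ (2 * m))"
    proof (cases "s \<le> t")
      case True
      then show ?thesis using ord[of s t x y] zz unfolding e by auto
    next
      case False
      have "(u z \<omega> - u z' \<omega>) ^ (2 * m) = (u z' \<omega> - u z \<omega>) ^ (2 * m)" for \<omega>
        by (simp add: power_mult power2_commute)
      moreover have "?d z z' = ?d z' z" unfolding e by (simp add: max_time_metric_def resistance_sym abs_minus_commute)
      ultimately show ?thesis using ord[of t s y x] zz False unfolding e by auto
    qed
  qed
qed

definition u_version :: "real \<times> 'a \<Rightarrow> 'w \<Rightarrow> real" where
  "u_version z \<omega> = lim (\<lambda>n. u (spacetime_net n z) \<omega>)"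

lemma u_version_spacetime:
  assumes T: "0 < T"
  shows "AE \<omega> in \<Omega>. \<forall>\<gamma>. 0 < \<gamma> \<and> \<gamma> < time_exponent / 2 \<longrightarrow> (\<exists>C. \<forall>z\<in>{0..T} \<times> F. \<forall>z'\<in>{0..T} \<times> F.
      \<bar>u_version z \<omega> - u_version z' \<omega>\<bar> \<le> C * max_time_metric resistance z z' powr \<gamma>)"
    and "z \<in> {0..T} \<times> F \<Longrightarrow> AE \<omega> in \<Omega>. u_version z \<omega> = u z \<omega>"
proof -
  interpret N: approximating_nets "{0..T} \<times> F" "max_time_metric resistance" spacetime_net "1 + osc_const" r_max
           "T + 1" "real M / r_max" "T + osc_const" by (rule spacetime_nets[OF T])
  have \<beta>: "0 < time_exponent / 2" using time_exponent by simp
  have meas: "\<And>z. z \<in> {0..T} \<times> F \<Longrightarrow> u z \<in> borel_measurable \<Omega>"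
    using u_measurable by auto
  note mom = spacetime_increment_moment[OF T]
  show "AE \<omega> in \<Omega>. \<forall>\<gamma>. 0 < \<gamma> \<and> \<gamma> < time_exponent / 2 \<longrightarrow> (\<exists>C. \<forall>z\<in>{0..T} \<times> F. \<forall>z'\<in>{0..T} \<times> F.
      \<bar>u_version z \<omega> - u_version z' \<omega>\<bar> \<le> C * max_time_metric resistance z z' powr \<gamma>)"
    unfolding u_version_def
  proof (rule N.kolmogorov_chaining(1)[where U=u and \<Omega>=\<Omega> and \<beta>="time_exponent / 2"])
    show "0 < time_exponent / 2" by (rule \<beta>)
  qed ((rule meas | rule mom), assumption)+
  show "AE \<omega> in \<Omega>. u_version z \<omega> = u z \<omega>" if z: "z \<in> {0..T} \<times> F"
    unfolding u_version_def
  proof (rule N.kolmogorov_chaining(2)[where U=u and \<Omega>=\<Omega> and \<beta>="time_exponent / 2" and z=z])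
    show "0 < time_exponent / 2" by (rule \<beta>)
  qed ((rule z | ((rule meas | rule mom), assumption))+)
qed

text \<open>At a fixed time, chaining in space alone produces another version, with the better exponent. The two
  versions agree almost surely on the countable union of the nets, and both are continuous.\<close>

lemma u_version_space:
  assumes t: "0 \<le> t"
  shows "AE \<omega> in \<Omega>. \<forall>\<gamma>. 0 < \<gamma> \<and> \<gamma> < 1 / 2 \<longrightarrow> (\<exists>C. \<forall>x\<in>F. \<forall>y\<in>F.
      \<bar>u_version (t, x) \<omega> - u_version (t, y) \<omega>\<bar> \<le> C * resistance x y powr \<gamma>)"
proof -
  interpret N: approximating_nets F resistance space_net osc_const r_max 1 "real M" osc_const by (rule space_nets)
  define w where "w x \<omega> = lim (\<lambda>n. u (t, space_net n x) \<omega>)" for x \<omega>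
  have mom: "\<exists>C\<ge>0. \<forall>x\<in>F. \<forall>y\<in>F. moment m (t, x) (t, y)
      \<le> ennreal (C * (resistance x y powr (1 / 2)) ^ (2 * m))" if m: "m > 0" for m
  proof (intro exI[of _ "moment_const m * (4 * (1 + t)) ^ m"] conjI ballI)
    show "0 \<le> moment_const m * (4 * (1 + t)) ^ m" using t moment_const_nonneg by simp
    fix x y assume xy: "x \<in> F" "y \<in> F"
    have "(resistance x y powr (1 / 2)) ^ (2 * m) = resistance x y ^ m"
      using resistance_nonneg[of x y] by (simp add: power_mult power2_eq_square flip: powr_add)
    then show "moment m (t, x) (t, y)
      \<le> ennreal (moment_const m * (4 * (1 + t)) ^ m * (resistance x y powr (1 / 2)) ^ (2 * m))"
    proof -
      have "moment_const m * (2 * (2 * (1 + t) * resistance x y)) ^ m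
          = moment_const m * (4 * (1 + t)) ^ m * (resistance x y powr (1 / 2)) ^ (2 * m)"
        unfolding \<open>(resistance x y powr (1 / 2)) ^ (2 * m) = resistance x y ^ m\<close> mult.assoc
          power_mult_distrib[symmetric] by simp
      then show ?thesis using space_increment_moment[OF t xy m] by (simp only:)
    qed
  qed
  have w: "AE \<omega> in \<Omega>. \<forall>\<gamma>. 0 < \<gamma> \<and> \<gamma> < 1 / 2 \<longrightarrow> (\<exists>C. \<forall>x\<in>F. \<forall>y\<in>F. \<bar>w x \<omega> - w y \<omega>\<bar> \<le> C * resistance x y powr \<gamma>)"
    and wu: "\<And>x. x \<in> F \<Longrightarrow> AE \<omega> in \<Omega>. w x \<omega> = u (t, x) \<omega>"
  proof -
    have meas: "\<And>x. x \<in> F \<Longrightarrow> u (t, x) \<in> borel_measurable \<Omega>" by (rule u_measurable[OF t])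
    have \<beta>: "(0::real) < 1 / 2" by simp
    show "AE \<omega> in \<Omega>. \<forall>\<gamma>. 0 < \<gamma> \<and> \<gamma> < 1 / 2 \<longrightarrow> (\<exists>C. \<forall>x\<in>F. \<forall>y\<in>F. \<bar>w x \<omega> - w y \<omega>\<bar> \<le> C * resistance x y powr \<gamma>)"
      unfolding w_def
    proof (rule N.kolmogorov_chaining(1)[where U="\<lambda>x. u (t, x)" and \<Omega>=\<Omega> and \<beta>="1 / 2"])
      show "(0::real) < 1 / 2" by (rule \<beta>)
    qed ((rule meas | rule mom), assumption)+
    show "AE \<omega> in \<Omega>. w x \<omega> = u (t, x) \<omega>" if x: "x \<in> F" for x
      unfolding w_def
    proof (rule N.kolmogorov_chaining(2)[where U="\<lambda>x. u (t, x)" and \<Omega>=\<Omega> and \<beta>="1 / 2" and z=x])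
      show "(0::real) < 1 / 2" by (rule \<beta>)
    qed ((rule x | ((rule meas | rule mom), assumption))+)
  qed
  define Q where "Q = (\<Union>n. space_net n ` F)"
  have Q: "countable Q" unfolding Q_def by (intro countable_UN[OF countableI_type] countable_finite card_space_net(1))
  have QF: "q \<in> F" if "q \<in> Q" for q using that space_net_in by (auto simp: Q_def)
  have T: "0 < t + 1" using t by simp
  have "AE \<omega> in \<Omega>. \<forall>q\<in>Q. u_version (t, q) \<omega> = w q \<omega>"
    unfolding AE_ball_countable[OF Q]
  proof
    fix q assume "q \<in> Q"
    then have q: "q \<in> F" by (rule QF)
    then have "AE \<omega> in \<Omega>. u_version (t, q) \<omega> = u (t, q) \<omega>" using t by (intro u_version_spacetime(2)[OF T]) auto
    then show "AE \<omega> in \<Omega>. u_version (t, q) \<omega> = w q \<omega>" using wu[OF q] by eventually_elim simp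
  qed
  then show ?thesis using w u_version_spacetime(1)[OF T]
  proof eventually_elim
    case (elim \<omega>)
    \<comment> \<open>Any admissible exponents serve to pass to the limit along the nets.\<close>
    obtain C where C: "\<And>x y. x \<in> F \<Longrightarrow> y \<in> F \<Longrightarrow> \<bar>w x \<omega> - w y \<omega>\<bar> \<le> C * resistance x y powr (1 / 4)"
      using elim(2)[rule_format, of "1 / 4"] by auto
    let ?g = "time_exponent / 4"
    have g: "0 < ?g \<and> ?g < time_exponent / 2" using time_exponent(1) by simp
    from elim(3)[rule_format, OF g] obtain D where D: "\<forall>z\<in>{0..t + 1} \<times> F. \<forall>z'\<in>{0..t + 1} \<times> F.
        \<bar>u_version z \<omega> - u_version z' \<omega>\<bar> \<le> D * max_time_metric resistance z z' powr ?g"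
      by blast
    have "u_version (t, x) \<omega> = w x \<omega>" if x: "x \<in> F" for x
    proof -
      have R0: "(\<lambda>n. resistance x (space_net n x)) \<longlonglongrightarrow> 0" by (rule N.net_tendsto[OF x])
      have p0: "(\<lambda>n. c * resistance x (space_net n x) powr g) \<longlonglongrightarrow> 0" if g: "0 < g" for c g :: real
      proof -
        have "(\<lambda>n. resistance x (space_net n x) powr g) \<longlonglongrightarrow> 0 powr g"
          using g resistance_nonneg by (intro tendsto_powr2 R0 tendsto_const always_eventually) auto
        then show ?thesis by (intro tendsto_mult_right_zero) simp
      qed
      have bd: "\<bar>u_version (t, x) \<omega> - w x \<omega>\<bar>
          \<le> D * resistance x (space_net n x) powr ?g + C * resistance x (space_net n x) powr (1 / 4)" for n
      proof -
        let ?q = "space_net n x"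
        have q: "?q \<in> F" "?q \<in> Q" using x by (auto simp: Q_def space_net_in)
        have "\<bar>u_version (t, x) \<omega> - u_version (t, ?q) \<omega>\<bar> \<le> D * resistance x ?q powr ?g"
        proof -
          have "\<bar>u_version (t, x) \<omega> - u_version (t, ?q) \<omega>\<bar> \<le> D * max_time_metric resistance (t, x) (t, ?q) powr ?g"
            by (rule bspec[OF bspec[OF D]]) (use x q t in auto)
          then show ?thesis using resistance_nonneg[of x ?q] by (simp add: max_time_metric_def)
        qed
        moreover have "u_version (t, ?q) \<omega> = w ?q \<omega>" using elim(1) q by blast
        moreover have "\<bar>w x \<omega> - w ?q \<omega>\<bar> \<le> C * resistance x ?q powr (1 / 4)" by (rule C[OF x q(1)])
        ultimately show ?thesis by linarith
      qed
      have "(\<lambda>n. D * resistance x (space_net n x) powr ?g + C * resistance x (space_net n x) powr (1 / 4)) \<longlonglongrightarrow> 0 + 0"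
        using time_exponent by (intro tendsto_add p0) auto
      then have "\<bar>u_version (t, x) \<omega> - w x \<omega>\<bar> \<le> 0 + 0"
        using bd by (intro LIMSEQ_le_const) auto
      then show ?thesis by simp
    qed
    then show ?case using elim(2) by simp
  qed
qed

theorem u_version_holder:
  fixes t T :: real
  shows "is_version_on \<Omega> ({0..} \<times> F) u_version u"
  "0 < T \<Longrightarrow> AE \<omega> in \<Omega>. essentially_holder (holder_exponent spectral_dim \<alpha>) ({0..T} \<times> F)
                         (max_time_metric resistance) (\<lambda>z. u_version z \<omega>)"
  "0 \<le> t \<Longrightarrow> AE \<omega> in \<Omega>. essentially_holder (1/2) F resistance (\<lambda>x. u_version (t, x) \<omega>)"
proof -
  show "is_version_on \<Omega> ({0..} \<times> F) u_version u"
    unfolding is_version_on_def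
  proof (intro ballI conjI)
    fix z :: "real \<times> 'a" assume z: "z \<in> {0..} \<times> F"
    then obtain t x where tx: "z = (t, x)" "0 \<le> t" "x \<in> F" by auto
    have T: "0 < t + 1" using tx by simp
    have "u (spacetime_net n z) \<in> borel_measurable \<Omega>" for n
      using tx time_net(3) space_net_in by (auto simp: spacetime_net_def intro!: u_measurable)
    then show "u_version z \<in> borel_measurable \<Omega>"
      unfolding u_version_def[abs_def] by (rule borel_measurable_lim_metric)
    show "AE \<omega> in \<Omega>. u_version z \<omega> = u z \<omega>"
      using tx by (intro u_version_spacetime(2)[OF T]) auto
  qed
  show "AE \<omega> in \<Omega>. essentially_holder (holder_exponent spectral_dim \<alpha>) ({0..T} \<times> F)
                         (max_time_metric resistance) (\<lambda>z. u_version z \<omega>)" if T: "0 < T"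
  proof -
    interpret N: approximating_nets "{0..T} \<times> F" "max_time_metric resistance" spacetime_net "1 + osc_const" r_max
           "T + 1" "real M / r_max" "T + osc_const" by (rule spacetime_nets[OF T])
    show ?thesis using u_version_spacetime(1)[OF T]
    proof eventually_elim
      case (elim \<omega>)
      show ?case
        by (rule Metric_space.essentially_holderI[OF N.metric_space, where \<delta>'="time_exponent / 2"])
          (use time_exponent elim in auto)
    qed
  qed
  show "AE \<omega> in \<Omega>. essentially_holder (1/2) F resistance (\<lambda>x. u_version (t, x) \<omega>)" if t: "0 \<le> t"
  proof -
    interpret N: approximating_nets F resistance space_net osc_const r_max 1 "real M" osc_const by (rule space_nets)
    show ?thesis using u_version_space[OF t]
    proof eventually_elim
      case (elim \<omega>)
      show ?case
        by (rule Metric_space.essentially_holderI[OF N.metric_space, where \<delta>'="1 / 2"]) (use elim in auto)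
    qed
  qed
qed

end

theorem theorem5p6:
  fixes M :: nat and F :: "'a::metric_space set" and \<psi> :: "nat \<Rightarrow> 'a \<Rightarrow> 'a"
    and A :: "'a \<Rightarrow> 'a \<Rightarrow> real" and r :: "nat \<Rightarrow> real" and \<mu> :: "'a measure"
    and b :: boundary_condition and lam :: "nat \<Rightarrow> real" and \<phi> :: "nat \<Rightarrow> 'a \<Rightarrow> real"
    and \<Omega> :: "'w measure" and W :: "real \<Rightarrow> ('a \<Rightarrow> real) \<Rightarrow> 'w \<Rightarrow> real"
    and X :: "nat \<Rightarrow> real \<Rightarrow> 'w \<Rightarrow> real"
    and \<alpha> :: real and u :: "real \<times> 'a \<Rightarrow> 'w \<Rightarrow> real"
  defines "R \<equiv> weighted_pcf_set.resistance M F \<psi> A r"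
    and "d\<^sub>s \<equiv> weighted_pcf_set.spectral_dim M r"
  assumes "pcf_dirichlet_space M F \<psi> A r \<mu>"
    and "pcf_dirichlet_space.eigenbasis M F \<psi> A r \<mu> b lam \<phi>"
    and "prob_space \<Omega>"
    and "cylindrical_wiener_process \<Omega> \<mu> W"
    and "\<And>k t. t \<ge> 0 \<Longrightarrow>
           is_wiener_integral \<Omega> (\<lambda>s. W s (\<phi> k)) t (\<lambda>s. exp (- lam k * (t - s))) (X k t)"
    and "\<alpha> \<ge> 0"
    and "\<And>t x. t \<ge> 0 \<Longrightarrow> x \<in> F \<Longrightarrow>
           L2_tendsto \<Omega> (\<lambda>n \<omega>. \<Sum>k<n. (1 + lam k) powr (- \<alpha> / 2) * X k t \<omega> * \<phi> k x) (u (t, x))"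
  shows "\<exists>v. is_version_on \<Omega> ({0..} \<times> F) v u \<and>
     (\<forall>T>0. AE \<omega> in \<Omega>. essentially_holder (holder_exponent d\<^sub>s \<alpha>) ({0..T} \<times> F)
                         (max_time_metric R) (\<lambda>z. v z \<omega>)) \<and>
     (\<forall>t\<ge>0. AE \<omega> in \<Omega>. essentially_holder (1/2) F R (\<lambda>x. v (t, x) \<omega>))"
proof -
  interpret H: stochastic_heat_field M F \<psi> A r \<mu> b lam \<phi> \<Omega> W X \<alpha> u
  proof (intro stochastic_heat_field.intro laplace_eigenbasis.intro laplace_eigenbasis_axioms.intro
        stochastic_heat_field_axioms.intro)
  qed (rule assms(3-) | assumption)+
  show ?thesis
    unfolding R_def d\<^sub>s_def using H.u_version_holder by (intro exI[of _ H.u_version]) blast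
qed

end
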